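(* Let $A\subseteq\overline{\mathbb{Q}}$ be a subset such that $A\cap\mathbb{Q}$ is coinfinite in $\mathbb{Q}$ (i.e. $\mathbb{Q}\setminus A$ is infinite) and $A\cap\mathbb{Q}$ is not thin as a subset of $\mathbb{Q}$. For $L\in\operatorname{Sub}(\overline{\mathbb{Q}})$ write $A_L=A\cap L$. Then the class $$\mathcal{U}_A=\{L\in\operatorname{Sub}(\overline{\mathbb{Q}}) : A_L\text{ is universally definable in }L\}$$ is meager in $\operatorname{Sub}(\overline{\mathbb{Q}})$.
   Context: $\operatorname{Sub}(\overline{\mathbb{Q}})$ is the set of all subfields of a fixed algebraic closure $\overline{\mathbb{Q}}$ of $\mathbb{Q}$. It is regarded as a subset of the power set $2^{\overline{\mathbb{Q}}}$ (identifying subsets with characteristic functions) and carries the topology inherited from the product topology; a basis is given by the sets $U_{\vec a,\vec b}=\{L : a_1,\dots,a_n\in L,\ b_1,\dots,b_k\notin L\}$ for finite tuples $\vec a,\vec b$ from $\overline{\mathbb{Q}}$. A set is meager if it is a countable union of nowhere dense sets. Definability: a subset $C\subseteq L$ is universally (resp. existentially) definable in the field $L$ if it is the set of $x\in L$ satisfying in $L$ a formula $\forall \vec Y\,\phi(X,\vec Y)$ (resp. $\exists\vec Y\,\phi(X,\vec Y)$), where $\phi$ is a quantifier-free formula in the language of rings with parameters from $L$. Thin sets (Serre): for a field $K$ of characteristic $0$ and $n\ge1$, a subset $T\subseteq K^n=\mathbb{A}^n(K)$ is thin if it is contained in a finite union of sets each of which is either (1) $V(K)$ for a proper Zariski-closed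 $V\subsetneq\mathbb{A}^n_K$, or (2) $\pi(W(K))$, where $W$ is an irreducible $K$-variety of dimension $n$ and $\pi:W\to\mathbb{A}^n_K$ is a dominant morphism of degree at least $2$. *)

theory Defs
  imports
    "HOL-Analysis.Function_Topology"
    "HOL-Algebra.Algebra"
    "HOL-Algebra.Algebraic_Closure_Type"
begin

section \<open>The space of subfields and meagerness\<close>

text \<open>
  The algebraic closure of the rationals is a type \<open>'a\<close> of class \<open>{alg_closed_field, field_char_0}\<close>
  all of whose elements are \<open>algebraic\<close>; \<open>\<rat> :: 'a set\<close> is its prime field.
\<close>

definition subfields :: "'a::field set set" where
  "subfields = {L. subfield L (ring_of_type_algebra :: 'a ring)}"

text \<open>Subsets are identified with their characteristic functions \<open>'a \<Rightarrow> bool\<close>.\<close>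

definition subfield_topology :: "'a::field set topology" where
  "subfield_topology =
     pullback_topology subfields (\<lambda>L x. x \<in> L)
       (product_topology (\<lambda>_. discrete_topology (UNIV :: bool set)) UNIV)"

definition nowhere_dense_in :: "'b topology \<Rightarrow> 'b set \<Rightarrow> bool" where
  "nowhere_dense_in T S \<longleftrightarrow> S \<subseteq> topspace T \<and> T interior_of (T closure_of S) = {}"

definition meager_in :: "'b topology \<Rightarrow> 'b set \<Rightarrow> bool" where
  "meager_in T S \<longleftrightarrow> (\<exists>N :: nat \<Rightarrow> 'b set. (\<forall>i. nowhere_dense_in T (N i)) \<and> S = (\<Union>i. N i))"


section \<open>Universal definability in the language of rings\<close>

datatype 'a rterm =
    RVar nat
  | RParam 'a
  | RZero
  | ROne
  | RNeg "'a rterm"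
  | RAdd "'a rterm" "'a rterm"
  | RMult "'a rterm" "'a rterm"

datatype 'a qf_formula =
    QEq "'a rterm" "'a rterm"
  | QNot "'a qf_formula"
  | QAnd "'a qf_formula" "'a qf_formula"
  | QOr "'a qf_formula" "'a qf_formula"

primrec rterm_vars :: "'a rterm \<Rightarrow> nat set" where
  "rterm_vars (RVar i) = {i}"
| "rterm_vars (RParam c) = {}"
| "rterm_vars RZero = {}"
| "rterm_vars ROne = {}"
| "rterm_vars (RNeg s) = rterm_vars s"
| "rterm_vars (RAdd s t) = rterm_vars s \<union> rterm_vars t"
| "rterm_vars (RMult s t) = rterm_vars s \<union> rterm_vars t"

primrec qf_vars :: "'a qf_formula \<Rightarrow> nat set" where
  "qf_vars (QEq s t) = rterm_vars s \<union> rterm_vars t"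
| "qf_vars (QNot \<phi>) = qf_vars \<phi>"
| "qf_vars (QAnd \<phi> \<psi>) = qf_vars \<phi> \<union> qf_vars \<psi>"
| "qf_vars (QOr \<phi> \<psi>) = qf_vars \<phi> \<union> qf_vars \<psi>"

text \<open>
  The ring operations of a subfield are those of the ambient field, so terms and quantifier-free
  formulas are evaluated there; only the quantifier in \<open>universally_definable\<close> depends on the
  subfield.
\<close>

primrec rterm_val :: "(nat \<Rightarrow> 'a) \<Rightarrow> 'a::field rterm \<Rightarrow> 'a" where
  "rterm_val e (RVar i) = e i"
| "rterm_val e (RParam c) = c"
| "rterm_val e RZero = 0"
| "rterm_val e ROne = 1"
| "rterm_val e (RNeg s) = - rterm_val e s"
| "rterm_val e (RAdd s t) = rterm_val e s + rterm_val e t"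
| "rterm_val e (RMult s t) = rterm_val e s * rterm_val e t"

primrec qf_sat :: "(nat \<Rightarrow> 'a) \<Rightarrow> 'a::field qf_formula \<Rightarrow> bool" where
  "qf_sat e (QEq s t) \<longleftrightarrow> rterm_val e s = rterm_val e t"
| "qf_sat e (QNot \<phi>) \<longleftrightarrow> \<not> qf_sat e \<phi>"
| "qf_sat e (QAnd \<phi> \<psi>) \<longleftrightarrow> qf_sat e \<phi> \<and> qf_sat e \<psi>"
| "qf_sat e (QOr \<phi> \<psi>) \<longleftrightarrow> qf_sat e \<phi> \<or> qf_sat e \<psi>"

text \<open>
  Variable \<open>0\<close> is \<open>X\<close> and variables \<open>1, \<dots>, k\<close> are \<open>Y\<close>; \<open>set_qf_formula \<phi>\<close> is the set of
  parameters of \<open>\<phi>\<close>.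
\<close>

definition universally_definable :: "'a::field set \<Rightarrow> 'a set \<Rightarrow> bool" where
  "universally_definable L C \<longleftrightarrow>
     (\<exists>k \<phi>. set_qf_formula \<phi> \<subseteq> L \<and> qf_vars \<phi> \<subseteq> {..k} \<and>
        C = {x \<in> L. \<forall>ys. length ys = k \<and> set ys \<subseteq> L \<longrightarrow> qf_sat (\<lambda>i. (x # ys) ! i) \<phi>})"


section \<open>Varieties over a field\<close>

text \<open>
  An irreducible variety over a field \<open>K\<close> (an integral separated scheme of finite type) is given as
  a model in the sense of Zariski and Samuel: a function field \<open>F\<close>, with structure map
  \<open>\<iota> : K \<rightarrow> F\<close>, together with the set \<open>M\<close> of the local rings of the variety, which are subrings
  of \<open>F\<close>. The points of the variety are the members of \<open>M\<close>.
\<close>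

definition local_ring_at :: "('f, 'b) ring_scheme \<Rightarrow> 'f set \<Rightarrow> 'f set \<Rightarrow> 'f set" where
  "local_ring_at F R p = {x \<in> carrier F. \<exists>a\<in>R. \<exists>s\<in>R - p. x \<otimes>\<^bsub>F\<^esub> s = a}"

text \<open>The spectrum of a subring \<open>R\<close> of \<open>F\<close>, each prime replaced by its local ring.\<close>

definition affine_model :: "('f, 'b) ring_scheme \<Rightarrow> 'f set \<Rightarrow> 'f set set" where
  "affine_model F R = {local_ring_at F R p | p. primeideal p (F\<lparr>carrier := R\<rparr>)}"

definition max_ideal_of :: "('f, 'b) ring_scheme \<Rightarrow> 'f set \<Rightarrow> 'f set" where
  "max_ideal_of F O' = O' - Units (F\<lparr>carrier := O'\<rparr>)"

definition valuation_subring :: "('f, 'b) ring_scheme \<Rightarrow> 'f set \<Rightarrow> bool" where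
  "valuation_subring F V \<longleftrightarrow>
     subring V F \<and> (\<forall>x\<in>carrier F - {\<zero>\<^bsub>F\<^esub>}. x \<in> V \<or> inv\<^bsub>F\<^esub> x \<in> V)"

definition dominates :: "('f, 'b) ring_scheme \<Rightarrow> 'f set \<Rightarrow> 'f set \<Rightarrow> bool" where
  "dominates F V O' \<longleftrightarrow> O' \<subseteq> V \<and> max_ideal_of F O' \<subseteq> max_ideal_of F V"

text \<open>
  The rings in \<open>\<A>\<close> are the coordinate rings of a finite affine open cover. The last condition
  (at most one point for each valuation) is separatedness.
\<close>

definition irreducible_variety ::
    "('k, 'a) ring_scheme \<Rightarrow> ('f, 'b) ring_scheme \<Rightarrow> ('k \<Rightarrow> 'f) \<Rightarrow> 'f set set \<Rightarrow> bool" where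
  "irreducible_variety K F \<iota> M \<longleftrightarrow>
     field F \<and> \<iota> \<in> ring_hom K F \<and>
     (\<exists>\<A>. finite \<A> \<and> \<A> \<noteq> {} \<and> M = (\<Union>R\<in>\<A>. affine_model F R) \<and>
        (\<forall>R\<in>\<A>. (\<exists>G. finite G \<and> G \<subseteq> carrier F \<and> R = generate_ring F (\<iota> ` carrier K \<union> G)) \<and>
                  generate_field F R = carrier F)) \<and>
     (\<forall>O1\<in>M. \<forall>O2\<in>M. \<forall>V. valuation_subring F V \<and> dominates F V O1 \<and> dominates F V O2 \<longrightarrow> O1 = O2)"

text \<open>The rings of polynomials in the variables \<open>0, \<dots>, n - 1\<close>, in the library's encoding of
  monomials as multisets of variables.\<close>

definition polys :: "('k, 'a) ring_scheme \<Rightarrow> nat \<Rightarrow> (nat multiset \<Rightarrow> 'k) set" where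
  "polys K n = ring.indexed_pset K {..<n} (carrier K)"

definition poly_value ::
    "('k, 'a) ring_scheme \<Rightarrow> ('f, 'b) ring_scheme \<Rightarrow> ('k \<Rightarrow> 'f) \<Rightarrow> (nat multiset \<Rightarrow> 'k) \<Rightarrow> 'f list \<Rightarrow> 'f"
  where
  "poly_value K F \<iota> p xs =
     finsum F (\<lambda>m. \<iota> (p m) \<otimes>\<^bsub>F\<^esub> finprod F (\<lambda>i. xs ! i [^]\<^bsub>F\<^esub> count m i) (set_mset m))
       {m. p m \<noteq> \<zero>\<^bsub>K\<^esub>}"

definition alg_independent ::
    "('k, 'a) ring_scheme \<Rightarrow> ('f, 'b) ring_scheme \<Rightarrow> ('k \<Rightarrow> 'f) \<Rightarrow> 'f list \<Rightarrow> bool" where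
  "alg_independent K F \<iota> ts \<longleftrightarrow>
     set ts \<subseteq> carrier F \<and>
     (\<forall>p\<in>polys K (length ts). poly_value K F \<iota> p ts = \<zero>\<^bsub>F\<^esub> \<longrightarrow> p = (\<lambda>_. \<zero>\<^bsub>K\<^esub>))"

definition generated_subfield ::
    "('k, 'a) ring_scheme \<Rightarrow> ('f, 'b) ring_scheme \<Rightarrow> ('k \<Rightarrow> 'f) \<Rightarrow> 'f list \<Rightarrow> 'f set" where
  "generated_subfield K F \<iota> ts = generate_field F (\<iota> ` carrier K \<union> set ts)"

text \<open>The dimension of a variety is the transcendence degree of its function field.\<close>

definition has_trdeg ::
    "('k, 'a) ring_scheme \<Rightarrow> ('f, 'b) ring_scheme \<Rightarrow> ('k \<Rightarrow> 'f) \<Rightarrow> nat \<Rightarrow> bool" where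
  "has_trdeg K F \<iota> n \<longleftrightarrow>
     (\<exists>ts. length ts = n \<and> alg_independent K F \<iota> ts \<and>
        (\<forall>x\<in>carrier F. \<not> ring.transcendental F (generated_subfield K F \<iota> ts) x))"

text \<open>
  A morphism to affine \<open>n\<close>-space is an \<open>n\<close>-tuple of global sections, and these are the elements
  of \<open>F\<close> that belong to every local ring.
\<close>

definition morphism_to_affine :: "'f set set \<Rightarrow> nat \<Rightarrow> 'f list \<Rightarrow> bool" where
  "morphism_to_affine M n ts \<longleftrightarrow> length ts = n \<and> set ts \<subseteq> \<Inter>M"

text \<open>
  The closure of the image is the zero set of the polynomials \<open>p\<close> for which the function \<open>p(ts)\<close>
  on the variety vanishes, that is, is the zero element of \<open>F\<close>; the morphism is dominant if there
  are no such \<open>p\<close> other than \<open>0\<close>.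
\<close>

definition dominant ::
    "('k, 'a) ring_scheme \<Rightarrow> ('f, 'b) ring_scheme \<Rightarrow> ('k \<Rightarrow> 'f) \<Rightarrow> 'f list \<Rightarrow> bool" where
  "dominant K F \<iota> ts \<longleftrightarrow> alg_independent K F \<iota> ts"

text \<open>The degree of a dominant morphism \<open>ts\<close> is the degree of \<open>F\<close> over \<open>K(ts)\<close>.\<close>

definition has_degree ::
    "('k, 'a) ring_scheme \<Rightarrow> ('f, 'b) ring_scheme \<Rightarrow> ('k \<Rightarrow> 'f) \<Rightarrow> 'f list \<Rightarrow> nat \<Rightarrow> bool" where
  "has_degree K F \<iota> ts d \<longleftrightarrow> ring.dimension F d (generated_subfield K F \<iota> ts) (carrier F)"

definition affine_space :: "('k, 'a) ring_scheme \<Rightarrow> nat \<Rightarrow> 'k list set" where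
  "affine_space K n = {as. length as = n \<and> set as \<subseteq> carrier K}"

definition rational_points ::
    "('k, 'a) ring_scheme \<Rightarrow> ('f, 'b) ring_scheme \<Rightarrow> ('k \<Rightarrow> 'f) \<Rightarrow> 'f set set \<Rightarrow> 'f set set" where
  "rational_points K F \<iota> M =
     {O'\<in>M. \<forall>x\<in>O'. \<exists>c\<in>carrier K. x \<ominus>\<^bsub>F\<^esub> \<iota> c \<in> max_ideal_of F O'}"

text \<open>The image of a rational point has as coordinates the residues of the components of \<open>ts\<close>.\<close>

definition image_of_rational_points ::
    "('k, 'a) ring_scheme \<Rightarrow> ('f, 'b) ring_scheme \<Rightarrow> ('k \<Rightarrow> 'f) \<Rightarrow> 'f set set \<Rightarrow> nat \<Rightarrow> 'f list \<Rightarrow> 'k list set"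
  where
  "image_of_rational_points K F \<iota> M n ts =
     {as \<in> affine_space K n. \<exists>O'\<in>rational_points K F \<iota> M.
        \<forall>i<n. ts ! i \<ominus>\<^bsub>F\<^esub> \<iota> (as ! i) \<in> max_ideal_of F O'}"


section \<open>Thin sets\<close>

text \<open>
  The closed subscheme of affine \<open>n\<close>-space cut out by \<open>S\<close> is proper iff \<open>S\<close> contains a nonzero
  polynomial.
\<close>

definition thin_type1 :: "('k, 'a) ring_scheme \<Rightarrow> nat \<Rightarrow> 'k list set \<Rightarrow> bool" where
  "thin_type1 K n Z \<longleftrightarrow>
     (\<exists>S \<subseteq> polys K n. (\<exists>p\<in>S. p \<noteq> (\<lambda>_. \<zero>\<^bsub>K\<^esub>)) \<and>
        Z = {as \<in> affine_space K n. \<forall>p\<in>S. poly_value K K (\<lambda>c. c) p as = \<zero>\<^bsub>K\<^esub>})"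

text \<open>
  The carrier of \<open>F\<close> is taken from the type \<open>'k\<close> of elements of \<open>K\<close>. For infinite \<open>K\<close> this is no
  restriction up to isomorphism, since a finitely generated extension field of \<open>K\<close> has the
  cardinality of \<open>K\<close>.
\<close>

definition thin_type2 :: "('k, 'a) ring_scheme \<Rightarrow> nat \<Rightarrow> 'k list set \<Rightarrow> bool" where
  "thin_type2 K n Z \<longleftrightarrow>
     (\<exists>(F :: 'k ring) \<iota> M ts d.
        irreducible_variety K F \<iota> M \<and> has_trdeg K F \<iota> n \<and>
        morphism_to_affine M n ts \<and> dominant K F \<iota> ts \<and>
        has_degree K F \<iota> ts d \<and> d \<ge> 2 \<and>
        Z = image_of_rational_points K F \<iota> M n ts)"

definition thin :: "('k, 'a) ring_scheme \<Rightarrow> nat \<Rightarrow> 'k list set \<Rightarrow> bool" where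
  "thin K n T \<longleftrightarrow>
     T \<subseteq> affine_space K n \<and>
     (\<exists>\<C>. finite \<C> \<and> T \<subseteq> \<Union>\<C> \<and> (\<forall>Z\<in>\<C>. thin_type1 K n Z \<or> thin_type2 K n Z))"

definition rational_field :: "'a::field_char_0 ring" where
  "rational_field = ring_of_type_algebra\<lparr>carrier := \<rat>\<rparr>"

end

theory Submission
  imports Defs
begin

text \<open>
  Fix a quantifier-free formula \<open>\<phi>\<close>. The fields \<open>L\<close> in which \<open>\<forall>Y. \<phi>(X, Y)\<close> defines \<open>A \<inter> L\<close> form a nowhere
  dense set, and there are only countably many formulas. To see this, let \<open>L\<close> be such a field and \<open>D\<close> a finite
  set. At every rational outside \<open>A\<close>, hence at infinitely many rationals, \<open>\<phi>\<close> fails for some \<open>Y\<close> in \<open>L\<close>. In an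
  ultrapower these failures form a generic point of a variety over \<open>L\<close> that dominates the line; freezing a
  transcendence basis at one of the \<open>L\<close>-points and lifting the remaining coordinates by Hensel's lemma yields a
  failure of \<open>\<phi>\<close> at \<open>X = c + t\<close> with coordinates in \<open>L[[t]]\<close> that are algebraic over \<open>\<rat>(t)\<close>. The field which
  they generate together with the elements of \<open>D \<inter> L\<close> contains no element of \<open>D - L\<close>, because a constant
  in \<open>L((t))\<close> lies in \<open>L\<close>.

  Since \<open>A \<inter> \<rat>\<close> is not thin, it contains a sequence that leaves every thin set. In the ultrapower this sequence is
  an element \<open>x\<close> such that \<open>\<rat>(x)\<close> is relatively algebraically closed in the ultrapower \<open>\<rat>*\<close> of \<open>\<rat>\<close>: a rational
  point on an irreducible curve of degree at least \<open>2\<close> over the line would put the sequence into a thin set.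
  Hence \<open>\<rat>*\<close> is linearly disjoint from every algebraic extension of \<open>\<rat>(x)\<close>. Transporting the power series solution
  along \<open>c + t \<mapsto> x\<close> and taking components of the ultrapower gives a rational in \<open>A\<close> at which \<open>\<phi>\<close> fails over a field \<open>F\<close>
  with \<open>F \<inter> D = L \<inter> D\<close>. This failure persists in all fields close to \<open>F\<close>.
\<close>

section \<open>Polynomials over a subring\<close>

text \<open>Over \<open>L\<close> itself the formula holds at every point of
  \<open>A \<inter> L\<close>, so a failure over \<open>A\<close> must live in a field other than
  \<open>L\<close> that still agrees with \<open>L\<close> on \<open>D\<close>. Two sequences of
  rationals serve this purpose. The one outside \<open>A\<close> has only to be infinite; the one
  inside \<open>A\<close> carries the non-thinness. Power series are the meeting place: their
  coefficients remember \<open>L\<close>, while being algebraic over the constants and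
  \<open>t\<close> allows them to be re-embedded over any transcendental \<open>x\<close>. This is
  why transcendental coordinates have to be frozen. A primitive element over \<rat>(x) is
  represented by a sequence of algebraic numbers, and the field sought is generated by one entry of
  it. Linear disjointness is what controls \<open>D\<close>: an unwanted element that occurs for
  almost all entries is pushed down from coefficients in the ultrapower of \<rat> to coefficients in
  \<rat>(x), where power series can see it. The failure is finally attached to a rational
  \<open>x\<close> because rationals lie in every field: a nearby field only has to contain finitely
  many coordinates.\<close>

definition ring_closed :: "'b::idom set \<Rightarrow> bool" where
  "ring_closed R \<longleftrightarrow> 1 \<in> R \<and> (\<forall>x\<in>R. \<forall>y\<in>R. x - y \<in> R \<and> x * y \<in> R)"

lemma ring_closed_UNIV: "ring_closed UNIV"
  by (simp add: ring_closed_def)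

lemma ring_closed_1: "ring_closed R \<Longrightarrow> 1 \<in> R"
  and ring_closed_diff: "ring_closed R \<Longrightarrow> x \<in> R \<Longrightarrow> y \<in> R \<Longrightarrow> x - y \<in> R"
  and ring_closed_mult: "ring_closed R \<Longrightarrow> x \<in> R \<Longrightarrow> y \<in> R \<Longrightarrow> x * y \<in> R"
  by (auto simp: ring_closed_def)

lemma ring_closed_0: "ring_closed R \<Longrightarrow> 0 \<in> R"
  using ring_closed_diff[of R 1 1] by (simp add: ring_closed_1)

lemma ring_closed_uminus: "ring_closed R \<Longrightarrow> x \<in> R \<Longrightarrow> - x \<in> R"
  using ring_closed_diff[of R 0 x] by (simp add: ring_closed_0)

lemma ring_closed_add: "ring_closed R \<Longrightarrow> x \<in> R \<Longrightarrow> y \<in> R \<Longrightarrow> x + y \<in> R"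
  using ring_closed_diff[of R x "- y"] by (simp add: ring_closed_uminus)

lemma ring_closed_sum: "ring_closed R \<Longrightarrow> (\<And>i. i \<in> I \<Longrightarrow> f i \<in> R) \<Longrightarrow> sum f I \<in> R"
  by (induction I rule: infinite_finite_induct) (auto simp: ring_closed_0 ring_closed_add)

lemma ring_closed_power: "ring_closed R \<Longrightarrow> x \<in> R \<Longrightarrow> x ^ n \<in> R"
  by (induction n) (auto simp: ring_closed_1 ring_closed_mult)

lemma ring_closed_of_nat: "ring_closed R \<Longrightarrow> of_nat n \<in> R"
  by (induction n) (auto simp: ring_closed_1 ring_closed_0 ring_closed_add)

lemmas ring_closed_intros = ring_closed_0 ring_closed_1 ring_closed_diff ring_closed_mult
  ring_closed_uminus ring_closed_add ring_closed_sum ring_closed_power ring_closed_of_nat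

section \<open>Polynomials with coefficients in a subring, and the ring generated by one more
  element\<close>

definition coeffs_in :: "'b::idom set \<Rightarrow> 'b poly \<Rightarrow> bool" where
  "coeffs_in R p \<longleftrightarrow> (\<forall>i. coeff p i \<in> R)"

context
  fixes R :: "'b::idom set"
  assumes R: "ring_closed R"
begin

lemma coeffs_in_0: "coeffs_in R 0"
  and coeffs_in_pCons: "c \<in> R \<Longrightarrow> coeffs_in R p \<Longrightarrow> coeffs_in R (pCons c p)"
  and coeffs_in_smult: "c \<in> R \<Longrightarrow> coeffs_in R p \<Longrightarrow> coeffs_in R (smult c p)"
  and coeffs_in_add: "coeffs_in R p \<Longrightarrow> coeffs_in R q \<Longrightarrow> coeffs_in R (p + q)"
  and coeffs_in_diff: "coeffs_in R p \<Longrightarrow> coeffs_in R q \<Longrightarrow> coeffs_in R (p - q)"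
  and coeffs_in_uminus: "coeffs_in R p \<Longrightarrow> coeffs_in R (- p)"
  and coeffs_in_monom: "c \<in> R \<Longrightarrow> coeffs_in R (monom c n)"
  and coeffs_in_mult: "coeffs_in R p \<Longrightarrow> coeffs_in R q \<Longrightarrow> coeffs_in R (p * q)"
  and coeffs_in_pderiv: "coeffs_in R p \<Longrightarrow> coeffs_in R (pderiv p)"
  using R by (auto simp: coeffs_in_def coeff_pCons coeff_mult coeff_pderiv simp del: of_nat_Suc
      intro!: ring_closed_intros split: nat.splits)

lemma coeffs_in_1: "coeffs_in R 1"
  using R by (auto simp: coeffs_in_def ring_closed_0 ring_closed_1)

lemma coeffs_in_poly: "coeffs_in R p \<Longrightarrow> x \<in> R \<Longrightarrow> poly p x \<in> R"
  using R by (auto simp: coeffs_in_def poly_altdef intro!: ring_closed_intros)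

lemma coeffs_in_pcompose: "coeffs_in R p \<Longrightarrow> coeffs_in R q \<Longrightarrow> coeffs_in R (pcompose p q)"
proof (induction p)
  case (pCons a p)
  have "a \<in> R" "coeffs_in R p"
    using pCons.prems(1) unfolding coeffs_in_def by (metis coeff_pCons_0, metis coeff_pCons_Suc)
  then show ?case
    using pCons by (auto simp: pcompose_pCons intro!: coeffs_in_add coeffs_in_mult coeffs_in_pCons coeffs_in_0)
qed (simp add: coeffs_in_0)

end

lemmas coeffs_in_intros = coeffs_in_0 coeffs_in_1 coeffs_in_pCons coeffs_in_smult coeffs_in_add
  coeffs_in_diff coeffs_in_uminus coeffs_in_monom coeffs_in_mult coeffs_in_pderiv coeffs_in_pcompose

lemma coeffs_in_pCons_iff: "coeffs_in R (pCons a p) \<longleftrightarrow> a \<in> R \<and> coeffs_in R p"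
  unfolding coeffs_in_def by (auto simp: coeff_pCons split: nat.splits)

lemma coeffs_in_UNIV: "coeffs_in UNIV p"
  by (simp add: coeffs_in_def)

lemma coeffs_in_mono: "coeffs_in R p \<Longrightarrow> R \<subseteq> S \<Longrightarrow> coeffs_in S p"
  by (auto simp: coeffs_in_def)

definition adjoin :: "'b::idom set \<Rightarrow> 'b \<Rightarrow> 'b set" where
  "adjoin R y = {poly p y | p. coeffs_in R p}"

lemma adjoinI: "coeffs_in R p \<Longrightarrow> poly p y \<in> adjoin R y"
  by (auto simp: adjoin_def)

lemma ring_closed_adjoin:
  assumes "ring_closed R"
  shows "ring_closed (adjoin R y)"
  unfolding ring_closed_def adjoin_def
proof (safe)
  show "\<exists>p. 1 = poly p y \<and> coeffs_in R p"
    by (rule exI[of _ 1]) (simp add: coeffs_in_1 assms)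
next
  fix p q assume "coeffs_in R p" "coeffs_in R q"
  then show "\<exists>pa. poly p y - poly q y = poly pa y \<and> coeffs_in R pa"
    by (intro exI[of _ "p - q"]) (simp add: coeffs_in_diff assms)
next
  fix p q assume "coeffs_in R p" "coeffs_in R q"
  then show "\<exists>pa. poly p y * poly q y = poly pa y \<and> coeffs_in R pa"
    by (intro exI[of _ "p * q"]) (simp add: coeffs_in_mult assms)
qed

lemma adjoin_superset: "ring_closed R \<Longrightarrow> R \<subseteq> adjoin R y"
proof
  fix x assume "ring_closed R" "x \<in> R"
  then have "poly [:x:] y \<in> adjoin R y"
    by (intro adjoinI coeffs_in_intros)
  then show "x \<in> adjoin R y" by simp
qed

lemma adjoin_self: "ring_closed R \<Longrightarrow> y \<in> adjoin R y"
proof -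
  assume "ring_closed R"
  then have "poly [:0, 1:] y \<in> adjoin R y"
    by (intro adjoinI coeffs_in_intros ring_closed_intros)
  then show ?thesis by simp
qed

lemma adjoin_least: "ring_closed S \<Longrightarrow> R \<subseteq> S \<Longrightarrow> y \<in> S \<Longrightarrow> adjoin R y \<subseteq> S"
  by (auto simp: adjoin_def intro!: coeffs_in_poly intro: coeffs_in_mono)

text \<open>\<open>H\<close> is a total function that is constrained on \<open>R\<close> only. The
  partial homomorphisms built later grow by one generator at a time, and \<open>R\<close> grows with
  them.\<close>

definition ring_hom_on :: "'b::idom set \<Rightarrow> ('b \<Rightarrow> 'c::idom) \<Rightarrow> bool" where
  "ring_hom_on R H \<longleftrightarrow> H 1 = 1 \<and> (\<forall>x\<in>R. \<forall>y\<in>R. H (x - y) = H x - H y \<and> H (x * y) = H x * H y)"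

context
  fixes R :: "'b::idom set" and H :: "'b \<Rightarrow> 'c::idom"
  assumes R: "ring_closed R" and H: "ring_hom_on R H"
begin

lemma hom_on_1: "H 1 = 1"
  and hom_on_diff: "x \<in> R \<Longrightarrow> y \<in> R \<Longrightarrow> H (x - y) = H x - H y"
  and hom_on_mult: "x \<in> R \<Longrightarrow> y \<in> R \<Longrightarrow> H (x * y) = H x * H y"
  using H by (auto simp: ring_hom_on_def)

lemma hom_on_0: "H 0 = 0"
  using hom_on_diff[of 1 1] by (simp add: ring_closed_1[OF R])

lemma hom_on_uminus: "x \<in> R \<Longrightarrow> H (- x) = - H x"
  using hom_on_diff[of 0 x] by (simp add: hom_on_0 ring_closed_0[OF R])

lemma hom_on_add: "x \<in> R \<Longrightarrow> y \<in> R \<Longrightarrow> H (x + y) = H x + H y"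
  using hom_on_diff[of x "- y"] by (simp add: hom_on_uminus ring_closed_uminus[OF R])

lemma hom_on_sum: "(\<And>i. i \<in> I \<Longrightarrow> f i \<in> R) \<Longrightarrow> H (sum f I) = (\<Sum>i\<in>I. H (f i))"
  by (induction I rule: infinite_finite_induct) (auto simp: hom_on_0 hom_on_add ring_closed_sum[OF R])

lemma hom_on_power: "x \<in> R \<Longrightarrow> H (x ^ n) = H x ^ n"
  by (induction n) (auto simp: hom_on_1 hom_on_mult ring_closed_power[OF R])

lemma hom_on_image: "ring_closed (H ` R)"
  unfolding ring_closed_def
proof (intro conjI ballI)
  show "1 \<in> H ` R" using hom_on_1 ring_closed_1[OF R] by (metis imageI)
  fix x y assume "x \<in> H ` R" "y \<in> H ` R"
  then show "x - y \<in> H ` R" "x * y \<in> H ` R"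
    using hom_on_diff hom_on_mult ring_closed_diff[OF R] ring_closed_mult[OF R]
    by (smt (verit, best) image_iff)+
qed

lemma coeff_map_hom: "coeff (map_poly H p) i = H (coeff p i)"
  by (simp add: coeff_map_poly hom_on_0)

lemma map_poly_hom_diff:
  "coeffs_in R p \<Longrightarrow> coeffs_in R q \<Longrightarrow> map_poly H (p - q) = map_poly H p - map_poly H q"
  by (auto simp: poly_eq_iff coeff_map_hom coeffs_in_def hom_on_diff)

lemma map_poly_hom_add:
  "coeffs_in R p \<Longrightarrow> coeffs_in R q \<Longrightarrow> map_poly H (p + q) = map_poly H p + map_poly H q"
  by (auto simp: poly_eq_iff coeff_map_hom coeffs_in_def hom_on_add)

lemma map_poly_hom_mult:
  "coeffs_in R p \<Longrightarrow> coeffs_in R q \<Longrightarrow> map_poly H (p * q) = map_poly H p * map_poly H q"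
  by (auto simp: poly_eq_iff coeff_map_hom coeffs_in_def coeff_mult hom_on_sum hom_on_mult ring_closed_mult[OF R])

lemma map_poly_hom_smult:
  "c \<in> R \<Longrightarrow> coeffs_in R p \<Longrightarrow> map_poly H (smult c p) = smult (H c) (map_poly H p)"
  by (auto simp: poly_eq_iff coeff_map_hom coeffs_in_def hom_on_mult)

lemma map_poly_hom_pderiv:
  "coeffs_in R p \<Longrightarrow> map_poly H (pderiv p) = pderiv (map_poly H p)"
proof -
  have "H (of_nat n) = of_nat n" for n
    by (induction n) (auto simp: hom_on_0 hom_on_1 hom_on_add ring_closed_intros R)
  then show "coeffs_in R p \<Longrightarrow> map_poly H (pderiv p) = pderiv (map_poly H p)"
    by (auto simp: poly_eq_iff coeff_map_hom coeffs_in_def coeff_pderiv hom_on_mult ring_closed_of_nat[OF R]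
        simp del: of_nat_Suc)
qed

lemma poly_map_hom:
  assumes "coeffs_in R p" "x \<in> R"
  shows "poly (map_poly H p) (H x) = H (poly p x)"
proof -
  have "coeffs_in R p \<Longrightarrow> poly (map_poly H p) (H x) = H (poly p x)"
  proof (induction p)
    case (pCons a p)
    then have "a \<in> R" "coeffs_in R p" by (auto simp: coeffs_in_pCons_iff)
    moreover from this have "poly p x \<in> R" by (intro coeffs_in_poly R assms)
    ultimately show ?case
      using pCons.IH assms(2) by (auto simp: map_poly_pCons hom_on_0 hom_on_add hom_on_mult ring_closed_mult[OF R])
  qed (simp add: hom_on_0)
  then show ?thesis using assms by simp
qed

text \<open>Two polynomials over \<open>R\<close> with the same value at \<open>y\<close> differ by
  a relation of \<open>y\<close>. As \<open>z\<close> satisfies the image of every relation, the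
  value at \<open>z\<close> does not depend on the polynomial chosen.\<close>

lemma hom_on_adjoin:
  assumes "\<And>p. coeffs_in R p \<Longrightarrow> poly p y = 0 \<Longrightarrow> poly (map_poly H p) z = 0"
  obtains H' where "ring_hom_on (adjoin R y) H'" "\<And>x. x \<in> R \<Longrightarrow> H' x = H x" "H' y = z"
    "\<And>p. coeffs_in R p \<Longrightarrow> H' (poly p y) = poly (map_poly H p) z"
proof -
  define H' where "H' x = (let p = (SOME p. coeffs_in R p \<and> poly p y = x) in poly (map_poly H p) z)" for x
  have H': "H' (poly p y) = poly (map_poly H p) z" if p: "coeffs_in R p" for p
  proof -
    define q where "q = (SOME q. coeffs_in R q \<and> poly q y = poly p y)"
    have "\<exists>q. coeffs_in R q \<and> poly q y = poly p y" using p by auto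
    then have q: "coeffs_in R q" "poly q y = poly p y"
      unfolding q_def by (metis (mono_tags, lifting) someI_ex)+
    have "poly (map_poly H (q - p)) z = 0"
      using q p by (intro assms coeffs_in_diff[OF R]) auto
    then have "poly (map_poly H q) z = poly (map_poly H p) z"
      using q p by (simp add: map_poly_hom_diff)
    then show ?thesis by (simp add: H'_def q_def[symmetric])
  qed
  show ?thesis
  proof
    show H'R: "H' x = H x" if "x \<in> R" for x
      using H'[of "[:x:]"] that by (simp add: coeffs_in_intros R map_poly_pCons hom_on_0)
    show "H' y = z"
      using H'[of "[:0,1:]"] by (simp add: coeffs_in_intros ring_closed_intros R map_poly_pCons hom_on_0 hom_on_1)
    show "ring_hom_on (adjoin R y) H'"
      unfolding ring_hom_on_def
    proof (safe)
      show "H' 1 = 1" using H'R[of 1] by (simp add: hom_on_1 ring_closed_1[OF R])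
    next
      fix a b assume "a \<in> adjoin R y" "b \<in> adjoin R y"
      then obtain p q where pq: "a = poly p y" "coeffs_in R p" "b = poly q y" "coeffs_in R q"
        by (auto simp: adjoin_def)
      show "H' (a - b) = H' a - H' b"
        using H'[of "p - q"] pq by (simp add: coeffs_in_diff R H' map_poly_hom_diff)
      show "H' (a * b) = H' a * H' b"
        using H'[of "p * q"] pq by (simp add: coeffs_in_mult R H' map_poly_hom_mult)
    qed
  qed (use H' in auto)
qed

end

lemma ring_hom_on_id: "ring_hom_on R (\<lambda>x. x)"
  by (simp add: ring_hom_on_def)

text \<open>The leading coefficient of \<open>g\<close> may have no inverse in \<open>R\<close>, so
  \<open>p\<close> is multiplied by it once per reduction step and \<open>N\<close> counts the
  steps. The same division then serves subfields, term rings and polynomials over \<rat>.\<close>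

lemma pseudo_division_in:
  fixes g :: "'b::idom poly"
  assumes R: "ring_closed R" and g: "coeffs_in R g" "g \<noteq> 0" and p: "coeffs_in R p"
  shows "\<exists>N q r. coeffs_in R q \<and> coeffs_in R r \<and> smult (lead_coeff g ^ N) p = g * q + r \<and>
           (r = 0 \<or> degree r < degree g)"
  using p
proof (induction "degree p" arbitrary: p rule: less_induct)
  case less
  have lc: "lead_coeff g \<in> R" "lead_coeff p \<in> R" using g less.prems by (auto simp: coeffs_in_def)
  show ?case
  proof (cases "degree p < degree g \<or> p = 0")
    case True
    then show ?thesis
      using less.prems by (intro exI[of _ 0] exI[of _ p]) (auto intro: coeffs_in_0 R)
  next
    case False
    define t where "t = monom (lead_coeff p) (degree p - degree g)"
    define p' where "p' = smult (lead_coeff g) p - g * t"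
    have p'R: "coeffs_in R p'" and tR: "coeffs_in R t"
      unfolding p'_def t_def using lc less.prems g(1) by (auto intro!: coeffs_in_intros R)
    have deg: "degree p' \<le> degree p" 
      unfolding p'_def t_def using False g(2)
      by (intro degree_diff_le order.trans[OF degree_smult_le] order.trans[OF degree_mult_le])
         (auto simp: degree_monom_eq)
    have "coeff (g * t) (degree p) = lead_coeff g * lead_coeff p"
      using False by (simp add: t_def mult.commute[of g] coeff_monom_mult)
    then have c0: "coeff p' (degree p) = 0" by (simp add: p'_def)
    have "p' = 0 \<or> degree p' < degree p"
      using deg c0 by (metis le_neq_implies_less leading_coeff_0_iff)
    then consider "p' = 0" | "degree p' < degree p" by blast
    then show ?thesis
    proof cases
      case 1
      then have "smult (lead_coeff g ^ 1) p = g * t + 0" by (simp add: p'_def)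
      then show ?thesis using tR coeffs_in_0[OF R] by metis
    next
      case 2
      from less.hyps[OF 2 p'R] obtain N q r where
        qr: "coeffs_in R q" "coeffs_in R r" "smult (lead_coeff g ^ N) p' = g * q + r"
          "r = 0 \<or> degree r < degree g" by blast
      have "smult (lead_coeff g ^ Suc N) p = smult (lead_coeff g ^ N) (p' + g * t)"
        by (simp add: p'_def mult.commute)
      also have "\<dots> = g * (q + smult (lead_coeff g ^ N) t) + r"
        using qr by (simp add: smult_add_right algebra_simps)
      finally show ?thesis
        using qr tR lc by (intro exI[of _ "Suc N"] exI[of _ "q + smult (lead_coeff g ^ N) t"] exI[of _ r])
          (auto intro!: coeffs_in_intros ring_closed_intros R)
    qed
  qed
qed

section \<open>Relations of least degree and their specialisations\<close>

definition annihilates :: "'b::idom set \<Rightarrow> 'b \<Rightarrow> 'b poly \<Rightarrow> bool" where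
  "annihilates R y p \<longleftrightarrow> coeffs_in R p \<and> p \<noteq> 0 \<and> poly p y = 0"

definition alg_over :: "'b::idom set \<Rightarrow> 'b \<Rightarrow> bool" where
  "alg_over R y \<longleftrightarrow> (\<exists>p. annihilates R y p)"

text \<open>The minimal polynomial of \<open>y\<close> over the fraction field of \<open>R\<close>,
  up to a nonzero factor. It is not made monic, which explains the powers of its leading coefficient
  below.\<close>

definition min_annihilator :: "'b::idom set \<Rightarrow> 'b \<Rightarrow> 'b poly \<Rightarrow> bool" where
  "min_annihilator R y g \<longleftrightarrow> annihilates R y g \<and> (\<forall>p. annihilates R y p \<longrightarrow> degree g \<le> degree p)"

lemma min_annihilator_exists: "alg_over R y \<Longrightarrow> \<exists>g. min_annihilator R y g"
  unfolding alg_over_def min_annihilator_def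
  using ex_has_least_nat[of "annihilates R y" _ degree] by blast

lemma min_annihilatorD:
  assumes "min_annihilator R y g"
  shows "coeffs_in R g" "g \<noteq> 0" "poly g y = 0"
    "\<And>p. coeffs_in R p \<Longrightarrow> poly p y = 0 \<Longrightarrow> degree p < degree g \<Longrightarrow> p = 0"
  using assms by (auto simp: min_annihilator_def annihilates_def dest: leD)

lemma min_annihilator_degree: "min_annihilator R y g \<Longrightarrow> degree g > 0"
  using min_annihilatorD[of R y g] by (metis degree_0_id neq0_conv of_nat_0 pCons_eq_0_iff poly_pCons mult_zero_right add_0_right poly_0 degree_eq_zeroE)

lemma min_annihilator_divides:
  fixes g :: "'b::idom poly"
  assumes R: "ring_closed R" and g: "min_annihilator R y g" and p: "coeffs_in R p" "poly p y = 0"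
  shows "\<exists>N q. coeffs_in R q \<and> smult (lead_coeff g ^ N) p = g * q"
proof -
  note g' = min_annihilatorD[OF g]
  obtain N q r where qr: "coeffs_in R q" "coeffs_in R r" "smult (lead_coeff g ^ N) p = g * q + r"
          "r = 0 \<or> degree r < degree g"
    using pseudo_division_in[OF R g'(1,2) p(1)] by blast
  have "poly r y = 0"
    using arg_cong[OF qr(3), of "\<lambda>p. poly p y"] p g' by simp
  then have "r = 0" using qr g'(4) by blast
  then show ?thesis using qr by auto
qed

text \<open>In characteristic 0 the derivative of a nonconstant polynomial is nonzero and of smaller
  degree, so minimality forbids it to vanish at \<open>y\<close>. This separability later supplies
  the simple root for Hensel lifting.\<close>

lemma min_annihilator_pderiv:
  fixes g :: "'b::{idom,ring_char_0} poly"
  assumes R: "ring_closed R" and g: "min_annihilator R y g"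
  shows "poly (pderiv g) y \<noteq> 0"
proof
  assume "poly (pderiv g) y = 0"
  moreover have "degree (pderiv g) < degree g"
    using min_annihilator_degree[OF g] by (simp add: degree_pderiv)
  ultimately have "pderiv g = 0"
    using min_annihilatorD[OF g] R by (metis coeffs_in_pderiv)
  then show False using min_annihilator_degree[OF g] by (simp add: pderiv_eq_0_iff)
qed

text \<open>After multiplication by a power of the leading coefficient, every relation
  \<open>p\<close> of \<open>y\<close> is a multiple of \<open>g\<close>. If \<open>H\<close> does
  not kill that coefficient, the image of \<open>p\<close> vanishes wherever the image of
  \<open>g\<close> does.\<close>

lemma specialise_root:
  fixes g :: "'b::idom poly" and H :: "'b \<Rightarrow> 'c::idom"
  assumes R: "ring_closed R" and H: "ring_hom_on R H" and g: "min_annihilator R y g"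
    and lc: "H (lead_coeff g) \<noteq> 0" and z: "poly (map_poly H g) z = 0"
    and p: "coeffs_in R p" "poly p y = 0"
  shows "poly (map_poly H p) z = 0"
proof -
  note g' = min_annihilatorD[OF g]
  have lR: "lead_coeff g \<in> R" using g' by (simp add: coeffs_in_def)
  obtain N q where q: "coeffs_in R q" "smult (lead_coeff g ^ N) p = g * q"
    using min_annihilator_divides[OF R g p] by blast
  have "smult (H (lead_coeff g) ^ N) (map_poly H p) = map_poly H g * map_poly H q"
    using arg_cong[OF q(2), of "map_poly H"] map_poly_hom_mult[OF R H g'(1) q(1)]
      map_poly_hom_smult[OF R H ring_closed_power[OF R lR, of N] p(1)] hom_on_power[OF R H lR, of N]
    by metis
  from arg_cong[OF this, of "\<lambda>p. poly p z"] show ?thesis using z lc by simp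
qed

text \<open>For injective \<open>H\<close>, a root of the image of \<open>g\<close> satisfies no new
  relations. A relation \<open>h\<close> of \<open>z\<close> of least degree divides a multiple of
  \<open>g\<close>, with a cofactor too short to vanish at \<open>y\<close>; hence \<open>h\<close>
  vanishes at \<open>y\<close>, and so does everything that \<open>h\<close> divides.\<close>

lemma conjugate_minimal:
  fixes g :: "'b::idom poly" and H :: "'b \<Rightarrow> 'c::idom"
  assumes R: "ring_closed R" and H: "ring_hom_on R H" and inj: "\<And>x. x \<in> R \<Longrightarrow> H x = 0 \<Longrightarrow> x = 0"
    and g: "min_annihilator R y g" and z: "poly (map_poly H g) z = 0"
    and p: "coeffs_in R p" "poly (map_poly H p) z = 0"
  shows "poly p y = 0"
proof -
  note g' = min_annihilatorD[OF g]
  define I where "I h \<longleftrightarrow> coeffs_in R h \<and> h \<noteq> 0 \<and> poly (map_poly H h) z = 0" for h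
  have "I g" using g' z by (simp add: I_def)
  then obtain h where h: "I h" "\<And>h'. I h' \<Longrightarrow> degree h \<le> degree h'"
    using ex_has_least_nat[of I g degree] by blast
  note h' = h(1)[unfolded I_def]
  have lR: "lead_coeff h \<in> R" using h' by (simp add: coeffs_in_def)
  have divi: "\<exists>N q. coeffs_in R q \<and> smult (lead_coeff h ^ N) f = h * q" 
    if f: "coeffs_in R f" "poly (map_poly H f) z = 0" for f
  proof -
    obtain N q r where qr: "coeffs_in R q" "coeffs_in R r" "smult (lead_coeff h ^ N) f = h * q + r"
          "r = 0 \<or> degree r < degree h"
      using pseudo_division_in[OF R _ _ f(1)] h' by blast
    have "smult (H (lead_coeff h) ^ N) (map_poly H f) = map_poly H h * map_poly H q + map_poly H r"
      using arg_cong[OF qr(3), of "map_poly H"] map_poly_hom_mult[OF R H conjunct1[OF h'] qr(1)]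
        map_poly_hom_smult[OF R H ring_closed_power[OF R lR, of N] f(1)] hom_on_power[OF R H lR, of N]
        map_poly_hom_add[OF R H coeffs_in_mult[OF R conjunct1[OF h'] qr(1)] qr(2)]
      by metis
    from arg_cong[OF this, of "\<lambda>p. poly p z"] have "poly (map_poly H r) z = 0" using h' f by simp
    then have "r = 0" using qr(2,4) h(2)[of r] unfolding I_def by (metis leD)
    then show ?thesis using qr by auto
  qed
  have deg: "degree h > 0"
  proof (rule ccontr)
    assume "\<not> degree h > 0"
    then obtain c where c: "h = [:c:]" using degree_eq_zeroE by blast
    then have "H c = 0" "c \<in> R" using h' by (auto simp: map_poly_pCons hom_on_0[OF R H] coeffs_in_pCons_iff)
    then show False using inj h' c by auto
  qed
  obtain N q where q: "coeffs_in R q" "smult (lead_coeff h ^ N) g = h * q"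
    using divi[of g] g' z by blast
  have hq: "poly h y * poly q y = 0"
    using arg_cong[OF q(2), of "\<lambda>p. poly p y"] g' by simp
  have "q \<noteq> 0" using q(2) h' g' by auto
  then have dg: "degree g = degree h + degree q"
    using arg_cong[OF q(2), of degree] h' by (simp add: degree_mult_eq)
  have "poly q y \<noteq> 0" using g'(4)[of q] q(1) dg deg \<open>q \<noteq> 0\<close> by auto
  then have hy: "poly h y = 0" using hq by simp
  obtain N q where q: "coeffs_in R q" "smult (lead_coeff h ^ N) p = h * q"
    using divi[OF p] by blast
  show ?thesis
    using arg_cong[OF q(2), of "\<lambda>p. poly p y"] hy h' by simp
qed

text \<open>Send \<open>y\<close> to a root of the image of its minimal annihilator, which exists in
  an algebraically closed field: \<open>specialise_root\<close> makes the extension well defined and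
  \<open>conjugate_minimal\<close> makes it injective.\<close>

lemma hom_on_adjoin_inj:
  fixes H :: "'b::idom \<Rightarrow> 'c::alg_closed_field"
  assumes R: "ring_closed R" and H: "ring_hom_on R H" and inj: "\<And>x. x \<in> R \<Longrightarrow> H x = 0 \<Longrightarrow> x = 0"
    and alg: "alg_over R y"
  obtains H' where "ring_hom_on (adjoin R y) H'" "\<And>x. x \<in> R \<Longrightarrow> H' x = H x"
    "\<And>x. x \<in> adjoin R y \<Longrightarrow> H' x = 0 \<Longrightarrow> x = 0" "alg_over (H ` R) (H' y)"
proof -
  obtain g where g: "min_annihilator R y g" using min_annihilator_exists[OF alg] by blast
  note g' = min_annihilatorD[OF g]
  have lR: "lead_coeff g \<in> R" using g' by (simp add: coeffs_in_def)
  have lc: "H (lead_coeff g) \<noteq> 0" using inj[OF lR] g' by auto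
  then have c: "coeff (map_poly H g) (degree g) \<noteq> 0" by (simp add: coeff_map_hom[OF R H])
  then have "degree (map_poly H g) > 0"
    using min_annihilator_degree[OF g] le_degree by fastforce
  then obtain z where z: "poly (map_poly H g) z = 0" using alg_closed_imp_poly_has_root by blast
  obtain H' where H': "ring_hom_on (adjoin R y) H'" "\<And>x. x \<in> R \<Longrightarrow> H' x = H x" "H' y = z"
    "\<And>p. coeffs_in R p \<Longrightarrow> H' (poly p y) = poly (map_poly H p) z"
    using hom_on_adjoin[OF R H, of y z] specialise_root[OF R H g lc z] by blast
  show ?thesis
  proof
    show "x = 0" if "x \<in> adjoin R y" "H' x = 0" for x
      using that conjugate_minimal[OF R H inj g z] by (auto simp: adjoin_def H'(4))
    show "alg_over (H ` R) (H' y)"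
      unfolding alg_over_def annihilates_def
    proof (intro exI conjI)
      show "map_poly H g \<noteq> 0" using c by force
    qed (use z g'(1) in \<open>auto simp: H' coeffs_in_def coeff_map_hom[OF R H]\<close>)
  qed (use H' in auto)
qed

section \<open>Algebraic elements over a subfield\<close>

definition field_closed :: "'b::field set \<Rightarrow> bool" where
  "field_closed k \<longleftrightarrow> ring_closed k \<and> (\<forall>x\<in>k. inverse x \<in> k)"

lemma field_closed_ring: "field_closed k \<Longrightarrow> ring_closed k"
  and field_closed_inverse: "field_closed k \<Longrightarrow> x \<in> k \<Longrightarrow> inverse x \<in> k"
  by (auto simp: field_closed_def)

lemma field_closed_divide: "field_closed k \<Longrightarrow> x \<in> k \<Longrightarrow> y \<in> k \<Longrightarrow> x / y \<in> k"
  by (simp add: divide_inverse field_closed_ring field_closed_inverse ring_closed_mult)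

text \<open>The ring record of a type class field. The theorems on algebraic elements and finite
  extensions speak of records; the lemmas below translate them to sets in a type.\<close>

abbreviation type_ring :: "'b::field ring" where
  "type_ring \<equiv> ring_of_type_algebra"

lemma type_ring_sel [simp]:
  "carrier (type_ring :: 'b::field ring) = UNIV"
  "x \<otimes>\<^bsub>(type_ring :: 'b::field ring)\<^esub> y = x * y"
  "x \<oplus>\<^bsub>(type_ring :: 'b::field ring)\<^esub> y = x + y"
  "\<one>\<^bsub>(type_ring :: 'b::field ring)\<^esub> = 1"
  "\<zero>\<^bsub>(type_ring :: 'b::field ring)\<^esub> = 0"
  by (simp_all add: ring_of_type_algebra_def)

lemma type_ring_uminus [simp]: "\<ominus>\<^bsub>(type_ring :: 'b::field ring)\<^esub> x = - x"
proof -
  interpret TR: field "type_ring :: 'b ring" by (rule field_from_type_algebra)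
  show ?thesis by (rule TR.minus_equality) simp_all
qed

lemma type_ring_inv [simp]: "x \<noteq> 0 \<Longrightarrow> inv\<^bsub>(type_ring :: 'b::field ring)\<^esub> x = inverse x"
proof -
  interpret TR: field "type_ring :: 'b ring" by (rule field_from_type_algebra)
  assume "x \<noteq> 0"
  then show ?thesis by (intro TR.inv_char) simp_all
qed

lemma type_ring_pow [simp]: "x [^]\<^bsub>(type_ring :: 'b::field ring)\<^esub> (n::nat) = x ^ n"
  by (induction n) (simp_all add: mult.commute)

lemma subring_type_ring_iff: "subring k (type_ring :: 'b::field ring) \<longleftrightarrow> ring_closed k"
proof
  interpret TR: field "type_ring :: 'b ring" by (rule field_from_type_algebra)
  assume "subring k (type_ring :: 'b::field ring)"
  from subringE[OF this] show "ring_closed k"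
    unfolding ring_closed_def by (simp, metis add_uminus_conv_diff)
next
  interpret TR: field "type_ring :: 'b ring" by (rule field_from_type_algebra)
  assume "ring_closed k"
  then show "subring k (type_ring :: 'b::field ring)"
    by (intro TR.subringI) (auto intro: ring_closed_intros)
qed

lemma subfield_type_ring_iff: "subfield k (type_ring :: 'b::field ring) \<longleftrightarrow> field_closed k"
proof
  interpret TR: field "type_ring :: 'b ring" by (rule field_from_type_algebra)
  assume k: "subfield k (type_ring :: 'b::field ring)"
  have r: "ring_closed k" using subfieldE(1)[OF k] subring_type_ring_iff by blast
  moreover have "inverse x \<in> k" if "x \<in> k" for x
    using TR.subfield_m_inv(1)[OF k, of x] that ring_closed_0[OF r] by (cases "x = 0") auto
  ultimately show "field_closed k" by (simp add: field_closed_def)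
next
  interpret TR: field "type_ring :: 'b ring" by (rule field_from_type_algebra)
  assume "field_closed k"
  then show "subfield k (type_ring :: 'b::field ring)"
    by (intro TR.subfieldI') (auto simp: subring_type_ring_iff field_closed_def)
qed

lemma Poly_rev_Cons: "Poly (rev (a # p)) = Poly (rev p) + monom a (length p)"
  by (auto simp: poly_eq_iff nth_default_def nth_append)

text \<open>Polynomials over a record are lists with the leading coefficient first, whereas
  \<open>Poly\<close> takes the constant term first; hence the \<open>rev\<close>.\<close>

lemma type_ring_eval: "ring.eval (type_ring :: 'b::field ring) p x = poly (Poly (rev p)) x"
proof -
  interpret TR: field "type_ring :: 'b ring" by (rule field_from_type_algebra)
  show ?thesis
    by (induction p) (simp_all add: Poly_rev_Cons poly_monom del: rev.simps(2))
qed

lemma set_coeffs_subset_coeff: "set (coeffs q) \<subseteq> range (coeff q)"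
  by (cases "q = 0") (auto simp: coeffs_def)

lemma coeffs_inI: "0 \<in> K \<Longrightarrow> set (coeffs q) \<subseteq> K \<Longrightarrow> coeffs_in K q"
  unfolding coeffs_in_def
proof
  fix i assume "0 \<in> K" "set (coeffs q) \<subseteq> K"
  then show "coeff q i \<in> K"
    using coeff_in_coeffs[of q i] by (cases "q = 0"; cases "i \<le> degree q") (auto simp: coeff_eq_0)
qed

lemma algebraic_type_ring_iff:
  fixes x :: "'b::field"
  assumes k: "ring_closed k"
  shows "ring.algebraic type_ring k x \<longleftrightarrow> alg_over k x"
proof
  interpret TR: field "type_ring :: 'b ring" by (rule field_from_type_algebra)
  assume "TR.algebraic k x"
  then have "(TR.algebraic over k) x" by (simp add: over_def)
  then obtain p where p: "p \<in> carrier (univ_poly type_ring k)" "p \<noteq> []" "TR.eval p x = 0"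
    using TR.algebraicE[of k x] k by (auto simp: subring_type_ring_iff)
  then have pk: "set p \<subseteq> k" "hd p \<noteq> 0" by (auto simp: univ_poly_def polynomial_def)
  then have "coeff (Poly (rev p)) (length p - 1) \<noteq> 0"
    using p(2) by (cases p) (auto simp: nth_default_def nth_append)
  then have "Poly (rev p) \<noteq> 0" by force
  moreover have "coeffs_in k (Poly (rev p))"
    using pk(1) ring_closed_0[OF k] by (auto simp: coeffs_in_def nth_default_def rev_nth)
  ultimately show "alg_over k x"
    using p(3) by (auto simp: alg_over_def annihilates_def type_ring_eval)
next
  interpret TR: field "type_ring :: 'b ring" by (rule field_from_type_algebra)
  assume "alg_over k x"
  then obtain q where q: "coeffs_in k q" "q \<noteq> 0" "poly q x = 0"
    by (auto simp: alg_over_def annihilates_def)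
  define p where "p = rev (coeffs q)"
  have "(TR.algebraic over k) x"
  proof (rule TR.algebraicI)
    show "p \<noteq> []" using q by (simp add: p_def)
    show "TR.eval p x = \<zero>\<^bsub>type_ring\<^esub>" using q by (simp add: p_def type_ring_eval)
    have "hd p \<noteq> 0" using q by (simp add: p_def hd_rev last_coeffs_eq_coeff_degree)
    moreover have "set p \<subseteq> k" using q(1) set_coeffs_subset_coeff[of q] by (auto simp: p_def coeffs_in_def)
    ultimately show "p \<in> carrier (univ_poly type_ring k)"
      by (simp add: univ_poly_def polynomial_def)
  qed
  then show "TR.algebraic k x" by (simp add: over_def)
qed

section \<open>The relative algebraic closure of a subfield\<close>

lemma alg_over_self: "ring_closed k \<Longrightarrow> x \<in> k \<Longrightarrow> alg_over k x"
  unfolding alg_over_def annihilates_def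
  by (intro exI[of _ "[:- x, 1:]"]) (auto intro!: coeffs_in_intros ring_closed_intros)

lemma alg_over_mono: "alg_over k x \<Longrightarrow> k \<subseteq> l \<Longrightarrow> alg_over l x"
  unfolding alg_over_def annihilates_def using coeffs_in_mono by blast

definition alg_elements :: "'b::field set \<Rightarrow> 'b set" where
  "alg_elements k = {x. alg_over k x}"

lemma alg_elements_superset: "ring_closed k \<Longrightarrow> k \<subseteq> alg_elements k"
  by (auto simp: alg_elements_def alg_over_self)

lemma field_closed_alg_elements:
  fixes k :: "'b::field set"
  assumes "field_closed k"
  shows "field_closed (alg_elements k)"
proof -
  interpret TR: field "type_ring :: 'b ring" by (rule field_from_type_algebra)
  have "subfield {x \<in> carrier type_ring. (TR.algebraic over k) x} type_ring"
    using TR.subfield_of_algebraics[of k] assms by (simp add: subfield_type_ring_iff)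
  then show ?thesis
    by (simp add: subfield_type_ring_iff over_def algebraic_type_ring_iff field_closed_ring[OF assms] alg_elements_def)
qed

lemma simple_extension_type_ring:
  fixes k :: "'b::field set"
  assumes "ring_closed k"
  shows "ring.simple_extension type_ring k x = adjoin k x"
proof -
  interpret TR: field "type_ring :: 'b ring" by (rule field_from_type_algebra)
  have "TR.simple_extension k x = \<Inter> {K'. ring_closed K' \<and> k \<subseteq> K' \<and> x \<in> K'}"
    using TR.simple_extension_minimal[of k x] assms by (simp add: subring_type_ring_iff)
  also have "\<dots> = adjoin k x"
  proof (rule equalityI)
    show "\<Inter> {K'. ring_closed K' \<and> k \<subseteq> K' \<and> x \<in> K'} \<subseteq> adjoin k x"
      using ring_closed_adjoin[OF assms] adjoin_superset[OF assms] adjoin_self[OF assms]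
      by (intro Inter_lower) simp
    show "adjoin k x \<subseteq> \<Inter> {K'. ring_closed K' \<and> k \<subseteq> K' \<and> x \<in> K'}"
      by (intro Inter_greatest) (simp add: adjoin_least)
  qed
  finally show ?thesis .
qed

lemma field_closed_adjoin:
  fixes k :: "'b::field set"
  assumes "field_closed k" "alg_over k x"
  shows "field_closed (adjoin k x)"
proof -
  interpret TR: field "type_ring :: 'b ring" by (rule field_from_type_algebra)
  show ?thesis
  using TR.simple_extension_is_subfield[of k x] assms
  by (simp add: subfield_type_ring_iff simple_extension_type_ring field_closed_ring over_def algebraic_type_ring_iff)
qed

text \<open>The coefficients of a polynomial that kills \<open>w\<close> generate a finite extension
  \<open>K\<close> of \<open>k\<close>, over which \<open>w\<close> is algebraic; so the tower from
  \<open>k\<close> through \<open>K\<close> to \<open>K[w]\<close> is finite.\<close>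

lemma alg_over_trans:
  fixes k :: "'b::field set"
  assumes k: "field_closed k" and w: "alg_over (alg_elements k) w"
  shows "alg_over k w"
proof -
  interpret TR: field "type_ring :: 'b ring" by (rule field_from_type_algebra)
  obtain g where g: "coeffs_in (alg_elements k) g" "g \<noteq> 0" "poly g w = 0"
    using w by (auto simp: alg_over_def annihilates_def)
  have sk: "subfield k type_ring" using k by (simp add: subfield_type_ring_iff)
  define xs where "xs = coeffs g"
  have alg: "(TR.algebraic over k) x" if "x \<in> set xs" for x
  proof -
    have "x \<in> alg_elements k"
      using that g(1) set_coeffs_subset_coeff[of g] by (auto simp: xs_def coeffs_in_def)
    then show ?thesis
      by (simp add: alg_elements_def over_def algebraic_type_ring_iff field_closed_ring[OF k])
  qed
  define K where "K = TR.finite_extension k xs"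
  have sK: "subfield K type_ring" unfolding K_def
    by (rule TR.finite_extension_is_subfield[OF sk]) (use alg in auto)
  then have fK: "field_closed K" by (simp add: subfield_type_ring_iff)
  have fd: "TR.finite_dimension k K" unfolding K_def
    by (rule TR.finite_extension_finite_dimension(1)[OF sk]) (use alg in auto)
  have "set xs \<subseteq> K" unfolding K_def
    using TR.finite_extension_mem[of k xs] k by (simp add: subring_type_ring_iff field_closed_ring)
  then have "coeffs_in K g" 
    by (intro coeffs_inI ring_closed_0 field_closed_ring fK) (simp add: xs_def)
  then have aw: "alg_over K w" using g by (auto simp: alg_over_def annihilates_def)
  have fd2: "TR.finite_dimension K (adjoin K w)"
    using TR.finite_dimension_simple_extension[OF sK, of w] aw
    by (simp add: simple_extension_type_ring field_closed_ring fK over_def algebraic_type_ring_iff)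
  have "TR.finite_dimension k (adjoin K w)"
    using TR.telescopic_base_dim(1)[OF sk sK fd fd2] .
  then have "(TR.algebraic over k) w"
    using TR.finite_dimension_imp_algebraic[OF sk, of "adjoin K w" w]
    by (simp add: subring_type_ring_iff ring_closed_adjoin field_closed_ring fK adjoin_self)
  then show ?thesis by (simp add: over_def algebraic_type_ring_iff field_closed_ring[OF k])
qed

lemma alg_elements_trans:
  "field_closed k \<Longrightarrow> alg_over (alg_elements k) w \<Longrightarrow> w \<in> alg_elements k"
  using alg_over_trans by (simp add: alg_elements_def)

section \<open>Primitive elements and regular extensions\<close>

text \<open>A repeated linear factor would make its root a root of the derivative too, so the
  multiset of roots is a set.\<close>

lemma card_simple_roots:
  fixes p :: "'b::alg_closed_field poly"
  assumes "p \<noteq> 0" and simple: "\<And>x. poly p x = 0 \<Longrightarrow> poly (pderiv p) x \<noteq> 0"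
  shows "card {x. poly p x = 0} = degree p"
proof -
  obtain A where A: "size A = degree p" "p = smult (lead_coeff p) (\<Prod>x\<in>#A. [:- x, 1:])"
    using alg_closed_imp_factorization[OF assms(1)] by blast
  have roots: "{x. poly p x = 0} = set_mset A"
  proof -
    have "poly p x = lead_coeff p * (\<Prod>y\<in>#A. x - y)" for x
      by (subst A(2)) (simp add: poly_prod_mset)
    then show ?thesis using assms(1) by auto
  qed
  have "count A x = 1" if x: "x \<in># A" for x
  proof (rule ccontr)
    assume "count A x \<noteq> 1"
    then have "count A x \<ge> 2" using x by (metis One_nat_def Suc_1 Suc_leI count_greater_zero_iff le_neq_implies_less)
    then have "{#x, x#} \<subseteq># A" by (auto simp: subseteq_mset_def)
    then obtain B where "A = {#x, x#} + B" by (metis subset_mset.le_iff_add)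
    then have "\<exists>r. p = [:- x, 1:] * ([:- x, 1:] * r)"
      by (intro exI[of _ "smult (lead_coeff p) (\<Prod>x\<in>#B. [:- x, 1:])"], subst A(2)) (simp del: mult_pCons_left)
    then obtain r where r: "p = [:- x, 1:] * ([:- x, 1:] * r)" by blast
    have "poly (pderiv p) x = 0"
      unfolding r by (simp add: pderiv_mult pderiv_pCons del: mult_pCons_left)
    then show False using simple x roots by auto
  qed
  then have "A = mset_set (set_mset A)"
    by (intro multiset_eqI) (auto simp: count_mset_set' not_in_iff)
  then have "size A = card (set_mset A)" by (metis size_mset_set)
  then show ?thesis using A roots by simp
qed

text \<open>Newton interpolation: dividing by \<open>X - a\<close> leaves a quotient whose values at
  the other points are difference quotients of values of \<open>p\<close>, which stay in the field
  \<open>k\<close>.\<close>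

lemma coeffs_in_of_values:
  assumes k: "field_closed k"
  shows "finite S \<Longrightarrow> S \<subseteq> k \<Longrightarrow> (\<And>x. x \<in> S \<Longrightarrow> poly p x \<in> k) \<Longrightarrow> p = 0 \<or> degree p < card S \<Longrightarrow> coeffs_in k p"
proof (induction S arbitrary: p rule: finite_induct)
  case empty
  then show ?case by (simp add: coeffs_in_0 k field_closed_ring)
next
  case (insert a S)
  have R: "ring_closed k" by (rule field_closed_ring[OF k])
  define q where "q = synthetic_div p a"
  have pq: "p = [:- a, 1:] * q + [:poly p a:]"
    unfolding q_def using synthetic_div_correct'[of a p] by simp
  have "coeffs_in k q"
  proof (rule insert.IH)
    show "S \<subseteq> k" using insert by auto
    show "poly q x \<in> k" if "x \<in> S" for x
    proof -
      have "x \<noteq> a" using that insert by auto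
      moreover have "poly p x = (x - a) * poly q x + poly p a"
        by (subst pq) (simp add: algebra_simps)
      ultimately have "poly q x = (poly p x - poly p a) / (x - a)" by (simp add: field_simps)
      then show ?thesis using that insert.prems
        by (auto intro!: field_closed_divide k ring_closed_diff R)
    qed
    show "q = 0 \<or> degree q < card S"
      using insert.prems(3) insert.hyps unfolding q_def 
      by (auto simp: degree_synthetic_div synthetic_div_eq_0_iff)
  qed
  then show ?case using insert.prems
    by (subst pq) (auto intro!: coeffs_in_intros ring_closed_intros R)
qed

text \<open>If the derivative vanished at some root of \<open>g\<close>, it would vanish at
  \<open>y\<close> as well, by \<open>conjugate_minimal\<close> for the identity map.\<close>

lemma min_annihilator_roots:
  fixes g :: "'b::{alg_closed_field,field_char_0} poly"
  assumes k: "field_closed k" and g: "min_annihilator k y g"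
  shows "card {x. poly g x = 0} = degree g"
proof (rule card_simple_roots)
  note R = field_closed_ring[OF k]
  show "g \<noteq> 0" using min_annihilatorD[OF g] by simp
  have id: "map_poly (\<lambda>x. x) p = p" for p :: "'b poly" by (simp add: poly_eq_iff coeff_map_poly)
  fix x assume x: "poly g x = 0"
  show "poly (pderiv g) x \<noteq> 0"
    using conjugate_minimal[OF R ring_hom_on_id _ g, of x "pderiv g"] x min_annihilator_pderiv[OF R g]
      min_annihilatorD(1)[OF g] coeffs_in_pderiv[OF R] by (auto simp: id)
qed

text \<open>The minimal polynomial of \<open>z\<close> over \<open>k\<close> stays irreducible over \<open>l\<close>, so an expression \<open>b = p(z)\<close> with \<open>p\<close>
  over \<open>l\<close> has algebraic values at all conjugates of \<open>z\<close>; by interpolation the coefficients of \<open>p\<close> are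
  algebraic over \<open>k\<close>, hence in \<open>k\<close>.\<close>

lemma regular_descent:
  fixes z b :: "'b::{alg_closed_field,field_char_0}"
  assumes k: "field_closed k" and l: "field_closed l" and kl: "k \<subseteq> l"
    and reg: "\<And>w. w \<in> l \<Longrightarrow> alg_over k w \<Longrightarrow> w \<in> k"
    and z: "alg_over k z" and b: "alg_over k b" "b \<in> adjoin l z"
  shows "b \<in> adjoin k z"
proof -
  note Rk = field_closed_ring[OF k] and Rl = field_closed_ring[OF l]
  define C where "C = alg_elements k"
  have C: "field_closed C" unfolding C_def by (rule field_closed_alg_elements[OF k])
  note RC = field_closed_ring[OF C]
  have kC: "k \<subseteq> C" unfolding C_def by (rule alg_elements_superset[OF Rk])
  have lC: "coeffs_in k p" if "coeffs_in l p" "coeffs_in C p" for p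
    using that reg by (auto simp: coeffs_in_def C_def alg_elements_def)
  have id: "map_poly (\<lambda>x. x) p = p" for p :: "'b poly" by (simp add: poly_eq_iff coeff_map_poly)
  obtain g where g: "min_annihilator k z g" using min_annihilator_exists[OF z] by blast
  note g' = min_annihilatorD[OF g]
  have gl: "coeffs_in l g" using g'(1) kl by (rule coeffs_in_mono)
  have rootC: "x \<in> C" if "coeffs_in C p" "p \<noteq> 0" "poly p x = 0" for p x
    using that alg_elements_trans[OF k, of x] unfolding C_def alg_over_def annihilates_def by blast
  have gC: "coeffs_in C g" using g'(1) kC by (rule coeffs_in_mono)
  \<comment> \<open>The roots of a least relation \<open>h\<close> over \<open>l\<close> are roots
    of \<open>g\<close>, hence algebraic over \<open>k\<close>. So are the coefficients of the monic
    multiple of \<open>h\<close>; as they also lie in \<open>l\<close>, they lie in \<open>k\<close>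
    by \<open>reg\<close>, and \<open>h\<close> cannot be shorter than \<open>g\<close>.\<close>
  have gmin: "min_annihilator l z g"
  proof -
    have "alg_over l z" using z kl by (rule alg_over_mono)
    then obtain h where h: "min_annihilator l z h" using min_annihilator_exists by blast
    note h' = min_annihilatorD[OF h]
    obtain A where A: "h = smult (lead_coeff h) (\<Prod>x\<in>#A. [:- x, 1:])"
      using alg_closed_imp_factorization[OF h'(2)] by blast
    have lch: "lead_coeff h \<in> l" "lead_coeff h \<noteq> 0" using h' by (auto simp: coeffs_in_def)
    have AC: "x \<in> C" if "x \<in># A" for x
    proof -
      have "poly h x = 0" using that by (subst A) (auto simp: poly_prod_mset)
      then have "poly g x = 0"
        using specialise_root[OF Rl ring_hom_on_id h, of x g] lch gl g' by (simp add: id)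
      then show ?thesis using rootC gC g' by blast
    qed
    have "coeffs_in C (\<Prod>x\<in>#B. [:- x, 1:])" if "set_mset B \<subseteq> C" for B
      using that by (induction B) (auto intro!: coeffs_in_mult[OF RC] coeffs_in_pCons[OF RC] 
          coeffs_in_1[OF RC] coeffs_in_0[OF RC] ring_closed_uminus[OF RC] ring_closed_1[OF RC] simp del: mult_pCons_left)
    then have "coeffs_in C (\<Prod>x\<in>#A. [:- x, 1:])" using AC by auto
    moreover have "(\<Prod>x\<in>#A. [:- x, 1:]) = smult (inverse (lead_coeff h)) h"
      using lch by (subst (2) A) simp
    ultimately have "coeffs_in k (smult (inverse (lead_coeff h)) h)"
      using lC h' lch by (metis coeffs_in_smult[OF Rl] field_closed_inverse[OF l])
    then have "annihilates k z (smult (inverse (lead_coeff h)) h)"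
      using h' by (simp add: annihilates_def)
    then have "degree g \<le> degree h" using g h' by (auto simp: min_annihilator_def)
    then show ?thesis using h g' gl by (auto simp: min_annihilator_def annihilates_def intro: order.trans)
  qed
  obtain p0 where p0: "coeffs_in l p0" "b = poly p0 z" using b by (auto simp: adjoin_def)
  \<comment> \<open>Reduction modulo \<open>g\<close> brings the degree below the number of roots of
    \<open>g\<close>, as interpolation requires.\<close>
  obtain N q r where qr: "coeffs_in l q" "coeffs_in l r" "smult (lead_coeff g ^ N) p0 = g * q + r"
    "r = 0 \<or> degree r < degree g"
    using pseudo_division_in[OF Rl gl g'(2) p0(1)] by blast
  define c where "c = lead_coeff g ^ N"
  have c: "c \<in> k" "c \<noteq> 0" unfolding c_def
    using g' by (auto simp: coeffs_in_def intro!: ring_closed_power[OF Rk])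
  define p where "p = smult (inverse c) r"
  have pl: "coeffs_in l p" unfolding p_def
    using c kl qr(2) by (auto intro!: coeffs_in_smult[OF Rl] field_closed_inverse[OF l])
  have bp: "b = poly p z"
    using arg_cong[OF qr(3), of "\<lambda>p. poly p z"] p0 g' c by (simp add: c_def[symmetric] p_def field_simps)
  have dp: "p = 0 \<or> degree p < degree g" using qr(4) c by (auto simp: p_def)
  obtain \<mu> where \<mu>: "coeffs_in k \<mu>" "\<mu> \<noteq> 0" "poly \<mu> b = 0"
    using b by (auto simp: alg_over_def annihilates_def)
  \<comment> \<open>The composite of \<open>\<mu>\<close> with \<open>p\<close> vanishes at
    \<open>z\<close>, hence at every root of \<open>g\<close>.\<close>
  have val: "poly p w \<in> C" if w: "poly g w = 0" for w
  proof -
    have "poly (pcompose \<mu> p) w = 0"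
      using specialise_root[OF Rl ring_hom_on_id gmin, of w "pcompose \<mu> p"] w g' \<mu> bp
        coeffs_in_pcompose[OF Rl coeffs_in_mono[OF \<mu>(1) kl] pl]
      by (simp add: id poly_pcompose)
    then show ?thesis using rootC[of \<mu>] \<mu> coeffs_in_mono[OF \<mu>(1) kC] by (simp add: poly_pcompose)
  qed
  have "coeffs_in C p"
    using val dp min_annihilator_roots[OF k g] poly_roots_finite[OF g'(2)] rootC[OF gC g'(2)]
    by (intro coeffs_in_of_values[OF C, of "{x. poly g x = 0}"]) auto
  then have "coeffs_in k p" using lC pl by blast
  then show ?thesis using bp by (auto intro: adjoinI)
qed

text \<open>Put \<open>z = \<alpha> + n \<beta>\<close>. For all but finitely many \<open>n\<close>
  the polynomials \<open>g\<close> and \<open>f(z - n X)\<close> over \<open>k(z)\<close> share only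
  the root \<open>\<beta>\<close>. The minimal annihilator of \<open>\<beta>\<close> over
  \<open>k(z)\<close> then has a single root, and since its roots are simple it is linear.\<close>

lemma primitive_element_two:
  fixes \<alpha> \<beta> :: "'b::{alg_closed_field,field_char_0}"
  assumes k: "field_closed k" and \<alpha>: "alg_over k \<alpha>" and \<beta>: "alg_over k \<beta>"
  obtains n :: nat where "\<alpha> \<in> adjoin k (\<alpha> + of_nat n * \<beta>)" "\<beta> \<in> adjoin k (\<alpha> + of_nat n * \<beta>)"
    "alg_over k (\<alpha> + of_nat n * \<beta>)"
proof -
  note Rk = field_closed_ring[OF k]
  obtain f where f: "coeffs_in k f" "f \<noteq> 0" "poly f \<alpha> = 0" using \<alpha> by (auto simp: alg_over_def annihilates_def)
  obtain g where g: "coeffs_in k g" "g \<noteq> 0" "poly g \<beta> = 0" using \<beta> by (auto simp: alg_over_def annihilates_def)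
  \<comment> \<open>The \<open>n\<close> with \<open>\<alpha> + n \<beta> = a + n b\<close> for
    roots \<open>a\<close> of \<open>f\<close> and \<open>b \<noteq> \<beta>\<close> of
    \<open>g\<close>. Pairs with \<open>b = \<beta>\<close> divide by zero and contribute only the
    value 0.\<close>
  define bad where "bad = (\<lambda>(a, b). (a - \<alpha>) / (\<beta> - b)) ` ({x. poly f x = 0} \<times> {x. poly g x = 0})"
  have "finite bad" unfolding bad_def using f g by (simp add: poly_roots_finite)
  moreover have "infinite (range (of_nat :: nat \<Rightarrow> 'b))"
    by (simp add: finite_image_iff inj_on_def)
  ultimately obtain n :: nat where n: "(of_nat n :: 'b) \<notin> bad"
    by (metis rangeE finite_subset subsetI)
  define z where "z = \<alpha> + of_nat n * \<beta>"
  have "z \<in> alg_elements k" unfolding z_def using \<alpha> \<beta>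
    by (intro ring_closed_intros field_closed_ring field_closed_alg_elements k) (auto simp: alg_elements_def)
  then have z: "alg_over k z" by (simp add: alg_elements_def)
  define K where "K = adjoin k z"
  have K: "field_closed K" unfolding K_def by (rule field_closed_adjoin[OF k z])
  note RK = field_closed_ring[OF K]
  have kK: "k \<subseteq> K" unfolding K_def by (rule adjoin_superset[OF Rk])
  have zK: "z \<in> K" unfolding K_def by (rule adjoin_self[OF Rk])
  define h where "h = pcompose f [:z, - of_nat n:]"
  have h: "coeffs_in K h" unfolding h_def using f(1) kK zK
    by (auto intro!: coeffs_in_intros RK ring_closed_intros intro: coeffs_in_mono)
  have hb: "poly h \<beta> = 0" using f by (simp add: h_def poly_pcompose z_def algebra_simps)
  obtain m where m: "min_annihilator K \<beta> m"
    using min_annihilator_exists[OF alg_over_mono[OF \<beta> kK]] by blast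
  note m' = min_annihilatorD[OF m]
  have id: "map_poly (\<lambda>x. x) p = p" for p :: "'b poly" by (simp add: poly_eq_iff coeff_map_poly)
  have only: "x = \<beta>" if x: "poly m x = 0" for x
  proof (rule ccontr)
    assume ne: "x \<noteq> \<beta>"
    have "poly p x = 0" if "coeffs_in K p" "poly p \<beta> = 0" for p
      using specialise_root[OF RK ring_hom_on_id m, of x p] x m' that by (simp add: id)
    then have "poly h x = 0" "poly g x = 0" using h hb g coeffs_in_mono[OF g(1) kK] by auto
    moreover from this have "poly f (z - of_nat n * x) = 0" by (simp add: h_def poly_pcompose algebra_simps)
    moreover have "(z - of_nat n * x - \<alpha>) / (\<beta> - x) = of_nat n"
      using ne by (simp add: z_def field_simps)
    ultimately have "of_nat n \<in> bad" unfolding bad_def by force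
    then show False using n by simp
  qed
  have "{x. poly m x = 0} = {\<beta>}" using only m'(3) by blast
  then have "degree m = 1" using min_annihilator_roots[OF K m] by simp
  then obtain a c where ac: "m = [:c, a:]" "a \<noteq> 0" using degree1_coeffs by metis
  then have "\<beta> = - c / a" using m'(3) by (simp add: field_simps eq_neg_iff_add_eq_0)
  moreover have "- c / a \<in> K"
    using m'(1) ac by (auto simp: coeffs_in_pCons_iff intro!: field_closed_divide[OF K] ring_closed_uminus[OF RK])
  ultimately have bK: "\<beta> \<in> K" by simp
  have "z - of_nat n * \<beta> \<in> K" by (intro ring_closed_intros RK zK bK)
  then have "\<alpha> \<in> K" by (simp add: z_def)
  then show ?thesis using that[of n] bK z by (simp add: K_def z_def)
qed

text \<open>The element \<open>z\<close> is built from \<open>U\<close> by sums and natural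
  multiples alone. The last conjunct records this: any ring found to contain \<open>U\<close>
  contains \<open>z\<close> too.\<close>

lemma primitive_element:
  fixes U :: "'b::{alg_closed_field,field_char_0} set"
  assumes k: "field_closed k" and U: "finite U" "\<And>u. u \<in> U \<Longrightarrow> alg_over k u"
  shows "\<exists>z. alg_over k z \<and> U \<subseteq> adjoin k z \<and> (\<forall>S. ring_closed S \<longrightarrow> U \<subseteq> S \<longrightarrow> z \<in> S)"
  using U
proof (induction U rule: finite_induct)
  case empty
  then show ?case
    using field_closed_ring[OF k] by (intro exI[of _ 0]) (auto intro: alg_over_self ring_closed_0)
next
  case (insert \<beta> U)
  then obtain z where z: "alg_over k z" "U \<subseteq> adjoin k z" "\<And>S. ring_closed S \<Longrightarrow> U \<subseteq> S \<Longrightarrow> z \<in> S" by auto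
  obtain n :: nat where n: "z \<in> adjoin k (z + of_nat n * \<beta>)" "\<beta> \<in> adjoin k (z + of_nat n * \<beta>)"
    "alg_over k (z + of_nat n * \<beta>)"
    using primitive_element_two[OF k z(1), of \<beta>] insert by auto
  note R = field_closed_ring[OF k]
  have "adjoin k z \<subseteq> adjoin k (z + of_nat n * \<beta>)"
    by (intro adjoin_least ring_closed_adjoin adjoin_superset R n)
  then show ?case using z n
    by (intro exI[of _ "z + of_nat n * \<beta>"]) (auto intro!: ring_closed_intros)
qed

section \<open>Fields of rational functions\<close>

lemma field_closed_Rats: "field_closed (\<rat> :: 'b::field_char_0 set)"
  by (auto simp: field_closed_def ring_closed_def)

lemma coeffs_in_range:
  assumes "coeffs_in (h ` A) p" "h 0 = 0" "0 \<in> A"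
  obtains q where "p = map_poly h q" "coeffs_in A q"
proof -
  have "\<forall>i. \<exists>a\<in>A. coeff p i = h a" using assms(1) by (auto simp: coeffs_in_def)
  then obtain f where f: "\<And>i. f i \<in> A" "\<And>i. coeff p i = h (f i)" by metis
  define q where "q = (\<Sum>i\<le>degree p. monom (f i) i)"
  have c: "coeff q i = (if i \<le> degree p then f i else 0)" for i by (simp add: q_def coeff_sum)
  have "p = map_poly h q"
  proof (rule poly_eqI)
    fix i show "coeff p i = coeff (map_poly h q) i"
      using f(2)[of i] by (cases "i \<le> degree p") (simp_all add: coeff_map_poly assms(2) c coeff_eq_0)
  qed
  moreover have "coeffs_in A q" using f(1) assms(3) by (auto simp: coeffs_in_def c)
  ultimately show ?thesis using that by blast
qed

text \<open>Polynomials over the type \<open>rat\<close> can be evaluated in every field of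
  characteristic 0, so that a single relation can be read both in the ultrapower and at rational
  points. In \<open>ev2\<close> the coefficients are evaluated at \<open>x\<close> and the outer
  variable at \<open>w\<close>.\<close>

definition ev :: "rat poly \<Rightarrow> 'b::field_char_0 \<Rightarrow> 'b" where
  "ev p x = poly (map_poly of_rat p) x"

definition ev2 :: "rat poly poly \<Rightarrow> 'b::field_char_0 \<Rightarrow> 'b \<Rightarrow> 'b" where
  "ev2 f x w = poly (map_poly (\<lambda>p. ev p x) f) w"

lemma ring_hom_on_of_rat: "ring_hom_on R (of_rat :: rat \<Rightarrow> 'b::field_char_0)"
  by (simp add: ring_hom_on_def of_rat_diff of_rat_mult)

lemma ring_hom_on_ev: "ring_hom_on R (\<lambda>p. ev p x)"
  unfolding ring_hom_on_def ev_def
  by (simp add: map_poly_hom_diff[OF ring_closed_UNIV ring_hom_on_of_rat coeffs_in_UNIV coeffs_in_UNIV]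
     map_poly_hom_mult[OF ring_closed_UNIV ring_hom_on_of_rat coeffs_in_UNIV coeffs_in_UNIV] map_poly_1)

lemma ring_hom_on_ev2: "ring_hom_on R (\<lambda>f. ev2 f x w)"
  unfolding ring_hom_on_def ev2_def using hom_on_1[OF ring_closed_UNIV ring_hom_on_ev, of x]
  by (simp add: map_poly_hom_diff[OF ring_closed_UNIV ring_hom_on_ev coeffs_in_UNIV coeffs_in_UNIV]
     map_poly_hom_mult[OF ring_closed_UNIV ring_hom_on_ev coeffs_in_UNIV coeffs_in_UNIV] map_poly_1)

lemmas ev_0 = hom_on_0[OF ring_closed_UNIV ring_hom_on_ev]
  and ev_1 = hom_on_1[OF ring_closed_UNIV ring_hom_on_ev]
  and ev2_0 = hom_on_0[OF ring_closed_UNIV ring_hom_on_ev2]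
  and ev2_1 = hom_on_1[OF ring_closed_UNIV ring_hom_on_ev2]
  and ev2_diff = hom_on_diff[OF ring_closed_UNIV ring_hom_on_ev2 UNIV_I UNIV_I]
  and ev2_mult = hom_on_mult[OF ring_closed_UNIV ring_hom_on_ev2 UNIV_I UNIV_I]

lemma ev2_const: "ev2 [:p:] x w = ev p x"
  by (simp add: ev2_def map_poly_pCons ev_0)

lemma ev_const: "ev [:c:] x = of_rat c"
  by (simp add: ev_def map_poly_pCons)

lemma ev_var: "ev [:0, 1:] x = x"
  by (simp add: ev_def map_poly_pCons)

lemma adjoin_Rats: "adjoin \<rat> x = range (\<lambda>p. ev p x)"
proof
  show "adjoin \<rat> x \<subseteq> range (\<lambda>p. ev p x)"
  proof
    fix y assume "y \<in> adjoin \<rat> x"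
    then obtain p where p: "coeffs_in \<rat> p" "y = poly p x" by (auto simp: adjoin_def)
    then obtain q where "p = map_poly of_rat q"
      using coeffs_in_range[of of_rat UNIV p] unfolding Rats_def by (metis UNIV_I of_rat_0)
    then show "y \<in> range (\<lambda>p. ev p x)" using p by (auto simp: ev_def)
  qed
  show "range (\<lambda>p. ev p x) \<subseteq> adjoin \<rat> x"
    by (auto simp: ev_def intro!: adjoinI) (simp add: coeffs_in_def coeff_map_poly)
qed

lemma adjoin2_Rats: "adjoin (adjoin \<rat> x) w = range (\<lambda>f. ev2 f x w)"
proof
  show "adjoin (adjoin \<rat> x) w \<subseteq> range (\<lambda>p. ev2 p x w)"
  proof
    fix y assume "y \<in> adjoin (adjoin \<rat> x) w"
    then obtain p where p: "coeffs_in (range (\<lambda>p. ev p x)) p" "y = poly p w" by (auto simp: adjoin_def[of _ w] adjoin_Rats)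
    then obtain q where "p = map_poly (\<lambda>p. ev p x) q"
      using coeffs_in_range[of "\<lambda>p. ev p x" UNIV p] by (metis UNIV_I ev_0)
    then show "y \<in> range (\<lambda>p. ev2 p x w)" using p by (auto simp: ev2_def)
  qed
  show "range (\<lambda>p. ev2 p x w) \<subseteq> adjoin (adjoin \<rat> x) w"
    by (auto simp: ev2_def adjoin_Rats intro!: adjoinI) (simp add: coeffs_in_def coeff_map_poly ev_0)
qed

definition fractions :: "'b::field set \<Rightarrow> 'b set" where
  "fractions A = {a / b | a b. a \<in> A \<and> b \<in> A \<and> b \<noteq> 0}"

lemma fractionsI: "a \<in> A \<Longrightarrow> b \<in> A \<Longrightarrow> b \<noteq> 0 \<Longrightarrow> a / b \<in> fractions A"
  by (auto simp: fractions_def)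

lemma fractions_superset: "ring_closed A \<Longrightarrow> A \<subseteq> fractions A"
  using fractionsI[of _ A 1] by (auto simp: ring_closed_1)

lemma field_closed_fractions:
  assumes A: "ring_closed A"
  shows "field_closed (fractions A)"
proof -
  have bin: "u - v \<in> fractions A \<and> u * v \<in> fractions A" if uv: "u \<in> fractions A" "v \<in> fractions A" for u v
  proof -
    obtain a b c d where *: "u = a / b" "v = c / d" "a \<in> A" "b \<in> A" "c \<in> A" "d \<in> A" "b \<noteq> 0" "d \<noteq> 0"
      using uv by (auto simp: fractions_def)
    have "(a * d - c * b) / (b * d) \<in> fractions A" "(a * c) / (b * d) \<in> fractions A"
      using * by (intro fractionsI ring_closed_diff[OF A] ring_closed_mult[OF A]; simp)+
    then show ?thesis using * by (simp add: diff_frac_eq)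
  qed
  have "inverse u \<in> fractions A" if u: "u \<in> fractions A" for u
  proof -
    obtain a b where *: "u = a / b" "a \<in> A" "b \<in> A" using u by (auto simp: fractions_def)
    then show ?thesis
      using fractionsI[of b A a] fractions_superset[OF A] ring_closed_0[OF A] by (cases "a = 0") auto
  qed
  moreover have "1 \<in> fractions A" using fractions_superset[OF A] ring_closed_1[OF A] by blast
  ultimately show ?thesis using bin by (auto simp: field_closed_def ring_closed_def)
qed

lemma fractions_least: "field_closed B \<Longrightarrow> A \<subseteq> B \<Longrightarrow> fractions A \<subseteq> B"
  by (auto simp: fractions_def intro: field_closed_divide)

lemma Rats_least:
  assumes "field_closed (B :: 'b::field_char_0 set)"
  shows "\<rat> \<subseteq> B"
proof
  fix c :: 'b assume "c \<in> \<rat>"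
  then obtain a b where ab: "c = of_int a / of_int b" by (metis Rats_cases' of_int_eq_iff)
  note R = field_closed_ring[OF assms]
  have "of_int n \<in> B" for n
    by (cases n rule: int_diff_cases) (simp add: ring_closed_diff[OF R] ring_closed_of_nat[OF R])
  then show "c \<in> B" unfolding ab by (intro field_closed_divide assms)
qed

definition rat_functions :: "'b::field_char_0 \<Rightarrow> 'b set" where
  "rat_functions x = fractions (adjoin \<rat> x)"

lemma ring_closed_Rats: "ring_closed (\<rat> :: 'b::field_char_0 set)"
  by (rule field_closed_ring[OF field_closed_Rats])

lemma field_closed_rat_functions: "field_closed (rat_functions x)"
  unfolding rat_functions_def by (intro field_closed_fractions ring_closed_adjoin ring_closed_Rats)

lemma rat_functions_self: "x \<in> rat_functions x"
  unfolding rat_functions_def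
  using fractions_superset[OF ring_closed_adjoin] adjoin_self ring_closed_Rats by blast

lemma rat_functions_least: "field_closed B \<Longrightarrow> x \<in> B \<Longrightarrow> rat_functions x \<subseteq> B"
  unfolding rat_functions_def by (intro fractions_least adjoin_least Rats_least) (auto simp: field_closed_ring)

lemma rat_functions_ev: "rat_functions x = {ev p x / ev q x | p q. ev q x \<noteq> 0}"
  unfolding rat_functions_def fractions_def adjoin_Rats by auto

section \<open>The ultrapower of a field\<close>

text \<open>Zorn's lemma for families of sets all of whose finite intersections are infinite. Asking
  for infinite rather than nonempty intersections makes the ultrafilter nonprincipal.\<close>

lemma ultrafilter_exists:
  "\<exists>M :: nat set set. (\<forall>S\<in>M. infinite S) \<and> (\<forall>S. S \<in> M \<or> - S \<in> M) \<and>
     (\<forall>S\<in>M. \<forall>T\<in>M. S \<inter> T \<in> M) \<and> (\<forall>S\<in>M. \<forall>T. S \<subseteq> T \<longrightarrow> T \<in> M)"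
proof -
  define \<A> where "\<A> = {F :: nat set set. \<forall>S. finite S \<longrightarrow> S \<subseteq> F \<longrightarrow> infinite (\<Inter>S)}"
  have "\<exists>M\<in>\<A>. \<forall>W\<in>\<A>. M \<subseteq> W \<longrightarrow> W = M"
  proof (rule subset_Zorn')
    fix C assume C: "subset.chain \<A> C"
    show "\<Union>C \<in> \<A>"
      unfolding \<A>_def
    proof (intro CollectI allI impI)
      fix S assume S: "finite S" "S \<subseteq> \<Union>C"
      show "infinite (\<Inter>S)"
      proof (cases "C = {}")
        case True
        then show ?thesis using S by auto
      next
        case False
        obtain F where "F \<in> C" "S \<subseteq> F"
          using finite_subset_Union_chain[OF S False] C by blast
        then show ?thesis using C S(1) unfolding \<A>_def subset.chain_def by auto
      qed
    qed
  qed
  then obtain M where M: "M \<in> \<A>" "\<And>W. W \<in> \<A> \<Longrightarrow> M \<subseteq> W \<Longrightarrow> W = M" by blast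
  have fip: "infinite (\<Inter>S)" if "finite S" "S \<subseteq> M" for S using M(1) that by (auto simp: \<A>_def)
  have ultra: "P \<in> M \<or> - P \<in> M" for P
  proof (rule ccontr)
    assume neg: "\<not> (P \<in> M \<or> - P \<in> M)"
    \<comment> \<open>A set \<open>Q\<close> that cannot be added to \<open>M\<close> has a finite
      trace on some finite intersection of members. If both \<open>P\<close> and its complement were
      such sets, combining the two intersections would give a finite one.\<close>
    have ex: "\<exists>S. finite S \<and> S \<subseteq> M \<and> finite (Q \<inter> \<Inter>S)" if "Q \<notin> M" for Q
    proof -
      have "insert Q M \<notin> \<A>" using M(2)[of "insert Q M"] that by blast
      then obtain S where S: "finite S" "S \<subseteq> insert Q M" "finite (\<Inter>S)" by (auto simp: \<A>_def)
      have "Q \<inter> \<Inter>(S - {Q}) \<subseteq> \<Inter>S" by auto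
      then have "finite (Q \<inter> \<Inter>(S - {Q}))" using S(3) finite_subset by blast
      then show ?thesis using S by (intro exI[of _ "S - {Q}"]) auto
    qed
    obtain S T where "finite S" "S \<subseteq> M" "finite (P \<inter> \<Inter>S)" "finite T" "T \<subseteq> M" "finite (- P \<inter> \<Inter>T)"
      using ex neg by meson
    moreover have "\<Inter>(S \<union> T) \<subseteq> (P \<inter> \<Inter>S) \<union> (- P \<inter> \<Inter>T)" by auto
    ultimately have "finite (\<Inter>(S \<union> T))" "finite (S \<union> T)" "S \<union> T \<subseteq> M"
      using finite_subset by (blast, auto)
    then show False using fip by blast
  qed
  have inter: "S \<inter> T \<in> M" if "S \<in> M" "T \<in> M" for S T
  proof (rule ccontr)
    assume "S \<inter> T \<notin> M"
    then have "- (S \<inter> T) \<in> M" using ultra by blast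
    then have "infinite (\<Inter>{S, T, - (S \<inter> T)})" using that by (intro fip) auto
    moreover have "\<Inter>{S, T, - (S \<inter> T)} = {}" by auto
    ultimately show False by simp
  qed
  have up: "T \<in> M" if "S \<in> M" "S \<subseteq> T" for S T
  proof (rule ccontr)
    assume "T \<notin> M"
    then have "- T \<in> M" using ultra by blast
    then have "infinite (\<Inter>{S, - T})" using that by (intro fip) auto
    moreover have "\<Inter>{S, - T} = {}" using that by auto
    ultimately show False by simp
  qed
  show ?thesis
  proof (intro exI[of _ M] conjI ballI allI impI)
    show "infinite S" if "S \<in> M" for S using fip[of "{S}"] that by simp
  qed (fact ultra, rule inter, assumption+, rule up, assumption+)
qed

definition ultra_sets :: "nat set set" where
  "ultra_sets = (SOME M. (\<forall>S\<in>M. infinite S) \<and> (\<forall>S. S \<in> M \<or> - S \<in> M) \<and>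
     (\<forall>S\<in>M. \<forall>T\<in>M. S \<inter> T \<in> M) \<and> (\<forall>S\<in>M. \<forall>T. S \<subseteq> T \<longrightarrow> T \<in> M))"

lemma ultra_sets:
  shows "S \<in> ultra_sets \<Longrightarrow> infinite S" "S \<in> ultra_sets \<or> - S \<in> ultra_sets"
    "S \<in> ultra_sets \<Longrightarrow> T \<in> ultra_sets \<Longrightarrow> S \<inter> T \<in> ultra_sets"
    "S \<in> ultra_sets \<Longrightarrow> S \<subseteq> T \<Longrightarrow> T \<in> ultra_sets"
proof -
  have *: "(\<forall>S\<in>ultra_sets. infinite S) \<and> (\<forall>S. S \<in> ultra_sets \<or> - S \<in> ultra_sets) \<and>
     (\<forall>S\<in>ultra_sets. \<forall>T\<in>ultra_sets. S \<inter> T \<in> ultra_sets) \<and>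
     (\<forall>S\<in>ultra_sets. \<forall>T. S \<subseteq> T \<longrightarrow> T \<in> ultra_sets)"
    unfolding ultra_sets_def by (rule someI_ex[OF ultrafilter_exists])
  show "S \<in> ultra_sets \<Longrightarrow> infinite S"
    by (rule bspec[OF conjunct1[OF *]])
  show "S \<in> ultra_sets \<or> - S \<in> ultra_sets"
    by (rule spec[OF conjunct1[OF conjunct2[OF *]]])
  show "S \<in> ultra_sets \<Longrightarrow> T \<in> ultra_sets \<Longrightarrow> S \<inter> T \<in> ultra_sets"
    by (rule bspec[OF bspec[OF conjunct1[OF conjunct2[OF conjunct2[OF *]]]]])
  show "S \<in> ultra_sets \<Longrightarrow> S \<subseteq> T \<Longrightarrow> T \<in> ultra_sets"
    by (rule mp[OF spec[OF bspec[OF conjunct2[OF conjunct2[OF conjunct2[OF *]]]]]])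
qed

definition ultra :: "nat filter" where
  "ultra = Abs_filter (\<lambda>P. {n. P n} \<in> ultra_sets)"

lemma eventually_ultra: "eventually P ultra \<longleftrightarrow> {n. P n} \<in> ultra_sets"
  unfolding ultra_def
proof (rule eventually_Abs_filter, standard)
  show "{n. True} \<in> ultra_sets" using ultra_sets(2)[of UNIV] ultra_sets(1)[of "{}"] by auto
  show "{n. P n \<and> Q n} \<in> ultra_sets" if "{n. P n} \<in> ultra_sets" "{n. Q n} \<in> ultra_sets" for P Q
    using ultra_sets(3)[OF that] by (simp add: Collect_conj_eq)
  show "{n. Q n} \<in> ultra_sets" if "\<forall>n. P n \<longrightarrow> Q n" "{n. P n} \<in> ultra_sets" for P Q
    using ultra_sets(4)[OF that(2), of "{n. Q n}"] that(1) by (simp add: Collect_mono)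
qed

text \<open>For an ultrafilter \<open>eventually\<close> commutes with negation. Together with
  conjunction this carries the truth of quantifier-free formulas between the ultrapower and its
  components.\<close>

lemma ultra_not: "eventually (\<lambda>n. \<not> P n) ultra \<longleftrightarrow> \<not> eventually P ultra"
proof -
  have "eventually P ultra \<or> eventually (\<lambda>n. \<not> P n) ultra"
    using ultra_sets(2)[of "{n. P n}"] by (simp add: eventually_ultra Collect_neg_eq)
  moreover have "\<not> (eventually P ultra \<and> eventually (\<lambda>n. \<not> P n) ultra)"
    using ultra_sets(1)[OF ultra_sets(3)[of "{n. P n}" "- {n. P n}"]]
    by (auto simp: eventually_ultra Collect_neg_eq)
  ultimately show ?thesis by blast
qed

lemma ultra_False [simp]: "\<not> eventually (\<lambda>_. False) ultra"
  using ultra_not[of "\<lambda>_. True"] by simp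

lemma ultra_disj: "eventually (\<lambda>n. P n \<or> Q n) ultra \<longleftrightarrow> eventually P ultra \<or> eventually Q ultra"
proof -
  have "eventually (\<lambda>n. \<not> (P n \<or> Q n)) ultra \<longleftrightarrow> eventually (\<lambda>n. \<not> P n) ultra \<and> eventually (\<lambda>n. \<not> Q n) ultra"
    by (simp add: eventually_conj_iff)
  then show ?thesis by (simp only: ultra_not) blast
qed

lemma ultra_finite_Bex:
  "finite B \<Longrightarrow> eventually (\<lambda>n. \<exists>b\<in>B. P b n) ultra \<Longrightarrow> \<exists>b\<in>B. eventually (P b) ultra"
  by (induction B rule: finite_induct) (auto simp: ultra_disj)

lemma ultra_imp_ex: "eventually P ultra \<Longrightarrow> \<exists>n. P n"
  using eventually_happens ultra_False by (metis eventually_mono)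

lemma ultra_cofinite: "finite {n. \<not> P n} \<Longrightarrow> eventually P ultra"
  using ultra_not[of P] ultra_sets(1) by (auto simp: eventually_ultra)

\<comment> \<open>The ultrapower and its field structure\<close>
quotient_type 'a star = "nat \<Rightarrow> 'a" / "\<lambda>W Y. eventually (\<lambda>n. W n = Y n) ultra"
proof (rule equivpI)
  show "reflp (\<lambda>W Y. eventually (\<lambda>n. W n = (Y n :: 'a)) ultra)" by (simp add: reflp_def)
  show "symp (\<lambda>W Y. eventually (\<lambda>n. W n = (Y n :: 'a)) ultra)" by (simp add: symp_def eq_commute)
  show "transp (\<lambda>W Y. eventually (\<lambda>n. W n = (Y n :: 'a)) ultra)"
    unfolding transp_def by (auto elim: eventually_elim2)
qed

lift_definition star_n :: "(nat \<Rightarrow> 'a) \<Rightarrow> 'a star" is "\<lambda>W. W" .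

lemma star_n_eq_iff: "star_n W = star_n Y \<longleftrightarrow> eventually (\<lambda>n. W n = Y n) ultra"
  by transfer simp

lemma star_n_cases: obtains W where "x = star_n W"
proof -
  have "\<exists>W. x = star_n W"
  proof (transfer)
    fix x :: "nat \<Rightarrow> 'a"
    show "\<exists>W. eventually (\<lambda>n. x n = W n) ultra" by (rule exI[of _ x]) simp
  qed
  then show ?thesis using that by blast
qed

instantiation star :: (comm_ring_1) comm_ring_1
begin

lift_definition zero_star :: "'a star" is "\<lambda>_. 0" .
lift_definition one_star :: "'a star" is "\<lambda>_. 1" .
lift_definition plus_star :: "'a star \<Rightarrow> 'a star \<Rightarrow> 'a star" is "\<lambda>W Y n. W n + Y n"
  by (auto elim: eventually_elim2)
lift_definition minus_star :: "'a star \<Rightarrow> 'a star \<Rightarrow> 'a star" is "\<lambda>W Y n. W n - Y n"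
  by (auto elim: eventually_elim2)
lift_definition times_star :: "'a star \<Rightarrow> 'a star \<Rightarrow> 'a star" is "\<lambda>W Y n. W n * Y n"
  by (auto elim: eventually_elim2)
lift_definition uminus_star :: "'a star \<Rightarrow> 'a star" is "\<lambda>W n. - W n"
  by (auto elim: eventually_mono)

instance
proof
  fix a b c :: "'a star"
  show "a + b + c = a + (b + c)" "a + b = b + a" "0 + a = a" "- a + a = 0" "a - b = a + - b"
    "a * b * c = a * (b * c)" "a * b = b * a" "1 * a = a" "(a + b) * c = a * c + b * c"
    by (transfer; simp add: algebra_simps)+
  show "(0 :: 'a star) \<noteq> 1" 
    by transfer simp
qed

end

instantiation star :: (inverse) inverse
begin

lift_definition divide_star :: "'a star \<Rightarrow> 'a star \<Rightarrow> 'a star" is "\<lambda>W Y n. W n / Y n"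
  by (auto elim: eventually_elim2)
lift_definition inverse_star :: "'a star \<Rightarrow> 'a star" is "\<lambda>W n. inverse (W n)"
  by (auto elim: eventually_mono)

instance ..

end

instance star :: (field) field
proof
  fix a b :: "'a star"
  show "a / b = a * inverse b"
    by transfer (simp add: divide_inverse)
  show "inverse (0 :: 'a star) = 0"
    by transfer simp
  show "a \<noteq> 0 \<Longrightarrow> inverse a * a = 1"
    by transfer (auto simp: ultra_not[symmetric] elim: eventually_mono)
qed

lemma star_n_simps:
  "0 = star_n (\<lambda>_. 0)" "1 = star_n (\<lambda>_. 1)"
  "star_n W + star_n Y = star_n (\<lambda>n. W n + Y n)"
  "star_n W - star_n Y = star_n (\<lambda>n. W n - Y n)"
  "star_n W * star_n Y = star_n (\<lambda>n. W n * Y n)"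
  "- star_n W = star_n (\<lambda>n. - W n)"
  by (transfer; simp)+

lemma star_n_inverse: "inverse (star_n W) = star_n (\<lambda>n. inverse (W n))"
  by transfer simp

lemma star_n_power: "star_n W ^ k = star_n (\<lambda>n. W n ^ k)"
  by (induction k) (auto simp: star_n_simps)

lemma star_n_sum: "(\<Sum>i\<in>I. star_n (W i)) = star_n (\<lambda>n. \<Sum>i\<in>I. W i n)"
  by (induction I rule: infinite_finite_induct) (auto simp: star_n_simps)

definition star_of :: "'a \<Rightarrow> 'a star" where
  "star_of c = star_n (\<lambda>_. c)"

lemma star_of_eq_iff: "star_of a = star_of b \<longleftrightarrow> a = b"
  using ultra_imp_ex by (auto simp: star_of_def star_n_eq_iff)

lemma star_of_simps:
  "star_of 0 = 0" "star_of 1 = 1" "star_of (a + b) = star_of a + star_of b"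
  "star_of (a - b) = star_of a - star_of b" "star_of (a * b) = star_of a * star_of b"
  "star_of (- a) = - star_of a"
  by (simp_all add: star_of_def star_n_simps)

lemma ring_hom_on_star_of: "ring_hom_on R star_of"
  by (simp add: ring_hom_on_def star_of_simps)

instance star :: (field_char_0) field_char_0
proof
  have "of_nat n = star_of (of_nat n :: 'a)" for n
    by (induction n) (auto simp: star_of_simps)
  then show "inj (of_nat :: nat \<Rightarrow> 'a star)"
    by (auto simp: inj_def star_of_eq_iff)
qed

text \<open>A root is chosen in each component in which the leading coefficient is nonzero, and
  these are almost all components.\<close>

instance star :: (alg_closed_field) alg_closed_field
proof intro_classes
  fix n :: nat and f :: "nat \<Rightarrow> 'a star"
  assume n: "0 < n" "f n \<noteq> 0"
  have "\<exists>F. \<forall>k. f k = star_n (F k)" by (rule choice) (metis star_n_cases)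
  then obtain F where F: "\<And>k. f k = star_n (F k)" by blast
  have "\<forall>m. \<exists>x. F n m \<noteq> 0 \<longrightarrow> (\<Sum>k\<le>n. F k m * x ^ k) = 0"
    using alg_closed[of n "\<lambda>k. F k m" for m] n(1) by metis
  then obtain W where W: "\<And>m. F n m \<noteq> 0 \<Longrightarrow> (\<Sum>k\<le>n. F k m * W m ^ k) = 0" by metis
  have "eventually (\<lambda>m. F n m \<noteq> 0) ultra"
    using n(2) by (simp add: F star_n_simps(1) star_n_eq_iff ultra_not)
  then have "(\<Sum>k\<le>n. f k * star_n W ^ k) = 0"
    by (simp add: F star_n_simps star_n_power star_n_sum star_n_eq_iff) (auto elim: eventually_mono dest: W)
  then show "\<exists>x. (\<Sum>k\<le>n. f k * x ^ k) = 0" by (rule exI)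
qed

text \<open>The internal subset attached to \<open>S\<close>. A representative has all its entries
  in \<open>S\<close>; for nonempty \<open>S\<close> this is no loss, since entries on a negligible
  set can be changed.\<close>

definition star_set :: "'a set \<Rightarrow> 'a star set" where
  "star_set S = {star_n W | W. \<forall>n. W n \<in> S}"

lemma star_setI: "(\<And>n. W n \<in> S) \<Longrightarrow> star_n W \<in> star_set S"
  by (auto simp: star_set_def)

lemma ring_closed_star_set: "ring_closed S \<Longrightarrow> ring_closed (star_set S)"
  unfolding ring_closed_def[of "star_set S"]
  by (auto simp: star_set_def star_n_simps) (metis ring_closed_1 ring_closed_diff ring_closed_mult)+

lemma field_closed_star_set: "field_closed S \<Longrightarrow> field_closed (star_set S)"
  using ring_closed_star_set by (auto simp: field_closed_def star_set_def star_n_inverse)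

lemma star_set_poly:
  assumes p: "coeffs_in (star_set S) p" and "0 \<in> S"
  obtains P where "\<And>n. coeffs_in S (P n)" "\<And>Z. poly p (star_n Z) = star_n (\<lambda>n. poly (P n) (Z n))"
    "\<And>i. coeff p i = star_n (\<lambda>n. coeff (P n) i)" "\<And>n. degree (P n) \<le> degree p"
proof -
  have "\<forall>i. \<exists>W. coeff p i = star_n W \<and> (\<forall>n. W n \<in> S)"
    using p by (auto simp: coeffs_in_def star_set_def)
  then obtain W where W: "\<And>i. coeff p i = star_n (W i)" "\<And>i n. W i n \<in> S" by metis
  define P where "P n = (\<Sum>i\<le>degree p. monom (W i n) i)" for n
  have c: "coeff (P n) i = (if i \<le> degree p then W i n else 0)" for n i
    by (simp add: P_def coeff_sum)
  have "poly p (star_n Z) = star_n (\<lambda>n. poly (P n) (Z n))" for Z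
    by (simp add: poly_altdef[of p] W(1) P_def poly_sum poly_monom star_n_power star_n_simps star_n_sum)
  moreover have "coeff p i = star_n (\<lambda>n. coeff (P n) i)" for i
    by (cases "i \<le> degree p") (simp_all add: c W(1)[symmetric] star_n_simps(1)[symmetric] coeff_eq_0)
  moreover have "degree (P n) \<le> degree p" for n by (rule degree_le) (simp add: c)
  ultimately show ?thesis using that[of P] W(2) assms(2) by (auto simp: coeffs_in_def c)
qed

text \<open>The common bound \<open>d\<close> leaves only finitely many coefficient sequences, and
  each of them becomes one coefficient over the ultrapower.\<close>

lemma star_set_poly_lift:
  assumes P: "\<And>n. coeffs_in S (P n)" "\<And>n. degree (P n) \<le> d"
  obtains p where "coeffs_in (star_set S) p" "\<And>Z. poly p (star_n Z) = star_n (\<lambda>n. poly (P n) (Z n))"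
proof -
  define p where "p = (\<Sum>i\<le>d. monom (star_n (\<lambda>n. coeff (P n) i)) i)"
  have c: "coeff p i = star_n (\<lambda>n. coeff (P n) i)" for i
    using coeff_eq_0[OF order.strict_trans1[OF P(2)], of i]
    by (cases "i \<le> d") (simp_all add: p_def coeff_sum star_n_simps(1))
  have "poly (P n) x = (\<Sum>i\<le>d. coeff (P n) i * x ^ i)" for n x
    using P(2)[of n] by (rule poly_as_sum_of_monoms'[THEN arg_cong[of _ _ "\<lambda>p. poly p x"], symmetric, unfolded poly_sum poly_monom])
  then have "poly p (star_n Z) = star_n (\<lambda>n. poly (P n) (Z n))" for Z
    by (simp add: p_def poly_sum poly_monom star_n_power star_n_simps star_n_sum)
  moreover have "coeffs_in (star_set S) p"
    using P(1) by (auto simp: coeffs_in_def c intro: star_setI)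
  ultimately show ?thesis using that by blast
qed

section \<open>Terms and formulas in rings\<close>

text \<open>Terms with parameters in \<open>'a\<close> are to be read in power series rings and in
  the ultrapower; \<open>h\<close> says how the parameters are interpreted there.\<close>

primrec tval :: "('a \<Rightarrow> 'r) \<Rightarrow> (nat \<Rightarrow> 'r) \<Rightarrow> 'a rterm \<Rightarrow> 'r::comm_ring_1" where
  "tval h e (RVar i) = e i"
| "tval h e (RParam c) = h c"
| "tval h e RZero = 0"
| "tval h e ROne = 1"
| "tval h e (RNeg s) = - tval h e s"
| "tval h e (RAdd s t) = tval h e s + tval h e t"
| "tval h e (RMult s t) = tval h e s * tval h e t"

primrec qval :: "('a \<Rightarrow> 'r) \<Rightarrow> (nat \<Rightarrow> 'r::comm_ring_1) \<Rightarrow> 'a qf_formula \<Rightarrow> bool" where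
  "qval h e (QEq s t) \<longleftrightarrow> tval h e s = tval h e t"
| "qval h e (QNot \<phi>) \<longleftrightarrow> \<not> qval h e \<phi>"
| "qval h e (QAnd \<phi> \<psi>) \<longleftrightarrow> qval h e \<phi> \<and> qval h e \<psi>"
| "qval h e (QOr \<phi> \<psi>) \<longleftrightarrow> qval h e \<phi> \<or> qval h e \<psi>"

text \<open>An equation is kept as the difference of its sides. The truth of a formula depends only
  on which of these finitely many terms vanish, so it survives every passage between rings that
  respects zero and nonzero for them.\<close>

primrec qf_atoms :: "'a qf_formula \<Rightarrow> 'a rterm set" where
  "qf_atoms (QEq s t) = {RAdd s (RNeg t)}"
| "qf_atoms (QNot \<phi>) = qf_atoms \<phi>"
| "qf_atoms (QAnd \<phi> \<psi>) = qf_atoms \<phi> \<union> qf_atoms \<psi>"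
| "qf_atoms (QOr \<phi> \<psi>) = qf_atoms \<phi> \<union> qf_atoms \<psi>"

lemma finite_qf_atoms: "finite (qf_atoms \<phi>)"
  by (induction \<phi>) auto

lemma qf_atoms_vars: "t \<in> qf_atoms \<phi> \<Longrightarrow> rterm_vars t \<subseteq> qf_vars \<phi>"
  and qf_atoms_params: "t \<in> qf_atoms \<phi> \<Longrightarrow> set_rterm t \<subseteq> set_qf_formula \<phi>"
  by (induction \<phi>) auto

lemma tval_id: "tval (\<lambda>x. x) e t = rterm_val e t"
  by (induction t) auto

lemma qval_id: "qval (\<lambda>x. x) e \<phi> = qf_sat e \<phi>"
  by (induction \<phi>) (auto simp: tval_id)

lemma qval_atoms_cong:
  "(\<And>t. t \<in> qf_atoms \<phi> \<Longrightarrow> tval h e t = 0 \<longleftrightarrow> tval h' e' t = 0) \<Longrightarrow> qval h e \<phi> = qval h' e' \<phi>"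
  by (induction \<phi>) (auto simp: eq_neg_iff_add_eq_0)

lemma tval_cong:
  "(\<And>c. c \<in> set_rterm t \<Longrightarrow> h c = h' c) \<Longrightarrow> (\<And>i. i \<in> rterm_vars t \<Longrightarrow> e i = e' i) \<Longrightarrow> tval h e t = tval h' e' t"
  by (induction t) auto

lemma tval_in:
  "ring_closed R \<Longrightarrow> (\<And>c. c \<in> set_rterm t \<Longrightarrow> h c \<in> R) \<Longrightarrow> (\<And>i. i \<in> rterm_vars t \<Longrightarrow> e i \<in> R) \<Longrightarrow> tval h e t \<in> R"
  by (induction t) (auto intro: ring_closed_intros)

lemma tval_hom:
  assumes R: "ring_closed R" and H: "ring_hom_on R H"
  shows "(\<And>c. c \<in> set_rterm t \<Longrightarrow> h c \<in> R) \<Longrightarrow> (\<And>i. i \<in> rterm_vars t \<Longrightarrow> e i \<in> R) \<Longrightarrow>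
     H (tval h e t) = tval (\<lambda>c. H (h c)) (\<lambda>i. H (e i)) t"
proof (induction t)
  case (RNeg t)
  then show ?case using tval_in[OF R, of t h e] by (simp add: hom_on_uminus[OF R H])
next
  case (RAdd s t)
  then show ?case using tval_in[OF R, of t h e] tval_in[OF R, of s h e] by (simp add: hom_on_add[OF R H])
next
  case (RMult s t)
  then show ?case using tval_in[OF R, of t h e] tval_in[OF R, of s h e] by (simp add: hom_on_mult[OF R H])
qed (simp_all add: hom_on_0[OF R H] hom_on_1[OF R H])

lemma tval_star: "tval star_of (\<lambda>i. star_n (\<lambda>n. E n i)) t = star_n (\<lambda>n. rterm_val (E n) t)"
  by (induction t) (simp_all add: star_n_simps star_of_def)

lemma qval_star: "qval star_of (\<lambda>i. star_n (\<lambda>n. E n i)) \<phi> \<longleftrightarrow> eventually (\<lambda>n. qf_sat (E n) \<phi>) ultra"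
  by (induction \<phi>) (simp_all add: tval_star star_n_eq_iff ultra_not ultra_disj eventually_conj_iff)

text \<open>The ring generated by the parameters in \<open>P\<close> and by \<open>e 0\<close>, ...,
  \<open>e j\<close>. Each element comes with a term, which can be evaluated again in a component or
  in a ring of power series.\<close>

definition term_ring :: "'a set \<Rightarrow> ('a \<Rightarrow> 'r) \<Rightarrow> (nat \<Rightarrow> 'r::comm_ring_1) \<Rightarrow> nat \<Rightarrow> 'r set" where
  "term_ring P h e j = {tval h e t | t. set_rterm t \<subseteq> P \<and> rterm_vars t \<subseteq> {..j}}"

lemma term_ringI: "set_rterm t \<subseteq> P \<Longrightarrow> rterm_vars t \<subseteq> {..j} \<Longrightarrow> tval h e t \<in> term_ring P h e j"
  by (auto simp: term_ring_def)

lemma ring_closed_term_ring: 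
  fixes e :: "nat \<Rightarrow> 'r::idom"
  shows "ring_closed (term_ring P h e j)"
  unfolding ring_closed_def
proof (intro conjI ballI)
  show "1 \<in> term_ring P h e j" using term_ringI[of ROne P j h e] by simp
  fix x y assume "x \<in> term_ring P h e j" "y \<in> term_ring P h e j"
  then obtain s t where "x = tval h e s" "y = tval h e t" "set_rterm s \<subseteq> P" "set_rterm t \<subseteq> P"
    "rterm_vars s \<subseteq> {..j}" "rterm_vars t \<subseteq> {..j}" by (auto simp: term_ring_def)
  then show "x - y \<in> term_ring P h e j" "x * y \<in> term_ring P h e j"
    using term_ringI[of "RAdd s (RNeg t)" P j h e] term_ringI[of "RMult s t" P j h e] by auto
qed

lemma term_ring_param: "c \<in> P \<Longrightarrow> h c \<in> term_ring P h e j"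
  using term_ringI[of "RParam c" P j h e] by simp

lemma term_ring_var: "i \<le> j \<Longrightarrow> e i \<in> term_ring P h e j"
  using term_ringI[of "RVar i" P j h e] by simp

lemma term_ring_least:
  "ring_closed R \<Longrightarrow> (\<And>c. c \<in> P \<Longrightarrow> h c \<in> R) \<Longrightarrow> (\<And>i. i \<le> j \<Longrightarrow> e i \<in> R) \<Longrightarrow> term_ring P h e j \<subseteq> R"
  unfolding term_ring_def by (auto intro!: tval_in)

lemma term_ring_cong: "(\<And>i. i \<le> j \<Longrightarrow> e i = e' i) \<Longrightarrow> term_ring P h e j = term_ring P h e' j"
proof -
  assume "\<And>i. i \<le> j \<Longrightarrow> e i = e' i"
  then have *: "tval h e t = tval h e' t" if "rterm_vars t \<subseteq> {..j}" for t
    using that by (intro tval_cong) auto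
  show ?thesis
    unfolding term_ring_def
  proof (intro Collect_cong iff_exI)
    fix x t
    show "x = tval h e t \<and> set_rterm t \<subseteq> P \<and> rterm_vars t \<subseteq> {..j} \<longleftrightarrow>
      x = tval h e' t \<and> set_rterm t \<subseteq> P \<and> rterm_vars t \<subseteq> {..j}"
      using *[of t] by argo
  qed
qed

lemma term_ring_Suc:
  fixes e :: "nat \<Rightarrow> 'r::idom"
  shows "term_ring P h e (Suc j) \<subseteq> adjoin (term_ring P h e j) (e (Suc j))"
proof (rule term_ring_least)
  note R = ring_closed_term_ring[of P h e j]
  show "ring_closed (adjoin (term_ring P h e j) (e (Suc j)))" by (rule ring_closed_adjoin[OF R])
  show "h c \<in> adjoin (term_ring P h e j) (e (Suc j))" if "c \<in> P" for c
    using adjoin_superset[OF R] term_ring_param[OF that] by blast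
  show "e i \<in> adjoin (term_ring P h e j) (e (Suc j))" if "i \<le> Suc j" for i
    using adjoin_superset[OF R] adjoin_self[OF R] term_ring_var[of i j e P h] that
    by (cases "i = Suc j") auto
qed

section \<open>Power series over a subfield and Hensel lifting\<close>

definition fps_over :: "'a::field set \<Rightarrow> 'a fps set" where
  "fps_over L = {f. \<forall>n. fps_nth f n \<in> L}"

lemma ring_closed_fps_over: "ring_closed L \<Longrightarrow> ring_closed (fps_over L)"
  unfolding ring_closed_def[of "fps_over L"]
  by (auto simp: fps_over_def fps_mult_nth intro!: ring_closed_intros)

lemma fps_const_over: "ring_closed L \<Longrightarrow> c \<in> L \<Longrightarrow> fps_const c \<in> fps_over L"
  by (auto simp: fps_over_def ring_closed_0)

lemma fps_X_over: "ring_closed L \<Longrightarrow> fps_X \<in> fps_over L"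
  by (auto simp: fps_over_def ring_closed_0 ring_closed_1 fps_X_def)

lemma poly_diff_dvd: "(a - b) dvd (poly p a - poly p (b :: 'b::idom))"
proof (induction p)
  case (pCons c p)
  have "poly (pCons c p) a - poly (pCons c p) b = (a - b) * poly p a + b * (poly p a - poly p b)"
    by (simp add: algebra_simps)
  then show ?case using pCons by (simp only:) (intro dvd_add dvd_mult dvd_triv_left)
qed simp

lemma poly_taylor_dvd: "h ^ 2 dvd (poly p (z + h) - poly p z - h * poly (pderiv p) (z :: 'b::idom))"
proof (induction p)
  case (pCons c p)
  have "poly (pCons c p) (z + h) - poly (pCons c p) z - h * poly (pderiv (pCons c p)) z =
     (z + h) * (poly p (z + h) - poly p z - h * poly (pderiv p) z) + h ^ 2 * poly (pderiv p) z"
    by (simp add: pderiv_pCons algebra_simps power2_eq_square)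
  then show ?case using pCons by (simp only:) (intro dvd_add dvd_mult dvd_triv_left)
qed simp

lemma fps_nth_0_hom: "ring_hom_on R (\<lambda>f :: 'a::field fps. fps_nth f 0)"
  by (simp add: ring_hom_on_def)

lemma poly_fps_nth_0:
  fixes p :: "'a::field fps poly"
  shows "fps_nth (poly p x) 0 = poly (map_poly (\<lambda>f. fps_nth f 0) p) (fps_nth x 0)"
  using poly_map_hom[OF ring_closed_UNIV fps_nth_0_hom, of p x] by (simp add: coeffs_in_def)

text \<open>The derivative has the same constant term \<open>d\<close> at every approximation to the
  root. Each coefficient is therefore corrected by one division by \<open>d\<close>, which stays in
  the field \<open>L\<close>.\<close>

lemma fps_hensel:
  fixes g :: "'a::field fps poly"
  assumes L: "field_closed L" and g: "coeffs_in (fps_over L) g" and c: "c \<in> L"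
    and root: "fps_nth (poly g (fps_const c)) 0 = 0"
    and simple: "fps_nth (poly (pderiv g) (fps_const c)) 0 \<noteq> 0"
  shows "\<exists>z\<in>fps_over L. fps_nth z 0 = c \<and> poly g z = 0"
proof -
  note RL = field_closed_ring[OF L]
  note RF = ring_closed_fps_over[OF RL]
  define d where "d = fps_nth (poly (pderiv g) (fps_const c)) 0"
  have dz: "fps_nth (poly (pderiv g) z) 0 = d" if "fps_nth z 0 = c" for z
    using that by (simp add: d_def poly_fps_nth_0)
  have dL: "d \<in> L"
    using coeffs_in_poly[OF RF coeffs_in_pderiv[OF RF g] fps_const_over[OF RL c]] by (simp add: d_def fps_over_def)
  \<comment> \<open>The step after \<open>z n\<close> cancels the coefficient with index
    \<open>n + 1\<close> of the value of \<open>g\<close>; those up to \<open>n\<close> vanish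
    already.\<close>
  define z where "z = rec_nat (fps_const c)
    (\<lambda>n z. z - fps_const (fps_nth (poly g z) (Suc n) / d) * fps_X ^ Suc n)"
  have z0: "z 0 = fps_const c"
    and zS: "z (Suc n) = z n - fps_const (fps_nth (poly g (z n)) (Suc n) / d) * fps_X ^ Suc n" for n
    by (simp_all add: z_def)
  have inv: "z n \<in> fps_over L \<and> fps_nth (z n) 0 = c \<and> (\<forall>i\<le>n. fps_nth (poly g (z n)) i = 0)" for n
  proof (induction n)
    case 0
    then show ?case using root c RL by (simp add: z0 fps_const_over)
  next
    case (Suc n)
    define e where "e = fps_nth (poly g (z n)) (Suc n) / d"
    define h where "h = - (fps_const e * fps_X ^ Suc n)"
    have zS': "z (Suc n) = z n + h" by (simp add: zS h_def e_def)
    have "fps_nth (poly g (z n)) (Suc n) \<in> L"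
      using coeffs_in_poly[OF RF g] Suc.IH by (auto simp: fps_over_def)
    then have eL: "e \<in> L" unfolding e_def by (intro field_closed_divide[OF L] dL)
    have "h \<in> fps_over L" unfolding h_def
      by (intro ring_closed_intros RF fps_const_over RL eL fps_X_over)
    then have 1: "z (Suc n) \<in> fps_over L" using Suc.IH zS' ring_closed_add[OF RF] by metis
    have h_nth: "fps_nth (h * f) i = (if i < Suc n then 0 else - e * fps_nth f (i - Suc n))" for f i
      unfolding h_def using fps_X_power_mult_nth[of "Suc n" f i]
      by (simp add: mult.assoc del: power_Suc)
    \<comment> \<open>The quadratic Taylor term has order at least \<open>2 n + 2\<close>, beyond
      the coefficient being cancelled.\<close>
    obtain q where q: "poly g (z n + h) - poly g (z n) - h * poly (pderiv g) (z n) = h ^ 2 * q"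
      using poly_taylor_dvd[of h g "z n"] by (auto elim: dvdE)
    have eq: "poly g (z (Suc n)) = poly g (z n) + h * poly (pderiv g) (z n) + h * (h * q)"
      using q by (simp add: zS' algebra_simps power2_eq_square)
    have 2: "fps_nth (poly g (z (Suc n))) i = 0" if i: "i \<le> Suc n" for i
    proof (cases "i = Suc n")
      case True
      then show ?thesis using dz[of "z n"] Suc.IH simple h_nth[of 1 0]
        by (simp add: eq h_nth e_def d_def[symmetric])
    next
      case False
      then show ?thesis using i Suc.IH by (simp add: eq h_nth)
    qed
    have "fps_nth (z (Suc n)) 0 = c"
      using h_nth[of 1 0] Suc.IH by (simp add: zS')
    then show ?case using 1 2 by blast
  qed
  have stab: "fps_nth (z m) i = fps_nth (z i) i" if "i \<le> m" for m i
    using that by (induction m rule: dec_induct) (auto simp: zS fps_X_power_mult_right_nth simp del: power_Suc)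
  \<comment> \<open>Passing from \<open>z n\<close> to its successor changes only the coefficient
    with index \<open>n + 1\<close>, so the limit is read off the diagonal.\<close>
  define y where "y = Abs_fps (\<lambda>n. fps_nth (z n) n)"
  have "fps_nth (poly g y) m = 0" for m
  proof -
    define r where "r = fps_shift (Suc m) (y - z m)"
    have "y - z m = fps_X ^ Suc m * r"
    proof (rule fps_ext)
      fix i show "fps_nth (y - z m) i = fps_nth (fps_X ^ Suc m * r) i"
        using stab[of i m] by (simp add: fps_X_power_mult_nth r_def y_def del: power_Suc)
    qed
    then have "fps_X ^ Suc m dvd poly g y - poly g (z m)"
      using poly_diff_dvd[of y "z m" g] by (metis dvd_mult_left)
    then obtain q where "poly g y - poly g (z m) = fps_X ^ Suc m * q" by (rule dvdE)
    then have "fps_nth (poly g y - poly g (z m)) m = 0"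
      by (simp add: fps_X_power_mult_nth del: power_Suc)
    then show ?thesis using inv[of m] by simp
  qed
  then have "poly g y = 0" by (simp add: fps_eq_iff)
  moreover have "y \<in> fps_over L" "fps_nth y 0 = c" using inv by (auto simp: y_def fps_over_def)
  ultimately show ?thesis by blast
qed

section \<open>Points over power series\<close>

definition alg_tower :: "(nat \<Rightarrow> 'a::field_char_0 fps) \<Rightarrow> nat \<Rightarrow> bool" where
  "alg_tower z j \<longleftrightarrow> (\<forall>i<j. alg_over (term_ring UNIV fps_const z i) (z (Suc i)))"

lemma poly_star:
  assumes c: "\<And>i. coeff p i = star_n (\<lambda>m. coeff (P m) i)" and d: "\<And>m. degree (P m) \<le> d"
  shows "poly p (star_n Z) = star_n (\<lambda>m. poly (P m) (Z m))"
proof -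
  have "degree p \<le> d"
    by (rule degree_le) (auto simp: c star_n_simps(1) intro!: arg_cong[of _ _ star_n] coeff_eq_0 le_less_trans[OF d])
  then have "poly p (star_n Z) = (\<Sum>i\<le>d. coeff p i * star_n Z ^ i)"
    by (metis (no_types, lifting) poly_as_sum_of_monoms' poly_monom poly_sum sum.cong)
  moreover have "poly (P m) x = (\<Sum>i\<le>d. coeff (P m) i * x ^ i)" for m x
    using d[of m] by (metis (no_types, lifting) poly_as_sum_of_monoms' poly_monom poly_sum sum.cong)
  ultimately show ?thesis
    by (simp add: c star_n_power star_n_simps star_n_sum)
qed

lemma hom_on_subset: "ring_hom_on S H \<Longrightarrow> R \<subseteq> S \<Longrightarrow> ring_hom_on R H"
  by (auto simp: ring_hom_on_def)

lemma degree_map_poly_le: "f 0 = 0 \<Longrightarrow> degree (map_poly f p) \<le> degree p"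
  by (rule degree_le) (simp add: coeff_map_poly coeff_eq_0)

context
  fixes L :: "'a::field_char_0 set" and E :: "nat \<Rightarrow> nat \<Rightarrow> 'a" and k :: nat
  assumes L: "field_closed L" and E: "\<And>n i. i \<le> k \<Longrightarrow> E n i \<in> L" and inj: "inj (\<lambda>n. E n 0)"
begin

text \<open>The points \<open>E n\<close> assembled into one point of the ultrapower: a relation
  with parameters holds there iff it holds at \<open>E n\<close> for almost all
  \<open>n\<close>.\<close>

definition gen :: "nat \<Rightarrow> 'a star" where
  "gen i = star_n (\<lambda>n. E n i)"

text \<open>A power series arc through the \<open>m\<close>-th point: modulo \<open>t\<close> the
  map \<open>H\<close> is evaluation at \<open>E m\<close>, and the first coordinate moves as
  \<open>E m 0 + t\<close>.\<close>

definition point_hom :: "nat \<Rightarrow> nat \<Rightarrow> ('a star \<Rightarrow> 'a fps) \<Rightarrow> (nat \<Rightarrow> 'a fps) \<Rightarrow> bool" where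
  "point_hom j m H z \<longleftrightarrow> ring_hom_on (term_ring L star_of gen j) H \<and> (\<forall>c\<in>L. H (star_of c) = fps_const c) \<and>
     (\<forall>i\<le>j. H (gen i) = z i \<and> fps_nth (z i) 0 = E m i \<and> z i \<in> fps_over L) \<and>
     z 0 = fps_const (E m 0) + fps_X \<and> alg_tower z j"

text \<open>A nonzero polynomial over \<open>L\<close> vanishes at finitely many of the distinct
  values \<open>E n 0\<close> only, hence on a negligible set of indices.\<close>

lemma gen_transcendental: "\<not> alg_over (star_of ` L) (gen 0)"
proof
  assume "alg_over (star_of ` L) (gen 0)"
  then obtain p where p: "coeffs_in (star_of ` L) p" "p \<noteq> 0" "poly p (gen 0) = 0"
    by (auto simp: alg_over_def annihilates_def)
  have "\<forall>i. \<exists>c. coeff p i = star_of c" using p(1) by (auto simp: coeffs_in_def)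
  then obtain c where c: "\<And>i. coeff p i = star_of (c i)" by metis
  define q where "q = map_poly (Hilbert_Choice.inv star_of) p"
  have i: "Hilbert_Choice.inv star_of (star_of x) = x" for x :: 'a
    by (simp add: Hilbert_Choice.inv_f_f inj_def star_of_eq_iff)
  have cq: "coeff q i = c i" for i
    using i[of 0] by (simp add: q_def coeff_map_poly star_of_simps c i)
  have "q \<noteq> 0" using p(2) c cq star_of_simps(1) by (metis coeff_0 poly_eqI)
  have "poly p (gen 0) = star_n (\<lambda>m. poly q (E m 0))"
    unfolding gen_def by (rule poly_star[of _ _ "degree q"]) (simp_all add: cq c star_of_def)
  then have "eventually (\<lambda>m. poly q (E m 0) = 0) ultra" using p(3) by (simp add: star_n_simps(1) star_n_eq_iff)
  moreover have "finite {m. poly q (E m 0) = 0}"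
    using finite_vimageI[OF poly_roots_finite[OF \<open>q \<noteq> 0\<close>] inj] by (simp add: vimage_def)
  ultimately show False using ultra_sets(1) by (auto simp: eventually_ultra)
qed

lemma point_hom_0: "\<exists>H z. point_hom 0 m H z"
proof -
  have R: "ring_closed (star_of ` L)"
    by (rule hom_on_image[OF field_closed_ring[OF L] ring_hom_on_star_of])
  have i: "Hilbert_Choice.inv star_of (star_of x) = x" for x :: 'a
    by (simp add: Hilbert_Choice.inv_f_f inj_def star_of_eq_iff)
  define h where "h x = fps_const (Hilbert_Choice.inv star_of x)" for x :: "'a star"
  have hs: "h (star_of c) = fps_const c" for c by (simp add: h_def i)
  have h: "ring_hom_on (star_of ` L) h"
    unfolding ring_hom_on_def using hs[of 1]
    by (auto simp: hs star_of_simps(2) simp flip: star_of_simps(4,5))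
  define x where "x = fps_const (E m 0) + fps_X"
  \<comment> \<open>Only the zero polynomial is a relation of \<open>gen 0\<close>, so this
    generator may be sent to any power series.\<close>
  have "poly (map_poly h p) x = 0" if "coeffs_in (star_of ` L) p" "poly p (gen 0) = 0" for p
    using gen_transcendental that by (cases "p = 0") (auto simp: alg_over_def annihilates_def)
  then obtain H where H: "ring_hom_on (adjoin (star_of ` L) (gen 0)) H"
    "\<And>y. y \<in> star_of ` L \<Longrightarrow> H y = h y" "H (gen 0) = x"
    using hom_on_adjoin[OF R h, of "gen 0" x] by blast
  have "term_ring L star_of gen 0 \<subseteq> adjoin (star_of ` L) (gen 0)"
    using adjoin_superset[OF R] by (intro term_ring_least ring_closed_adjoin R) (auto simp: adjoin_self[OF R])
  then have "point_hom 0 m H (\<lambda>_. x)"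
    using H hom_on_subset[OF H(1)] E[of 0 m] field_closed_ring[OF L]
    by (auto simp: point_hom_def hs alg_tower_def x_def intro!: ring_closed_add ring_closed_fps_over fps_const_over fps_X_over)
  then show ?thesis by blast
qed

lemma point_hom_tval:
  assumes "point_hom j m H z" "set_rterm t \<subseteq> L" "rterm_vars t \<subseteq> {..j}"
  shows "H (tval star_of gen t) = tval fps_const z t"
proof -
  have "H (tval star_of gen t) = tval (\<lambda>c. H (star_of c)) (\<lambda>i. H (gen i)) t"
    using assms by (intro tval_hom[OF ring_closed_term_ring]) (auto simp: point_hom_def intro: term_ring_param term_ring_var)
  also have "\<dots> = tval fps_const z t"
    using assms by (intro tval_cong) (auto simp: point_hom_def)
  finally show ?thesis .
qed

lemma point_hom_nth_0:
  assumes "point_hom j m H z" "set_rterm t \<subseteq> L" "rterm_vars t \<subseteq> {..j}"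
  shows "fps_nth (H (tval star_of gen t)) 0 = rterm_val (E m) t"
proof -
  have "fps_nth (tval fps_const z t) 0 = tval (\<lambda>c. fps_nth (fps_const c) 0) (\<lambda>i. fps_nth (z i) 0) t"
    by (rule tval_hom[OF ring_closed_UNIV fps_nth_0_hom]) auto
  also have "\<dots> = tval (\<lambda>x. x) (E m) t"
    using assms by (intro tval_cong) (auto simp: point_hom_def)
  finally show ?thesis using point_hom_tval[OF assms] by (simp add: tval_id)
qed

lemma point_hom_extend:
  assumes H: "point_hom j m H z" and z': "z' \<in> fps_over L" "fps_nth z' 0 = E m (Suc j)"
    "alg_over (term_ring UNIV fps_const z j) z'"
    and ext: "\<And>p. coeffs_in (term_ring L star_of gen j) p \<Longrightarrow> poly p (gen (Suc j)) = 0 \<Longrightarrow> poly (map_poly H p) z' = 0"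
  shows "\<exists>H z. point_hom (Suc j) m H z"
proof -
  let ?R = "term_ring L star_of gen j"
  have h: "ring_hom_on ?R H" using H by (simp add: point_hom_def)
  obtain H' where H': "ring_hom_on (adjoin ?R (gen (Suc j))) H'" "\<And>x. x \<in> ?R \<Longrightarrow> H' x = H x"
    "H' (gen (Suc j)) = z'"
    using hom_on_adjoin[OF ring_closed_term_ring h, of "gen (Suc j)" z'] ext by blast
  define w where "w = z(Suc j := z')"
  have w: "i \<le> j \<Longrightarrow> w i = z i" for i by (simp add: w_def)
  have "term_ring UNIV fps_const w i = term_ring UNIV fps_const z i" if "i \<le> j" for i
    using that w by (intro term_ring_cong) auto
  then have "alg_tower w (Suc j)"
    using H z'(3) by (auto simp: alg_tower_def point_hom_def w_def less_Suc_eq)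
  then have "point_hom (Suc j) m H' w"
    using H H' hom_on_subset[OF H'(1) term_ring_Suc] z' 
    by (auto simp: point_hom_def w_def le_Suc_eq term_ring_param term_ring_var)
  then show ?thesis by blast
qed

text \<open>A transcendental generator is frozen at its value at \<open>m\<close>; an algebraic one is lifted to a power
  series by Hensel's lemma.\<close>

lemma point_hom_Suc:
  assumes j: "Suc j \<le> k" and IH: "eventually (\<lambda>m. \<exists>H z. point_hom j m H z) ultra"
  shows "eventually (\<lambda>m. \<exists>H z. point_hom (Suc j) m H z) ultra"
proof -
  let ?R = "term_ring L star_of gen j"
  note RR = ring_closed_term_ring[of L star_of gen j]
  note RL = field_closed_ring[OF L]
  show ?thesis
  proof (cases "alg_over ?R (gen (Suc j))")
    case False
    \<comment> \<open>There is no relation over the earlier generators to be respected, and a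
      constant is algebraic over everything.\<close>
    have "\<exists>H z. point_hom (Suc j) m H z" if "point_hom j m H z" for m H z
    proof (rule point_hom_extend[OF that])
      show "fps_const (E m (Suc j)) \<in> fps_over L" by (intro fps_const_over RL E j)
      show "alg_over (term_ring UNIV fps_const z j) (fps_const (E m (Suc j)))"
        by (intro alg_over_self ring_closed_term_ring term_ring_param) simp
      show "poly (map_poly H p) (fps_const (E m (Suc j))) = 0"
        if "coeffs_in ?R p" "poly p (gen (Suc j)) = 0" for p
        using False that by (cases "p = 0") (auto simp: alg_over_def annihilates_def)
    qed simp
    then show ?thesis using IH by (auto elim: eventually_mono)
  next
    case True
    then obtain g where g: "min_annihilator ?R (gen (Suc j)) g" using min_annihilator_exists by blast
    note g' = min_annihilatorD[OF g]
    have "\<forall>i. \<exists>t. coeff g i = tval star_of gen t \<and> set_rterm t \<subseteq> L \<and> rterm_vars t \<subseteq> {..j}"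
      using g'(1) by (auto simp: coeffs_in_def term_ring_def)
    then obtain t where t: "\<And>i. coeff g i = tval star_of gen (t i)" "\<And>i. set_rterm (t i) \<subseteq> L"
      "\<And>i. rterm_vars (t i) \<subseteq> {..j}" by metis
    \<comment> \<open>The polynomial \<open>g\<close> in the component \<open>m\<close>: its
      coefficients are given by terms, evaluated here at \<open>E m\<close>.\<close>
    define G where "G m = (\<Sum>i\<le>degree g. monom (rterm_val (E m) (t i)) i)" for m
    have cG: "coeff (G m) i = (if i \<le> degree g then rterm_val (E m) (t i) else 0)" for m i
      by (simp add: G_def coeff_sum)
    have gt: "coeff g i = star_n (\<lambda>m. rterm_val (E m) (t i))" for i
      using t(1)[of i] tval_star[of E "t i"] by (simp add: gen_def[abs_def])
    have gG: "coeff g i = star_n (\<lambda>m. coeff (G m) i)" for i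
      using gt[of i] by (cases "i \<le> degree g") (simp_all add: cG coeff_eq_0 star_n_simps(1)[symmetric])
    have dG: "degree (G m) \<le> degree g" for m by (rule degree_le) (simp add: cG)
    have of_nat: "of_nat n = star_n (\<lambda>_. of_nat n :: 'a)" for n
      by (induction n) (auto simp: star_n_simps)
    have "coeff (pderiv g) i = star_n (\<lambda>m. coeff (pderiv (G m)) i)" for i
      by (simp only: coeff_pderiv gG of_nat star_n_simps)
    then have "poly (pderiv g) (gen (Suc j)) = star_n (\<lambda>m. poly (pderiv (G m)) (E m (Suc j)))"
      unfolding gen_def by (rule poly_star[of _ _ "degree g"]) (auto simp: degree_pderiv intro: order.trans[OF diff_le_self dG])
    \<comment> \<open>By \<open>e1\<close>, \<open>e2\<close> and \<open>e3\<close>, for almost all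
      \<open>m\<close> the value \<open>E m (Suc j)\<close> is a simple root of \<open>G m\<close>
      and the leading coefficient survives. These are the conditions for Hensel lifting and for
      \<open>specialise_root\<close>.\<close>
    then have e1: "eventually (\<lambda>m. poly (pderiv (G m)) (E m (Suc j)) \<noteq> 0) ultra"
      using min_annihilator_pderiv[OF RR g] by (simp add: star_n_simps(1) star_n_eq_iff ultra_not)
    have "poly g (gen (Suc j)) = star_n (\<lambda>m. poly (G m) (E m (Suc j)))"
      unfolding gen_def by (rule poly_star[of _ _ "degree g"]) (auto simp: gG dG)
    then have e2: "eventually (\<lambda>m. poly (G m) (E m (Suc j)) = 0) ultra"
      using g'(3) by (simp add: star_n_simps(1) star_n_eq_iff)
    have e3: "eventually (\<lambda>m. coeff (G m) (degree g) \<noteq> 0) ultra"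
      using g'(2) gG[of "degree g"] by (simp add: star_n_simps(1) star_n_eq_iff ultra_not flip: leading_coeff_0_iff)
    have step: "\<exists>H z. point_hom (Suc j) m H z" if ph: "point_hom j m H z"
      and m: "poly (pderiv (G m)) (E m (Suc j)) \<noteq> 0" "poly (G m) (E m (Suc j)) = 0" "coeff (G m) (degree g) \<noteq> 0" for m H z
    proof -
      have h: "ring_hom_on ?R H" using ph by (simp add: point_hom_def)
      define f where "f = map_poly H g"
      have cf: "coeff f i = tval fps_const z (t i)" for i
        using point_hom_tval[OF ph t(2,3)] by (simp add: f_def coeff_map_hom[OF RR h] t(1))
      have cf0: "fps_nth (coeff f i) 0 = coeff (G m) i" for i
      proof (cases "i \<le> degree g")
        case True
        then show ?thesis using point_hom_nth_0[OF ph t(2,3)] cf[of i] point_hom_tval[OF ph t(2,3)] by (simp add: cG)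
      next
        case False
        then have "coeff f i = 0" by (simp add: f_def coeff_map_hom[OF RR h] coeff_eq_0 hom_on_0[OF RR h])
        then show ?thesis using False by (simp add: cG)
      qed
      \<comment> \<open>Reduction of \<open>f\<close> modulo \<open>t\<close> is \<open>G m\<close>,
        so the simple root of \<open>G m\<close> lifts to a root of \<open>f\<close>.\<close>
      have fG: "map_poly (\<lambda>x. fps_nth x 0) f = G m" by (simp add: poly_eq_iff coeff_map_poly cf0)
      have fG': "map_poly (\<lambda>x. fps_nth x 0) (pderiv f) = pderiv (G m)"
        using map_poly_hom_pderiv[OF ring_closed_UNIV fps_nth_0_hom, of f] fG by (simp add: coeffs_in_def)
      have zL: "z i \<in> fps_over L" if "i \<le> j" for i using ph that by (simp add: point_hom_def)
      have "coeffs_in (fps_over L) f"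
        unfolding coeffs_in_def cf using t(2) subsetD[OF t(3)]
        by (intro allI tval_in ring_closed_fps_over RL) (auto intro!: fps_const_over RL zL)
      then obtain z' where z': "z' \<in> fps_over L" "fps_nth z' 0 = E m (Suc j)" "poly f z' = 0"
        using fps_hensel[OF L _ E[OF j], of f m] m by (auto simp: poly_fps_nth_0 fG fG')
      have lc: "H (lead_coeff g) \<noteq> 0"
        using m(3) cf0[of "degree g"] by (auto simp: f_def coeff_map_hom[OF RR h])
      have "coeffs_in (term_ring UNIV fps_const z j) f"
        unfolding coeffs_in_def cf using t(3) by (auto intro: term_ringI)
      moreover have "f \<noteq> 0" using lc by (auto simp: f_def coeff_map_hom[OF RR h, symmetric])
      ultimately have "alg_over (term_ring UNIV fps_const z j) z'"
        using z'(3) by (auto simp: alg_over_def annihilates_def)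
      then show ?thesis
        using point_hom_extend[OF ph z'(1,2)] specialise_root[OF RR h g lc z'(3)[unfolded f_def]] by blast
    qed
    show ?thesis
      using IH e1 e2 e3 by eventually_elim (auto intro: step)
  qed
qed

lemma point_hom_exists: "j \<le> k \<Longrightarrow> eventually (\<lambda>m. \<exists>H z. point_hom j m H z) ultra"
  by (induction j) (auto simp: point_hom_0 point_hom_Suc)

text \<open>Since \<open>H\<close> may have a kernel, an atom that is nonzero at the generic point
  could vanish on the power series. There are finitely many atoms, so \<open>m\<close> can be chosen
  such that those nonzero at the generic point are nonzero at \<open>E m\<close>; their power series
  then have a nonzero constant term.\<close>

lemma power_series_point:
  assumes \<phi>: "set_qf_formula \<phi> \<subseteq> L" "qf_vars \<phi> \<subseteq> {..k}" and false: "\<And>n. \<not> qf_sat (E n) \<phi>"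
  shows "\<exists>m z. z 0 = fps_const (E m 0) + fps_X \<and> (\<forall>i\<le>k. z i \<in> fps_over L) \<and> alg_tower z k \<and> \<not> qval fps_const z \<phi>"
proof -
  have star_false: "\<not> qval star_of gen \<phi>"
    using false qval_star[of E \<phi>] by (simp add: gen_def[abs_def])
  have tv: "tval star_of gen t = star_n (\<lambda>n. rterm_val (E n) t)" for t
    using tval_star[of E t] by (simp add: gen_def[abs_def])
  have "eventually (\<lambda>m. \<forall>t\<in>qf_atoms \<phi>. tval star_of gen t \<noteq> 0 \<longrightarrow> rterm_val (E m) t \<noteq> 0) ultra"
    using finite_qf_atoms by (intro eventually_ball_finite ballI)
      (auto simp: tv star_n_simps(1) star_n_eq_iff ultra_not[symmetric] elim: eventually_mono)
  from ultra_imp_ex[OF eventually_conj[OF point_hom_exists[OF order_refl] this]]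
  obtain m H z where ph: "point_hom k m H z"
    and nz: "\<And>t. t \<in> qf_atoms \<phi> \<Longrightarrow> tval star_of gen t \<noteq> 0 \<Longrightarrow> rterm_val (E m) t \<noteq> 0" by blast
  have "tval star_of gen t = 0 \<longleftrightarrow> tval fps_const z t = 0" if t: "t \<in> qf_atoms \<phi>" for t
  proof -
    have p: "set_rterm t \<subseteq> L" "rterm_vars t \<subseteq> {..k}"
      using \<phi> qf_atoms_vars[OF t] qf_atoms_params[OF t] by auto
    have "H 0 = 0" using ph hom_on_0[OF ring_closed_term_ring] by (auto simp: point_hom_def)
    then show ?thesis
      using point_hom_tval[OF ph p] point_hom_nth_0[OF ph p] nz[OF t] by (metis fps_zero_nth)
  qed
  then have "\<not> qval fps_const z \<phi>" using star_false qval_atoms_cong by blast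
  then show ?thesis using ph by (auto simp: point_hom_def)
qed

end

section \<open>Embedding the power series point into the ultrapower\<close>

lemma rat_functions_subset: "(\<And>n. W n \<in> \<rat>) \<Longrightarrow> rat_functions (star_n W) \<subseteq> star_set \<rat>"
  by (intro rat_functions_least field_closed_star_set field_closed_Rats star_setI)

lemma star_of_rat: "star_of (of_rat r) = of_rat r"
proof -
  have nat: "star_of (of_nat n :: 'a) = of_nat n" for n by (induction n) (auto simp: star_of_simps)
  have int: "star_of (of_int n :: 'a) = of_int n" for n
    by (cases n rule: int_diff_cases) (simp add: star_of_simps nat)
  have inv: "star_of (a / b) = star_of a / star_of b" for a b :: 'a
    by (simp add: divide_inverse star_of_simps) (simp add: star_of_def star_n_inverse)
  obtain a b where "r = of_int a / of_int b" by (metis quotient_of_div surj_pair)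
  then show ?thesis by (simp add: of_rat_divide inv int)
qed

lemma alg_over_Rats:
  assumes "algebraic (c :: 'a::field_char_0)"
  shows "alg_over \<rat> c"
proof -
  obtain p where "\<And>i. coeff p i \<in> \<int>" "p \<noteq> 0" "poly p c = 0" using assms by (auto simp: algebraic_def)
  then show ?thesis
    using Ints_subset_Rats by (auto simp: alg_over_def annihilates_def coeffs_in_def)
qed

lemma alg_over_Rats_star_of:
  assumes "algebraic (c :: 'a::field_char_0)"
  shows "alg_over \<rat> (star_of c)"
proof -
  obtain p where p: "coeffs_in \<rat> p" "p \<noteq> 0" "poly p c = 0"
    using alg_over_Rats[OF assms] by (auto simp: alg_over_def annihilates_def)
  have "coeff (map_poly star_of p) i \<in> \<rat>" for i
  proof -
    obtain r where "coeff p i = of_rat r" using p by (auto simp: coeffs_in_def elim: Rats_cases)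
    then show ?thesis by (simp add: coeff_map_poly star_of_simps(1) star_of_rat)
  qed
  moreover have "coeff (map_poly star_of p) (degree p) \<noteq> 0"
    using p(2) by (simp add: coeff_map_poly star_of_simps(1) star_of_eq_iff flip: star_of_simps(1))
  then have "map_poly star_of p \<noteq> 0" by (metis coeff_0)
  moreover have "poly (map_poly star_of p) (star_of c) = 0"
    using poly_map_hom[OF ring_closed_UNIV ring_hom_on_star_of coeffs_in_UNIV, of c p] p(3) by (simp add: star_of_simps)
  ultimately show ?thesis by (auto simp: alg_over_def annihilates_def coeffs_in_def)
qed

lemma star_of_algebraic: "algebraic c \<Longrightarrow> star_of c \<in> alg_elements (rat_functions (x :: 'a::field_char_0 star))"
  unfolding alg_elements_def
  by (intro CollectI alg_over_mono[OF alg_over_Rats_star_of] Rats_least field_closed_rat_functions)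

text \<open>With constant coefficients, a polynomial in \<open>c + t\<close> is a polynomial in
  \<open>t\<close> shifted by \<open>c\<close>, and the shift is injective.\<close>

lemma fps_shifted_X_transcendental:
  assumes "coeffs_in (range fps_const) p" "poly p (fps_const c + fps_X) = (0 :: 'a::field fps)"
  shows "p = 0"
proof -
  define q where "q = map_poly (\<lambda>f. fps_nth f 0) p"
  have pq: "p = map_poly fps_const q"
    using assms(1) by (auto simp: poly_eq_iff coeff_map_poly q_def coeffs_in_def image_iff) (metis fps_nth_fps_const)
  have "poly (map_poly fps_const r) (fps_const c + fps_X) = fps_of_poly (pcompose r [:c, 1:])" for r
    by (induction r) (auto simp: map_poly_pCons pcompose_pCons fps_of_poly_add fps_of_poly_mult fps_of_poly_pCons algebra_simps)
  then have "pcompose q [:c, 1:] = 0" using assms(2) by (simp add: pq)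
  then have "q = 0" by (simp add: pcompose_eq_0_iff)
  then show ?thesis by (simp add: pq)
qed

text \<open>Both \<open>c + t\<close> and \<open>x\<close> are transcendental over the constants, so
  one can be sent to the other; the algebraic generators follow because the ultrapower is
  algebraically closed. The images are algebraic over \<rat>(x) since all constants are algebraic
  numbers.\<close>

lemma tower_embedding:
  fixes z :: "nat \<Rightarrow> 'a::{alg_closed_field,field_char_0} fps"
  assumes alg: "\<And>c::'a. algebraic c"
    and z0: "z 0 = fps_const c + fps_X" and x: "\<not> alg_over (range star_of) x"
  shows "alg_tower z k \<Longrightarrow> \<exists>S. ring_hom_on (term_ring UNIV fps_const z k) S \<and> (\<forall>c. S (fps_const c) = star_of c) \<and>
     S (z 0) = x \<and> (\<forall>f\<in>term_ring UNIV fps_const z k. S f = 0 \<longrightarrow> f = 0) \<and> (\<forall>i\<le>k. S (z i) \<in> alg_elements (rat_functions x))"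
proof (induction k)
  case 0
  have R: "ring_closed (range (fps_const :: 'a \<Rightarrow> 'a fps))"
    by (intro hom_on_image[OF ring_closed_UNIV]) (simp add: ring_hom_on_def)
  define h where "h f = star_of (fps_nth f 0)" for f :: "'a fps"
  have h: "ring_hom_on (range fps_const) h" by (simp add: ring_hom_on_def h_def star_of_simps)
  have "poly (map_poly h p) x = 0" if "coeffs_in (range fps_const) p" "poly p (z 0) = 0" for p
    using fps_shifted_X_transcendental[OF that(1) that(2)[unfolded z0]] by simp
  then obtain S where S: "ring_hom_on (adjoin (range fps_const) (z 0)) S" "\<And>f. f \<in> range fps_const \<Longrightarrow> S f = h f" "S (z 0) = x"
    "\<And>p. coeffs_in (range fps_const) p \<Longrightarrow> S (poly p (z 0)) = poly (map_poly h p) x"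
    using hom_on_adjoin[OF R h, of "z 0" x] by blast
  have sub: "term_ring UNIV fps_const z 0 \<subseteq> adjoin (range fps_const) (z 0)"
    using adjoin_superset[OF R] by (intro term_ring_least ring_closed_adjoin R) (auto simp: adjoin_self[OF R])
  have inj: "f = 0" if f: "f \<in> adjoin (range fps_const) (z 0)" "S f = 0" for f
  proof -
    obtain p where p: "coeffs_in (range fps_const) p" "f = poly p (z 0)" using f by (auto simp: adjoin_def)
    have "coeffs_in (range star_of) (map_poly h p)"
      by (auto simp: coeffs_in_def coeff_map_poly h_def star_of_simps)
    then have "map_poly h p = 0"
      using x f(2) p by (auto simp: alg_over_def annihilates_def S(4))
    moreover have "h a = 0 \<Longrightarrow> a = 0" if "a \<in> range fps_const" for a
      using that by (auto simp: h_def star_of_eq_iff simp flip: star_of_simps(1))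
    ultimately have "p = 0"
      using p(1) coeff_map_hom[OF R h, of p] by (auto simp: poly_eq_iff coeffs_in_def)
    then show ?thesis using p by simp
  qed
  have "x \<in> alg_elements (rat_functions x)"
    using alg_elements_superset[OF field_closed_ring[OF field_closed_rat_functions]] rat_functions_self by blast
  then show ?case
    using S hom_on_subset[OF S(1) sub] inj sub by (intro exI[of _ S]) (auto simp: h_def)
next
  case (Suc k)
  let ?R = "term_ring UNIV fps_const z k" and ?C = "alg_elements (rat_functions x)"
  note R = ring_closed_term_ring[of UNIV fps_const z k]
  have "alg_tower z k" "alg_over ?R (z (Suc k))" using Suc.prems by (auto simp: alg_tower_def)
  then obtain S where S: "ring_hom_on ?R S" "\<And>c. S (fps_const c) = star_of c" "S (z 0) = x"
    "\<And>f. f \<in> ?R \<Longrightarrow> S f = 0 \<Longrightarrow> f = 0" "\<And>i. i \<le> k \<Longrightarrow> S (z i) \<in> ?C"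
    using Suc.IH by blast
  obtain S' where S': "ring_hom_on (adjoin ?R (z (Suc k))) S'" "\<And>f. f \<in> ?R \<Longrightarrow> S' f = S f"
    "\<And>f. f \<in> adjoin ?R (z (Suc k)) \<Longrightarrow> S' f = 0 \<Longrightarrow> f = 0" "alg_over (S ` ?R) (S' (z (Suc k)))"
    using hom_on_adjoin_inj[OF R S(1,4) \<open>alg_over ?R (z (Suc k))\<close>] by blast
  note C = field_closed_alg_elements[OF field_closed_rat_functions, of x]
  have "S (tval fps_const z t) \<in> ?C" if t: "rterm_vars t \<subseteq> {..k}" for t
  proof -
    have "S (tval fps_const z t) = tval (\<lambda>c. S (fps_const c)) (\<lambda>i. S (z i)) t"
      using t by (intro tval_hom[OF R S(1)]) (auto intro: term_ring_param term_ring_var)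
    also have "\<dots> \<in> ?C"
      using t S(2,5) star_of_algebraic[OF alg] by (intro tval_in field_closed_ring[OF C]) auto
    finally show ?thesis .
  qed
  then have "S ` ?R \<subseteq> ?C" by (auto simp: term_ring_def)
  then have new: "S' (z (Suc k)) \<in> ?C"
    using alg_elements_trans[OF field_closed_rat_functions] alg_over_mono[OF S'(4)] by blast
  have sub: "term_ring UNIV fps_const z (Suc k) \<subseteq> adjoin ?R (z (Suc k))" by (rule term_ring_Suc)
  have old: "S' (z i) = S (z i)" if "i \<le> k" for i using that S'(2) term_ring_var by blast
  have "S' (fps_const c) = star_of c" for c using S'(2)[OF term_ring_param] S(2) by simp
  moreover have "S' (z i) \<in> ?C" if "i \<le> Suc k" for i
    using that old S(5) new by (cases "i = Suc k") auto
  moreover have "S' (z 0) = x" using old S(3) by simp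
  ultimately show ?case
    using hom_on_subset[OF S'(1) sub] S'(3) sub by blast
qed

section \<open>Specialisation at rational points\<close>

text \<open>Reduction modulo \<open>g\<close> bounds the degree independently of \<open>b\<close>.
  Used in every component, it gives the common bound under which a sequence of polynomials is a
  polynomial over the ultrapower.\<close>

lemma adjoin_bounded_degree:
  fixes g :: "'b::field poly"
  assumes k: "field_closed k" and g: "coeffs_in k g" "g \<noteq> 0" "poly g z = 0" and b: "b \<in> adjoin k z"
  obtains p where "coeffs_in k p" "degree p \<le> degree g" "poly p z = b"
proof -
  note R = field_closed_ring[OF k]
  obtain f where f: "coeffs_in k f" "b = poly f z" using b by (auto simp: adjoin_def)
  obtain N q r where qr: "coeffs_in k r" "smult (lead_coeff g ^ N) f = g * q + r" "r = 0 \<or> degree r < degree g"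
    using pseudo_division_in[OF R g(1,2) f(1)] by blast
  define c where "c = lead_coeff g ^ N"
  have c: "c \<in> k" "c \<noteq> 0" using g by (auto simp: c_def coeffs_in_def intro!: ring_closed_power R)
  have "poly (smult (inverse c) r) z = b"
    using arg_cong[OF qr(2), of "\<lambda>p. poly p z"] f g c by (simp add: c_def[symmetric] field_simps)
  moreover have "coeffs_in k (smult (inverse c) r)"
    using c qr(1) by (intro coeffs_in_smult R field_closed_inverse[OF k])
  ultimately show ?thesis using that[of "smult (inverse c) r"] qr(3) by auto
qed

text \<open>Pulled back along the embedding \<open>S\<close>, an element of \<open>\<rat>(x)(U)\<close> is a quotient of power series over \<open>L\<close>.\<close>

lemma constant_in_fps_over:
  fixes z :: "nat \<Rightarrow> 'a::field_char_0 fps"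
  assumes L: "field_closed L" and S: "ring_hom_on (term_ring UNIV fps_const z k) S"
    "\<And>c. S (fps_const c) = star_of c" "\<And>f. f \<in> term_ring UNIV fps_const z k \<Longrightarrow> S f = 0 \<Longrightarrow> f = 0"
    and z: "\<And>i. i \<le> k \<Longrightarrow> z i \<in> fps_over L"
    and U: "U = star_of ` D \<union> S ` z ` {..k}" "D \<subseteq> L"
    and w: "\<And>T. ring_closed T \<Longrightarrow> U \<subseteq> T \<Longrightarrow> w \<in> T"
    and b: "star_of b \<in> adjoin (rat_functions (S (z 0))) w"
  shows "b \<in> L"
proof -
  let ?R = "term_ring UNIV fps_const z k"
  note R = ring_closed_term_ring[of UNIV fps_const z k]
  note RF = ring_closed_fps_over[OF field_closed_ring[OF L]]
  define C where "C = ?R \<inter> fps_over L"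
  have C: "ring_closed C" using R RF by (auto simp: C_def ring_closed_def)
  have CR: "r \<in> C \<Longrightarrow> r \<in> ?R" for r by (simp add: C_def)
  have constC: "fps_const c \<in> C" if "c \<in> L" for c
    using that unfolding C_def by (intro IntI term_ring_param fps_const_over field_closed_ring L) simp_all
  have zC: "z i \<in> C" if "i \<le> k" for i using that z by (simp add: C_def term_ring_var)
  define e where "e p = poly (map_poly (\<lambda>r. fps_const (of_rat r)) p) (z 0)" for p
  have eC: "e p \<in> C" for p
    unfolding e_def using Rats_least[OF L]
    by (intro coeffs_in_poly[OF C] zC) (auto simp: coeffs_in_def coeff_map_poly intro!: constC)
  have Se: "S (e p) = ev p (S (z 0))" for p
  proof -
    have "S (e p) = poly (map_poly S (map_poly (\<lambda>r. fps_const (of_rat r)) p)) (S (z 0))" unfolding e_def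
      by (rule poly_map_hom[OF R S(1), symmetric]) (auto simp: coeffs_in_def coeff_map_poly intro: term_ring_param term_ring_var)
    also have "map_poly S (map_poly (\<lambda>r. fps_const (of_rat r)) p) = map_poly of_rat p"
      using S(2) S(2)[of 0] by (intro poly_eqI) (simp add: coeff_map_poly star_of_simps(1) star_of_rat)
    finally show ?thesis by (simp add: ev_def)
  qed
  \<comment> \<open>The fractions \<open>S r / S d\<close> with \<open>d\<close> and
    \<open>r\<close> in \<open>C\<close>, written without division.\<close>
  define B where "B = {u. \<exists>d\<in>C. \<exists>r\<in>C. S d \<noteq> 0 \<and> S d * u = S r}"
  have BI: "u \<in> B" if "d \<in> C" "S d \<noteq> 0" "r \<in> C" "S d * u = S r" for u d r
    using that by (auto simp: B_def)
  note S_simps = hom_on_diff[OF R S(1)] hom_on_mult[OF R S(1)] ring_closed_mult[OF R] CR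
  have CB: "r \<in> C \<Longrightarrow> S r \<in> B" for r
    using BI[of 1 r] hom_on_1[OF R S(1)] by (simp add: ring_closed_1[OF C])
  have B: "ring_closed B"
    unfolding ring_closed_def
  proof (intro conjI ballI)
    show "1 \<in> B" using CB[of 1] hom_on_1[OF R S(1)] by (simp add: ring_closed_1[OF C])
    fix u v assume "u \<in> B" "v \<in> B"
    then obtain d r e s where *: "d \<in> C" "r \<in> C" "S d \<noteq> 0" "S d * u = S r" "e \<in> C" "s \<in> C" "S e \<noteq> 0" "S e * v = S s"
      by (auto simp: B_def)
    have "S (d * e) * (u - v) = S e * (S d * u) - S d * (S e * v)"
      using *(1,5) by (simp add: S_simps algebra_simps)
    then have "S (d * e) * (u - v) = S (e * r - d * s)"
      using *(1,2,5,6) unfolding *(4,8) by (simp add: S_simps)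
    then show "u - v \<in> B"
      by (intro BI[of "d * e" "e * r - d * s"]) (use * in \<open>auto simp: S_simps intro!: ring_closed_diff[OF C] ring_closed_mult[OF C]\<close>)
    have "S (d * e) * (u * v) = S (r * s)"
      using * by (simp add: S_simps flip: *(4,8))
    then show "u * v \<in> B"
      by (intro BI[of "d * e" "r * s"]) (use * in \<open>auto simp: S_simps intro!: ring_closed_mult[OF C]\<close>)
  qed
  have "rat_functions (S (z 0)) \<subseteq> B"
    unfolding rat_functions_ev
  proof safe
    fix p q assume "ev q (S (z 0)) \<noteq> 0"
    then show "ev p (S (z 0)) / ev q (S (z 0)) \<in> B" by (intro BI[OF eC[of q] _ eC[of p]]) (simp_all add: Se)
  qed
  moreover have "U \<subseteq> B"
    unfolding U(1)
  proof (intro Un_least subsetI)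
    fix u assume "u \<in> star_of ` D"
    then obtain a where "a \<in> D" "u = star_of a" by blast
    then show "u \<in> B" using CB[OF constC, of a] U(2) S(2)[of a] by auto
  qed (use CB zC in auto)
  ultimately have "star_of b \<in> B" using adjoin_least[OF B] w[OF B] b by blast
  then obtain d r where dr: "d \<in> C" "r \<in> C" "S d \<noteq> 0" "S d * star_of b = S r" by (auto simp: B_def)
  \<comment> \<open>Nothing is known yet about \<open>b\<close> and \<open>L\<close>; the term ring
    contains this constant because it admits all of them, so injectivity of \<open>S\<close> can be
    applied.\<close>
  have cb: "fps_const b \<in> ?R" by (rule term_ring_param) simp
  have "S (d * fps_const b - r) = 0"
    using dr cb by (simp add: S_simps S(2))
  then have eq: "d * fps_const b = r"
    using S(3)[of "d * fps_const b - r"] dr cb by (simp add: CR ring_closed_diff[OF R] ring_closed_mult[OF R])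
  have "d \<noteq> 0" using dr(3) hom_on_0[OF R S(1)] by metis
  \<comment> \<open>At an index where \<open>d\<close> has a nonzero coefficient, comparison with
    \<open>r\<close> writes \<open>b\<close> as a quotient of elements of \<open>L\<close>.\<close>
  then obtain i where i: "fps_nth d i \<noteq> 0" using fps_nonzero_nth by blast
  have "fps_nth d i * b = fps_nth r i" by (simp flip: eq)
  then have "b = fps_nth r i / fps_nth d i" using i by (simp add: field_simps)
  then show ?thesis
    using dr(1,2) field_closed_divide[OF L] by (auto simp: fps_over_def C_def)
qed

text \<open>The candidates are the fields \<open>F n\<close>, generated by the entries of a
  primitive element \<open>w\<close> for the coordinates and \<open>L \<inter> D\<close> over
  \<rat>(x). Almost all of them contain what they should. If each of these also met
  \<open>D - L\<close>, finiteness of \<open>D\<close> would single out one \<open>b\<close> that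
  lies in almost all \<open>F n\<close>, and this \<open>b\<close> is shown to lie in
  \<open>L\<close>.\<close>

lemma rational_specialisation:
  fixes L :: "'a::{alg_closed_field,field_char_0} set" and z :: "nat \<Rightarrow> 'a fps"
  assumes alg: "\<And>c::'a. algebraic c"
    and L: "field_closed L"
    and z: "z 0 = fps_const c + fps_X" "\<And>i. i \<le> k \<Longrightarrow> z i \<in> fps_over L" "alg_tower z k"
    and \<phi>: "set_qf_formula \<phi> \<subseteq> L" "qf_vars \<phi> \<subseteq> {..k}" "\<not> qval fps_const z \<phi>"
    and D: "finite D"
    and x: "\<And>n. x n \<in> \<rat>" "\<not> alg_over (range star_of) (star_n x)"
    and reg: "\<And>w. w \<in> star_set \<rat> \<Longrightarrow> alg_over (rat_functions (star_n x)) w \<Longrightarrow> w \<in> rat_functions (star_n x)"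
  shows "\<exists>n F e. field_closed F \<and> F \<inter> D = L \<inter> D \<and> (\<forall>i\<le>k. e i \<in> F) \<and> e 0 = x n \<and> \<not> qf_sat e \<phi>"
proof -
  let ?R = "term_ring UNIV fps_const z k" and ?k = "rat_functions (star_n x)"
  note R = ring_closed_term_ring[of UNIV fps_const z k]
  note K = field_closed_rat_functions[of "star_n x"]
  note Q = field_closed_Rats[where ?'b = 'a]
  have kQ: "?k \<subseteq> star_set \<rat>" by (rule rat_functions_subset[OF x(1)])
  obtain S where S: "ring_hom_on ?R S" "\<And>c. S (fps_const c) = star_of c" "S (z 0) = star_n x"
    "\<And>f. f \<in> ?R \<Longrightarrow> S f = 0 \<Longrightarrow> f = 0" "\<And>i. i \<le> k \<Longrightarrow> S (z i) \<in> alg_elements ?k"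
    using tower_embedding[OF alg z(1) x(2) z(3)] by blast
  have "\<forall>i. \<exists>Y. S (z i) = star_n Y" by (metis star_n_cases)
  then obtain Y where Y: "\<And>i. S (z i) = star_n (Y i)" by metis
  \<comment> \<open>The entry 0 is \<open>x n\<close> at every index; the chosen representative
    \<open>Y 0\<close> agrees with it only almost everywhere.\<close>
  define e where "e n i = (if i = 0 then x n else Y i n)" for n i
  have eS: "S (z i) = star_n (\<lambda>n. e n i)" for i
    using S(3) Y[of i] by (cases "i = 0") (simp_all add: e_def)
  have "S (tval fps_const z t) = tval star_of (\<lambda>i. star_n (\<lambda>n. e n i)) t" if "rterm_vars t \<subseteq> {..k}" for t
    using tval_hom[OF R S(1), of t fps_const z] that
    by (simp add: S(2) eS term_ring_param subset_iff term_ring_var)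
  moreover have "S f = 0 \<longleftrightarrow> f = 0" if "f \<in> ?R" for f using S(4)[OF that] hom_on_0[OF R S(1)] by blast
  ultimately have "tval fps_const z t = 0 \<longleftrightarrow> tval star_of (\<lambda>i. star_n (\<lambda>n. e n i)) t = 0" if "rterm_vars t \<subseteq> {..k}" for t
    using term_ringI[of t UNIV k fps_const z] that by (metis subset_UNIV)
  then have "qval fps_const z \<phi> = qval star_of (\<lambda>i. star_n (\<lambda>n. e n i)) \<phi>"
    using qf_atoms_vars[of _ \<phi>] \<phi>(2) by (intro qval_atoms_cong) blast
  then have ev1: "eventually (\<lambda>n. \<not> qf_sat (e n) \<phi>) ultra"
    using \<phi>(3) by (simp add: qval_star ultra_not)
  define U where "U = star_of ` (L \<inter> D) \<union> S ` z ` {..k}"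
  have "finite U" using D by (simp add: U_def)
  moreover have "alg_over ?k u" if "u \<in> U" for u
    using that S(5) star_of_algebraic[OF alg, of _ "star_n x"] by (auto simp: U_def alg_elements_def)
  ultimately obtain w where w: "alg_over ?k w" "U \<subseteq> adjoin ?k w" "\<And>T. ring_closed T \<Longrightarrow> U \<subseteq> T \<Longrightarrow> w \<in> T"
    using primitive_element[OF K] by metis
  obtain W where W: "w = star_n W" using star_n_cases by blast
  define F where "F n = adjoin \<rat> (W n)" for n
  have F: "field_closed (F n)" for n
    unfolding F_def by (rule field_closed_adjoin[OF Q alg_over_Rats[OF alg]])
  have UF: "eventually (\<lambda>n. Z n \<in> F n) ultra" if "star_n Z \<in> U" for Z
  proof -
    obtain p where p: "coeffs_in ?k p" "star_n Z = poly p w" using w(2) \<open>star_n Z \<in> U\<close> by (auto simp: adjoin_def)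
    obtain P where P: "\<And>n. coeffs_in \<rat> (P n)" "\<And>Z. poly p (star_n Z) = star_n (\<lambda>n. poly (P n) (Z n))"
      "\<And>i. coeff p i = star_n (\<lambda>n. coeff (P n) i)" "\<And>n. degree (P n) \<le> degree p"
      using star_set_poly[OF coeffs_in_mono[OF p(1) kQ] Rats_0] that by metis
    then have "eventually (\<lambda>n. Z n = poly (P n) (W n)) ultra"
      using p(2) by (simp add: W star_n_eq_iff)
    then show ?thesis by (rule eventually_mono) (simp add: F_def P(1) adjoinI)
  qed
  have ev2: "eventually (\<lambda>n. \<forall>a\<in>L \<inter> D. a \<in> F n) ultra"
    using D UF[of "\<lambda>_. _"] by (intro eventually_ball_finite) (auto simp: U_def star_of_def)
  have ev3: "eventually (\<lambda>n. \<forall>i\<in>{..k}. e n i \<in> F n) ultra"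
    by (intro eventually_ball_finite ballI UF) (auto simp: U_def eS[symmetric])
  show ?thesis
  proof (rule ccontr)
    assume no: "\<not> ?thesis"
    have ex: "\<exists>b\<in>D - L. b \<in> F n"
      if n: "\<not> qf_sat (e n) \<phi>" "\<forall>a\<in>L \<inter> D. a \<in> F n" "\<forall>i\<in>{..k}. e n i \<in> F n" for n
    proof (rule ccontr)
      assume "\<not> (\<exists>b\<in>D - L. b \<in> F n)"
      then have "F n \<inter> D = L \<inter> D" using n(2) by blast
      then have "field_closed (F n) \<and> F n \<inter> D = L \<inter> D \<and> (\<forall>i\<le>k. e n i \<in> F n) \<and> e n 0 = x n \<and> \<not> qf_sat (e n) \<phi>"
        using F n by (simp add: e_def)
      then show False using no by blast
    qed
    have "eventually (\<lambda>n. \<exists>b\<in>D - L. b \<in> F n) ultra"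
      using ev1 ev2 ev3 by eventually_elim (rule ex)
    then obtain b where b: "b \<in> D - L" "eventually (\<lambda>n. b \<in> F n) ultra"
      using ultra_finite_Bex[of "D - L" "\<lambda>b n. b \<in> F n"] D by blast
    obtain g where g: "coeffs_in ?k g" "g \<noteq> 0" "poly g w = 0" using w(1) by (auto simp: alg_over_def annihilates_def)
    obtain G where G: "\<And>n. coeffs_in \<rat> (G n)" "\<And>Z. poly g (star_n Z) = star_n (\<lambda>n. poly (G n) (Z n))"
      "\<And>i. coeff g i = star_n (\<lambda>n. coeff (G n) i)" "\<And>n. degree (G n) \<le> degree g"
      using star_set_poly[OF coeffs_in_mono[OF g(1) kQ] Rats_0] that by metis
    have ev4: "eventually (\<lambda>n. poly (G n) (W n) = 0) ultra"
      using g(3) by (simp add: W G(2) star_n_simps(1) star_n_eq_iff)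
    have "eventually (\<lambda>n. coeff (G n) (degree g) \<noteq> 0) ultra"
      using g(2) G(3)[of "degree g"] by (simp add: star_n_simps(1) star_n_eq_iff ultra_not flip: leading_coeff_0_iff)
    then have ev5: "eventually (\<lambda>n. G n \<noteq> 0) ultra" by (rule eventually_mono) auto
    \<comment> \<open>The polynomials that express \<open>b\<close> through \<open>W n\<close> must
      share a degree bound, here the degree of \<open>g\<close>. At exceptional indices the zero
      polynomial will do.\<close>
    have "\<exists>p. coeffs_in \<rat> p \<and> degree p \<le> degree g \<and> (b \<in> F n \<longrightarrow> poly (G n) (W n) = 0 \<longrightarrow> G n \<noteq> 0 \<longrightarrow> poly p (W n) = b)" for n
    proof (cases "b \<in> F n \<and> poly (G n) (W n) = 0 \<and> G n \<noteq> 0")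
      case True
      then obtain p where "coeffs_in \<rat> p" "degree p \<le> degree (G n)" "poly p (W n) = b"
        using adjoin_bounded_degree[OF Q G(1)[of n], of "W n" b] by (auto simp: F_def)
      then show ?thesis using G(4)[of n] by (intro exI[of _ p]) auto
    next
      case False
      then show ?thesis by (intro exI[of _ 0]) (auto simp: coeffs_in_0 field_closed_ring Q)
    qed
    then obtain P where P: "\<And>n. coeffs_in \<rat> (P n)" "\<And>n. degree (P n) \<le> degree g"
      "\<And>n. b \<in> F n \<Longrightarrow> poly (G n) (W n) = 0 \<Longrightarrow> G n \<noteq> 0 \<Longrightarrow> poly (P n) (W n) = b" by metis
    obtain p where p: "coeffs_in (star_set \<rat>) p" "\<And>Z. poly p (star_n Z) = star_n (\<lambda>n. poly (P n) (Z n))"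
      using star_set_poly_lift[of \<rat> P, OF P(1,2)] that by metis
    have "eventually (\<lambda>n. poly (P n) (W n) = b) ultra"
      using b(2) ev4 ev5 by eventually_elim (rule P(3))
    then have "poly p w = star_of b" by (simp add: W p(2) star_of_def star_n_eq_iff)
    then have "star_of b \<in> adjoin (star_set \<rat>) w" using adjoinI[OF p(1), of w] by simp
    moreover have "alg_over ?k (star_of b)" using star_of_algebraic[OF alg] by (simp add: alg_elements_def)
    \<comment> \<open>Since \<rat>(x) is relatively algebraically closed in the ultrapower of
      \<rat>, the coefficients of this expression for \<open>b\<close> can be taken from
      \<rat>(x).\<close>
    ultimately have "star_of b \<in> adjoin ?k w"
      using regular_descent[OF K field_closed_star_set[OF Q] kQ reg w(1)] by blast
    then have "b \<in> L"
      using constant_in_fps_over[OF L S(1,2,4) z(2) U_def _ w(3), of b] S(3) by auto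
    then show False using b(1) by blast
  qed
qed

section \<open>Local rings of an affine model\<close>

context
  fixes F :: "('f, 'm) ring_scheme" (structure) and R
  assumes F: "field F" and R: "subring R F"
begin

interpretation F: field F by (rule F)

lemma prime_in_subring:
  assumes p: "primeideal p (F\<lparr>carrier := R\<rparr>)"
  shows "p \<subseteq> R" "\<one> \<notin> p"
    "\<And>a b. a \<in> p \<Longrightarrow> b \<in> R \<Longrightarrow> a \<otimes> b \<in> p"
    "\<And>a b. a \<in> R \<Longrightarrow> b \<in> R \<Longrightarrow> a \<otimes> b \<in> p \<Longrightarrow> a \<in> p \<or> b \<in> p"
proof -
  interpret p: primeideal p "F\<lparr>carrier := R\<rparr>" by (rule p)
  show "p \<subseteq> R" using p.a_subset by simp
  show "\<And>a b. a \<in> p \<Longrightarrow> b \<in> R \<Longrightarrow> a \<otimes> b \<in> p" using p.I_r_closed by simp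
  show "\<And>a b. a \<in> R \<Longrightarrow> b \<in> R \<Longrightarrow> a \<otimes> b \<in> p \<Longrightarrow> a \<in> p \<or> b \<in> p" using p.I_prime by simp
  show "\<one> \<notin> p" using p.one_imp_carrier p.I_notcarr by auto
qed

lemma local_ring_superset:
  assumes p: "primeideal p (F\<lparr>carrier := R\<rparr>)"
  shows "R \<subseteq> local_ring_at F R p"
proof
  fix a assume a: "a \<in> R"
  then have "a \<in> carrier F" using subringE(1)[OF R] by blast
  then show "a \<in> local_ring_at F R p"
    unfolding local_ring_at_def using a prime_in_subring(2)[OF p] subringE(3)[OF R]
    by (intro CollectI conjI bexI[of _ a] bexI[of _ \<one>]) auto
qed

text \<open>For the fraction \<open>x = a / s\<close>: if \<open>a\<close> is outside
  \<open>p\<close>, then \<open>s / a\<close> is an inverse. If \<open>a\<close> is in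
  \<open>p\<close>, an inverse \<open>b / t\<close> would give \<open>a b = s t\<close>, a product
  of two elements outside the prime.\<close>

lemma local_ring_nonunit:
  assumes p: "primeideal p (F\<lparr>carrier := R\<rparr>)" and x: "x \<in> carrier F" "s \<in> R" "s \<notin> p" "a \<in> R" "x \<otimes> s = a"
  shows "x \<in> max_ideal_of F (local_ring_at F R p) \<longleftrightarrow> a \<in> p"
proof -
  note pr = prime_in_subring[OF p]
  note RF = subringE(1)[OF R]
  have sF: "s \<in> carrier F" and aF: "a \<in> carrier F" using x RF by auto
  have xO: "x \<in> local_ring_at F R p" using x by (auto simp: local_ring_at_def)
  show ?thesis
  proof
    assume "x \<in> max_ideal_of F (local_ring_at F R p)"
    then have nu: "x \<notin> Units (F\<lparr>carrier := local_ring_at F R p\<rparr>)" by (simp add: max_ideal_of_def)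
    show "a \<in> p"
    proof (rule ccontr)
      assume a: "a \<notin> p"
      have "\<zero> \<in> p" using additive_subgroup.zero_closed[OF ideal.axioms(1)[OF primeideal.axioms(1)[OF p]]] by simp
      then have "a \<noteq> \<zero>" using a by auto
      then have x0: "x \<noteq> \<zero>" using x(5) sF by auto
      then have u: "x \<in> Units F" using x(1) by (simp add: F.field_Units)
      have "inv x \<otimes> a = s"
        using u x(5) sF by (simp add: F.m_assoc[symmetric] F.Units_l_inv F.Units_inv_closed x(1) flip: x(5))
      then have "inv x \<in> local_ring_at F R p"
        unfolding local_ring_at_def using u a x(2,4) F.Units_inv_closed[OF u] by auto
      then have "x \<in> Units (F\<lparr>carrier := local_ring_at F R p\<rparr>)"
        using xO u by (auto simp: Units_def[of "F\<lparr>carrier := local_ring_at F R p\<rparr>"] intro!: bexI[of _ "inv x"])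
      then show False using nu by simp
    qed
  next
    assume a: "a \<in> p"
    have "x \<notin> Units (F\<lparr>carrier := local_ring_at F R p\<rparr>)"
    proof
      assume "x \<in> Units (F\<lparr>carrier := local_ring_at F R p\<rparr>)"
      then obtain y where y: "y \<in> local_ring_at F R p" "x \<otimes> y = \<one>" by (auto simp: Units_def)
      then obtain b t where bt: "y \<in> carrier F" "b \<in> R" "t \<in> R" "t \<notin> p" "y \<otimes> t = b" by (auto simp: local_ring_at_def)
      have tF: "t \<in> carrier F" using bt RF by auto
      have "a \<otimes> b = (x \<otimes> y) \<otimes> (s \<otimes> t)"
        using x(1) bt(1) sF tF by (simp add: F.m_ac flip: x(5) bt(5))
      then have "a \<otimes> b = s \<otimes> t" using y sF tF by simp
      then have "s \<otimes> t \<in> p" using pr(3)[OF a bt(2)] by simp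
      then show False using pr(4) x bt by blast
    qed
    then show "x \<in> max_ideal_of F (local_ring_at F R p)" using xO by (simp add: max_ideal_of_def)
  qed
qed

lemma max_ideal_of_local_ring_iff:
  assumes p: "primeideal p (F\<lparr>carrier := R\<rparr>)" and a: "a \<in> R"
  shows "a \<in> max_ideal_of F (local_ring_at F R p) \<longleftrightarrow> a \<in> p"
proof (rule local_ring_nonunit[OF p])
  show "a \<in> carrier F" using a subringE(1)[OF R] by blast
  then show "a \<otimes> \<one> = a" by simp
qed (use a prime_in_subring(2)[OF p] subringE(3)[OF R] in auto)

lemma Units_mono_carrier:
  "A \<subseteq> B \<Longrightarrow> Units (F\<lparr>carrier := A\<rparr>) \<subseteq> Units (F\<lparr>carrier := B\<rparr>)"
  by (auto simp: Units_def)

text \<open>Both primes consist of the elements of \<open>R\<close> that are not units of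
  \<open>V\<close>: domination keeps nonunits nonunits, and a unit of the smaller ring stays a unit
  in \<open>V\<close>.\<close>

lemma affine_model_separated:
  assumes "O1 \<in> affine_model F R" "O2 \<in> affine_model F R" "dominates F V O1" "dominates F V O2"
  shows "O1 = O2"
proof -
  have sub: "p \<subseteq> q"
    if p: "primeideal p (F\<lparr>carrier := R\<rparr>)" and q: "primeideal q (F\<lparr>carrier := R\<rparr>)"
      and dp: "dominates F V (local_ring_at F R p)" and dq: "dominates F V (local_ring_at F R q)" for p q
  proof
    fix a assume a: "a \<in> p"
    then have aR: "a \<in> R" using prime_in_subring(1)[OF p] by blast
    have "a \<in> max_ideal_of F V"
      using dp max_ideal_of_local_ring_iff[OF p aR] a by (auto simp: dominates_def)
    then have "a \<notin> Units (F\<lparr>carrier := V\<rparr>)" by (simp add: max_ideal_of_def)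
    then have "a \<notin> Units (F\<lparr>carrier := local_ring_at F R q\<rparr>)"
      using Units_mono_carrier dq by (auto simp: dominates_def)
    then show "a \<in> q"
      using max_ideal_of_local_ring_iff[OF q aR] local_ring_superset[OF q] aR by (auto simp: max_ideal_of_def)
  qed
  obtain p q where pq: "primeideal p (F\<lparr>carrier := R\<rparr>)" "O1 = local_ring_at F R p"
    "primeideal q (F\<lparr>carrier := R\<rparr>)" "O2 = local_ring_at F R q"
    using assms by (auto simp: affine_model_def)
  then have "p = q" using sub assms by blast
  then show ?thesis using pq by simp
qed

end

section \<open>Function fields\<close>

lemma rational_field_sel [simp]:
  "carrier (rational_field :: 'a::field_char_0 ring) = \<rat>"
  "x \<otimes>\<^bsub>(rational_field :: 'a::field_char_0 ring)\<^esub> y = x * y"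
  "x \<oplus>\<^bsub>(rational_field :: 'a::field_char_0 ring)\<^esub> y = x + y"
  "\<one>\<^bsub>(rational_field :: 'a::field_char_0 ring)\<^esub> = 1"
  "\<zero>\<^bsub>(rational_field :: 'a::field_char_0 ring)\<^esub> = 0"
  by (simp_all add: rational_field_def ring_of_type_algebra_def)

lemma field_rational_field: "field (rational_field :: 'a::field_char_0 ring)"
proof -
  interpret TR: field "type_ring :: 'a ring" by (rule field_from_type_algebra)
  have "subfield (\<rat> :: 'a set) type_ring" by (simp add: subfield_type_ring_iff field_closed_Rats)
  then show ?thesis using TR.subfield_iff(2) by (simp add: rational_field_def)
qed

lemma polys_1:
  assumes "p \<in> polys (rational_field :: 'a::field_char_0 ring) 1"
  shows "finite {m. p m \<noteq> 0}" "\<And>m. p m \<in> \<rat>" "\<And>m. p m \<noteq> 0 \<Longrightarrow> set_mset m \<subseteq> {0}"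
proof -
  interpret K: field "rational_field :: 'a ring" by (rule field_rational_field)
  have "finite {m. p m \<noteq> 0} \<and> (\<forall>m. p m \<in> \<rat>) \<and> (\<forall>m. p m \<noteq> 0 \<longrightarrow> set_mset m \<subseteq> {0})"
    using assms unfolding polys_def
  proof (induction rule: K.indexed_pset.induct)
    case (indexed_const k)
    have "finite {m. K.indexed_const k m \<noteq> 0}"
      by (rule finite_subset[of _ "{{#}}"]) (auto simp: K.indexed_const_def split: if_splits)
    then show ?case using indexed_const by (auto simp: K.indexed_const_def)
  next
    case (indexed_padd P Q)
    have "finite {m. K.indexed_padd P Q m \<noteq> 0}"
      using indexed_padd by (auto simp: K.indexed_padd_def intro: rev_finite_subset[of "{m. P m \<noteq> 0} \<union> {m. Q m \<noteq> 0}"])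
    moreover have "set_mset m \<subseteq> {0}" if "K.indexed_padd P Q m \<noteq> 0" for m
      using that indexed_padd by (cases "P m = 0") (auto simp: K.indexed_padd_def)
    ultimately show ?case using indexed_padd by (auto simp: K.indexed_padd_def)
  next
    case (indexed_pmult P i)
    have "{m. K.indexed_pmult P i m \<noteq> 0} \<subseteq> add_mset i ` {m. P m \<noteq> 0}"
    proof
      fix m assume "m \<in> {m. K.indexed_pmult P i m \<noteq> 0}"
      then have "i \<in># m" "P (m - {#i#}) \<noteq> 0" by (auto simp: K.indexed_pmult_def split: if_splits)
      then show "m \<in> add_mset i ` {m. P m \<noteq> 0}" by (intro image_eqI[of _ _ "m - {#i#}"]) auto
    qed
    then have fin: "finite {m. K.indexed_pmult P i m \<noteq> 0}" using indexed_pmult finite_subset by blast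
    have sub: "set_mset m \<subseteq> {0}" if m: "K.indexed_pmult P i m \<noteq> 0" for m
    proof -
      have "i \<in># m" "P (m - {#i#}) \<noteq> 0" using m by (auto simp: K.indexed_pmult_def split: if_splits)
      then have "set_mset (m - {#i#}) \<subseteq> {0}" "m = add_mset i (m - {#i#})" using indexed_pmult by auto
      then show ?thesis using indexed_pmult(2) by (metis insert_subset lessThan_iff less_one set_mset_add_mset_insert singletonI)
    qed
    have "K.indexed_pmult P i m \<in> \<rat>" for m using indexed_pmult by (simp add: K.indexed_pmult_def)
    then show ?case using fin sub by blast
  qed
  then show "finite {m. p m \<noteq> 0}" "\<And>m. p m \<in> \<rat>" "\<And>m. p m \<noteq> 0 \<Longrightarrow> set_mset m \<subseteq> {0}" by auto
qed

text \<open>Identifies the prime fields of two fields of characteristic 0; its values are meaningful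
  on \<rat> only.\<close>

definition rat_embed :: "'a::field_char_0 \<Rightarrow> 'e::field_char_0" where
  "rat_embed c = of_rat (inv_into UNIV of_rat c)"

lemma rat_embed_of_rat [simp]: "rat_embed (of_rat r) = of_rat r"
  unfolding rat_embed_def by (subst inv_into_f_f) (auto simp: inj_def)

text \<open>Varieties require a record as function field, while the field at hand is a subfield
  \<open>F0\<close> of a type class field. Computations take place in \<open>F0\<close> and are
  carried to \<open>F\<close> along \<open>j\<close>.\<close>

locale embedded_field =
  fixes F :: "'f ring" and F0 :: "'e::field_char_0 set" and j :: "'e \<Rightarrow> 'f"
  assumes field_F: "field F" and F0: "field_closed F0" and iso: "j \<in> ring_iso (type_ring\<lparr>carrier := F0\<rparr>) F"
begin

sublocale F: field F by (rule field_F)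

lemma carrier_F: "carrier F = j ` F0"
  and inj_j: "inj_on j F0"
  and j_mult: "a \<in> F0 \<Longrightarrow> b \<in> F0 \<Longrightarrow> j a \<otimes>\<^bsub>F\<^esub> j b = j (a * b)"
  and j_add: "a \<in> F0 \<Longrightarrow> b \<in> F0 \<Longrightarrow> j a \<oplus>\<^bsub>F\<^esub> j b = j (a + b)"
  and j_one: "\<one>\<^bsub>F\<^esub> = j 1"
  using iso by (auto simp: ring_iso_def bij_betw_def ring_hom_def)

lemmas F0_ring = field_closed_ring[OF F0]

lemma j_in: "a \<in> F0 \<Longrightarrow> j a \<in> carrier F"
  by (simp add: carrier_F)

lemma j_eq_iff: "a \<in> F0 \<Longrightarrow> b \<in> F0 \<Longrightarrow> j a = j b \<longleftrightarrow> a = b"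
  using inj_j by (auto simp: inj_on_def)

lemma j_zero: "\<zero>\<^bsub>F\<^esub> = j 0"
  using j_add[of 0 0] F.add.r_cancel_one[of "j 0" "j 0"] by (simp add: ring_closed_0[OF F0_ring] j_in)

lemma j_uminus: "a \<in> F0 \<Longrightarrow> \<ominus>\<^bsub>F\<^esub> j a = j (- a)"
  by (rule F.minus_equality) (simp_all add: j_add ring_closed_uminus[OF F0_ring] j_zero j_in)

lemma j_diff: "a \<in> F0 \<Longrightarrow> b \<in> F0 \<Longrightarrow> j a \<ominus>\<^bsub>F\<^esub> j b = j (a - b)"
  by (simp add: a_minus_def j_uminus j_add ring_closed_uminus[OF F0_ring])

lemma j_inverse: "a \<in> F0 \<Longrightarrow> a \<noteq> 0 \<Longrightarrow> inv\<^bsub>F\<^esub> (j a) = j (inverse a)"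
  by (rule F.inv_char) (simp_all add: j_mult field_closed_inverse[OF F0] j_one j_in)

lemma j_power: "a \<in> F0 \<Longrightarrow> j a [^]\<^bsub>F\<^esub> (n::nat) = j (a ^ n)"
  by (induction n) (simp_all add: j_one j_mult ring_closed_power[OF F0_ring] mult.commute)

lemma j_sum: "(\<And>i. i \<in> I \<Longrightarrow> g i \<in> F0) \<Longrightarrow> finite I \<Longrightarrow> finsum F (\<lambda>i. j (g i)) I = j (sum g I)"
  by (induction I rule: infinite_finite_induct)
    (auto simp: j_zero j_add j_in ring_closed_sum[OF F0_ring] Pi_def)

lemma subring_j: "ring_closed A \<Longrightarrow> A \<subseteq> F0 \<Longrightarrow> subring (j ` A) F"
  by (rule F.subringI)
    (auto simp: carrier_F j_one ring_closed_1 j_uminus j_mult j_add subset_iff ring_closed_uminus ring_closed_mult ring_closed_add)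

lemma subfield_j:
  assumes A: "field_closed A" "A \<subseteq> F0"
  shows "subfield (j ` A) F"
proof (rule F.subfieldI')
  show "subring (j ` A) F" using A by (intro subring_j field_closed_ring)
  fix y assume "y \<in> j ` A - {\<zero>\<^bsub>F\<^esub>}"
  then obtain a where a: "a \<in> A" "y = j a" "a \<noteq> 0" by (auto simp: j_zero)
  then show "inv\<^bsub>F\<^esub> y \<in> j ` A" using A by (auto simp: j_inverse field_closed_inverse)
qed

lemma ring_closed_vimage:
  assumes "subring B F"
  shows "ring_closed {a \<in> F0. j a \<in> B}"
  unfolding ring_closed_def
  using subringE(3,6)[OF assms] subringE(5,7)[OF assms] F0_ring
  by (auto simp: j_one[symmetric] ring_closed_1 ring_closed_diff ring_closed_mult j_mult[symmetric] j_diff[symmetric] a_minus_def)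

lemma field_closed_vimage:
  assumes "subfield B F"
  shows "field_closed {a \<in> F0. j a \<in> B}"
proof -
  have "j (inverse a) \<in> B" if "a \<in> F0" "j a \<in> B" for a
    using that F.subfield_m_inv(1)[OF assms, of "j a"]
    by (cases "a = 0") (auto simp: j_inverse j_zero j_eq_iff ring_closed_0[OF F0_ring])
  then show ?thesis
    using ring_closed_vimage[OF subfieldE(1)[OF assms]] by (auto simp: field_closed_def field_closed_inverse[OF F0])
qed

lemma generate_ring_j:
  assumes "ring_closed A" "A \<subseteq> F0" "G \<subseteq> A" and least: "\<And>B. ring_closed B \<Longrightarrow> G \<subseteq> B \<Longrightarrow> A \<subseteq> B"
  shows "generate_ring F (j ` G) = j ` A"
proof (rule F.generate_ringI[symmetric])
  show "j ` G \<subseteq> carrier F" using assms by (auto simp: carrier_F)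
  show "subring (j ` A) F" by (rule subring_j) fact+
  show "j ` G \<subseteq> j ` A" using assms by auto
  fix B assume "subring B F" "j ` G \<subseteq> B"
  then have "A \<subseteq> {a \<in> F0. j a \<in> B}" using assms by (intro least ring_closed_vimage) auto
  then show "j ` A \<subseteq> B" by auto
qed

lemma generate_field_j:
  assumes "field_closed A" "A \<subseteq> F0" "G \<subseteq> A" and least: "\<And>B. field_closed B \<Longrightarrow> G \<subseteq> B \<Longrightarrow> A \<subseteq> B"
  shows "generate_field F (j ` G) = j ` A"
proof (rule F.generate_fieldI[symmetric])
  show "j ` G \<subseteq> carrier F" using assms by (auto simp: carrier_F)
  show "subfield (j ` A) F" by (rule subfield_j) fact+
  show "j ` G \<subseteq> j ` A" using assms by auto
  fix B assume "subfield B F" "j ` G \<subseteq> B"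
  then have "A \<subseteq> {a \<in> F0. j a \<in> B}" using assms by (intro least field_closed_vimage) auto
  then show "j ` A \<subseteq> B" by auto
qed

lemma eval_j:
  assumes "set p \<subseteq> F0" "w \<in> F0"
  shows "F.eval (map j p) (j w) = j (poly (Poly (rev p)) w)"
  using assms(1)
proof (induction p)
  case (Cons a p)
  have "poly (Poly (rev p)) w \<in> F0"
    using Cons.prems assms(2) ring_closed_0[OF F0_ring]
    by (intro coeffs_in_poly F0_ring) (auto simp: coeffs_in_def nth_default_def rev_nth)
  then show ?case
    using Cons assms(2) unfolding Poly_rev_Cons
    by (simp add: j_power j_mult j_add ring_closed_power[OF F0_ring] ring_closed_mult[OF F0_ring] poly_monom add.commute)
qed (simp add: j_zero)

lemma algebraic_j:
  assumes k: "k \<subseteq> F0" "ring_closed k" and w: "w \<in> F0" "alg_over k w"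
  shows "(F.algebraic over (j ` k)) (j w)"
proof -
  obtain g where g: "coeffs_in k g" "g \<noteq> 0" "poly g w = 0" using w by (auto simp: alg_over_def annihilates_def)
  define p where "p = rev (coeffs g)"
  have pk: "set p \<subseteq> k" using g(1) set_coeffs_subset_coeff[of g] by (auto simp: p_def coeffs_in_def)
  have hd: "p \<noteq> []" "hd p \<noteq> 0" using g by (simp_all add: p_def hd_rev last_coeffs_eq_coeff_degree)
  then have "hd p \<in> F0" using pk k(1) by (meson hd_in_set subsetD)
  show ?thesis
  proof (rule F.algebraicI)
    show "map j p \<noteq> []" using hd by simp
    have "lead_coeff g \<in> F0" using g(1) k by (auto simp: coeffs_in_def)
    then have "hd (map j p) \<noteq> \<zero>\<^bsub>F\<^esub>"
      using hd \<open>hd p \<in> F0\<close> by (simp add: hd_map j_zero j_eq_iff ring_closed_0[OF F0_ring])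
    then show "map j p \<in> carrier (univ_poly F (j ` k))"
      using pk hd by (auto simp: univ_poly_def polynomial_def)
    have "set p \<subseteq> F0" using pk k by auto
    then show "F.eval (map j p) (j w) = \<zero>\<^bsub>F\<^esub>"
      using eval_j[OF _ w(1), of p] g by (simp add: p_def j_zero)
  qed
qed

lemma poly_value_1:
  assumes p: "p \<in> polys (rational_field :: 'a::field_char_0 ring) 1" and \<iota>: "\<And>r. \<iota> (of_rat r) = j (of_rat r)"
    and x: "x \<in> F0" and Q: "\<rat> \<subseteq> F0"
  shows "poly_value rational_field F \<iota> p [j x] = j (\<Sum>m | p m \<noteq> 0. rat_embed (p m) * x ^ count m 0)"
proof -
  note p' = polys_1[OF p]
  have \<iota>': "\<iota> (p m) = j (rat_embed (p m)) \<and> rat_embed (p m) \<in> F0" for m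
  proof -
    obtain r where "p m = of_rat r" using p'(2)[of m] by (auto elim: Rats_cases)
    then show ?thesis using \<iota> Q by auto
  qed
  have prod: "finprod F (\<lambda>i. [j x] ! i [^]\<^bsub>F\<^esub> count m i) (set_mset m) = j (x ^ count m 0)" if m: "p m \<noteq> 0" for m
  proof (cases "0 \<in># m")
    case True
    then have "set_mset m = insert 0 {}" using p'(3)[OF m] by auto
    then show ?thesis using x by (simp add: j_power j_in ring_closed_power[OF F0_ring])
  next
    case False
    then have "m = {#}" using p'(3)[OF m] by auto
    then show ?thesis by (simp add: j_one)
  qed
  have "poly_value rational_field F \<iota> p [j x] = finsum F (\<lambda>m. j (rat_embed (p m) * x ^ count m 0)) {m. p m \<noteq> 0}"
    unfolding poly_value_def
  proof (simp, intro F.finsum_cong' refl)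
    show "\<iota> (p m) \<otimes>\<^bsub>F\<^esub> finprod F (\<lambda>i. [j x] ! i [^]\<^bsub>F\<^esub> count m i) (set_mset m) = j (rat_embed (p m) * x ^ count m 0)"
      if "m \<in> {m. p m \<noteq> 0}" for m
      using \<iota>'[of m] prod[of m] that x by (simp add: j_mult ring_closed_power[OF F0_ring])
    show "(\<lambda>m. j (rat_embed (p m) * x ^ count m 0)) \<in> {m. p m \<noteq> 0} \<rightarrow> carrier F"
      using \<iota>' x by (auto intro!: j_in ring_closed_mult[OF F0_ring] ring_closed_power[OF F0_ring])
  qed
  also have "\<dots> = j (\<Sum>m | p m \<noteq> 0. rat_embed (p m) * x ^ count m 0)"
    using \<iota>' x p'(1) by (intro j_sum) (auto intro!: ring_closed_mult[OF F0_ring] ring_closed_power[OF F0_ring])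
  finally show ?thesis .
qed

text \<open>A monomial in one variable is determined by its exponent, so \<open>p\<close> becomes an
  ordinary polynomial \<open>c\<close> with the same coefficients, and \<open>x\<close> is a root of
  the zero polynomial only.\<close>

lemma alg_independent_1:
  assumes \<iota>: "\<And>r. \<iota> (of_rat r) = j (of_rat r)" and x: "x \<in> F0" and Q: "\<rat> \<subseteq> F0"
    and trans: "\<And>c. ev c x = 0 \<Longrightarrow> c = 0"
  shows "alg_independent (rational_field :: 'a::field_char_0 ring) F \<iota> [j x]"
  unfolding alg_independent_def
proof (intro conjI ballI impI)
  show "set [j x] \<subseteq> carrier F" using x by (simp add: carrier_F)
  fix p assume p0: "p \<in> polys (rational_field :: 'a ring) (length [j x])" "poly_value rational_field F \<iota> p [j x] = \<zero>\<^bsub>F\<^esub>"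
  then have p: "p \<in> polys (rational_field :: 'a ring) 1" by simp
  note p' = polys_1[OF p]
  have "\<forall>m. \<exists>r. p m = of_rat r" using p'(2) by (auto elim: Rats_cases)
  then obtain r where r: "\<And>m. p m = of_rat (r m)" by metis
  define c where "c = (\<Sum>m | p m \<noteq> 0. monom (r m) (count m 0))"
  have in0: "(\<Sum>m | p m \<noteq> 0. rat_embed (p m) * x ^ count m 0) \<in> F0"
    using x Q by (auto simp: r intro!: ring_closed_sum[OF F0_ring] ring_closed_mult[OF F0_ring] ring_closed_power[OF F0_ring])
  have "ev c x = (\<Sum>m | p m \<noteq> 0. rat_embed (p m) * x ^ count m 0)"
    unfolding c_def by (subst hom_on_sum[OF ring_closed_UNIV ring_hom_on_ev])
      (auto simp: ev_def map_poly_monom poly_monom r)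
  also have "\<dots> = 0"
    using p0(2) poly_value_1[OF p \<iota> x Q] in0 by (simp add: j_zero j_eq_iff ring_closed_0[OF F0_ring])
  finally have c: "c = 0" by (rule trans)
  have "r n = 0" if n: "p n \<noteq> 0" for n
  proof -
    have inj: "count m 0 = count n 0 \<longleftrightarrow> m = n" if m: "p m \<noteq> 0" for m
    proof
      assume eq: "count m 0 = count n 0"
      show "m = n"
      proof (rule multiset_eqI)
        fix i show "count m i = count n i"
          using p'(3)[OF m] p'(3)[OF n] eq by (metis count_eq_zero_iff singletonD subsetD)
      qed
    qed simp
    have "coeff c (count n 0) = (\<Sum>m | p m \<noteq> 0. if m = n then r m else 0)"
      unfolding c_def coeff_sum by (rule sum.cong) (auto simp: inj)
    also have "\<dots> = r n" using p'(1) n by (simp add: sum.delta)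
    finally show ?thesis using c by simp
  qed
  then have "p m = 0" for m using r[of m] by (cases "p m = 0") auto
  then show "p = (\<lambda>_. \<zero>\<^bsub>rational_field\<^esub>)" by auto
qed

end

section \<open>Plane curves\<close>

lemma (in embedded_field) simple_extension_full:
  assumes k: "field_closed k" "k \<subseteq> F0" and w: "w \<in> F0" "alg_over k w"
    and least: "\<And>B. field_closed B \<Longrightarrow> k \<subseteq> B \<Longrightarrow> w \<in> B \<Longrightarrow> F0 \<subseteq> B"
  shows "F.simple_extension (j ` k) (j w) = carrier F"
proof
  have kF: "subfield (j ` k) F" by (rule subfield_j[OF k])
  have wF: "j w \<in> carrier F" by (rule j_in[OF w(1)])
  have sub: "subfield (F.simple_extension (j ` k) (j w)) F"
    using F.simple_extension_is_subfield[OF kF wF] algebraic_j[OF k(2) field_closed_ring[OF k(1)] w] by simp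
  then show "F.simple_extension (j ` k) (j w) \<subseteq> carrier F" by (rule subfieldE(3))
  have "F0 \<subseteq> {a \<in> F0. j a \<in> F.simple_extension (j ` k) (j w)}"
  proof (rule least[OF field_closed_vimage[OF sub]])
    show "k \<subseteq> {a \<in> F0. j a \<in> F.simple_extension (j ` k) (j w)}"
      using k(2) F.simple_extension_incl[OF subfieldE(3)[OF kF] wF] by blast
    show "w \<in> {a \<in> F0. j a \<in> F.simple_extension (j ` k) (j w)}"
      using w(1) F.simple_extension_mem[OF subfieldE(1)[OF kF] wF] by simp
  qed
  then show "carrier F \<subseteq> F.simple_extension (j ` k) (j w)" by (auto simp: carrier_F)
qed

text \<open>The dimension is the degree of the irreducible polynomial of \<open>w\<close>, which is
  one less than the length of its coefficient list. Degree 0 would make \<open>F\<close> trivial,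
  and degree 1 would put \<open>w\<close> into \<open>k\<close>.\<close>

lemma (in embedded_field) dimension_ge_2:
  assumes k: "field_closed k" "k \<subseteq> F0" and w: "w \<in> F0" "alg_over k w" "w \<notin> k"
    and least: "\<And>B. field_closed B \<Longrightarrow> k \<subseteq> B \<Longrightarrow> w \<in> B \<Longrightarrow> F0 \<subseteq> B"
  obtains d where "F.dimension d (j ` k) (carrier F)" "d \<ge> 2"
proof -
  have kF: "subfield (j ` k) F" by (rule subfield_j[OF k])
  have wF: "j w \<in> carrier F" by (rule j_in[OF w(1)])
  have alg: "(F.algebraic over (j ` k)) (j w)" by (rule algebraic_j[OF k(2) field_closed_ring[OF k(1)] w(1,2)])
  define p where "p = F.Irr (j ` k) (j w)"
  have dim: "F.dimension (length p - 1) (j ` k) (carrier F)"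
    using F.dimension_simple_extension[OF kF wF alg] simple_extension_full[OF k w(1,2) least] by (simp add: p_def)
  note irr = F.IrrE[OF kF wF alg, folded p_def]
  have pk: "set p \<subseteq> j ` k" using irr(1) by (auto simp: univ_poly_def polynomial_def)
  have "length p - 1 \<noteq> 0"
  proof
    assume "length p - 1 = 0"
    then have "carrier F = {\<zero>\<^bsub>F\<^esub>}" using dim F.dimension_zero[OF kF] by simp
    then show False using F.one_closed F.one_not_zero by blast
  qed
  moreover have "length p - 1 \<noteq> 1"
  proof
    assume "length p - 1 = 1"
    then have "length p = Suc (Suc 0)" by simp
    then obtain a b where ab: "p = [a, b]" by (auto simp: length_Suc_conv)
    then obtain c where c: "c \<in> k" "b = j c" using pk by auto
    have cF: "c \<in> F0" using c k by auto
    have "a = \<one>\<^bsub>F\<^esub>" using irr(3) ab by simp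
    then have "j (w + c) = j 0"
      using irr(4) ab c wF cF w(1) by (simp add: j_in j_add flip: j_zero)
    then have "w + c = 0" using cF w(1) by (simp add: j_eq_iff ring_closed_0[OF F0_ring] ring_closed_add[OF F0_ring])
    then have "w = - c" by (simp add: eq_neg_iff_add_eq_0)
    then show False using w(3) c(1) ring_closed_uminus[OF field_closed_ring[OF k(1)]] by simp
  qed
  ultimately show ?thesis using that[OF dim] by simp
qed

text \<open>The affine curve with coordinate ring \<open>\<rat>[x, w]\<close>, realised in \<open>F\<close>, and its projection to the \<open>x\<close>-line.\<close>

locale plane_curve = embedded_field F F0 j
  for F :: "'f ring" and F0 :: "'e::field_char_0 set" and j :: "'e \<Rightarrow> 'f" +
  fixes x w :: 'e
  assumes F0_def: "F0 = fractions (adjoin (adjoin \<rat> x) w)"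
    and x_transcendental: "\<And>c. ev c x = 0 \<Longrightarrow> c = 0"
    and w_algebraic: "alg_over (rat_functions x) w"
    and w_irrational: "w \<notin> rat_functions x"
begin

definition \<iota> :: "'a::field_char_0 \<Rightarrow> 'f" where
  "\<iota> c = j (rat_embed c)"

definition coord_ring :: "'e set" where
  "coord_ring = adjoin (adjoin \<rat> x) w"

definition model :: "'f set set" where
  "model = affine_model F (j ` coord_ring)"

lemma coord_ring: "ring_closed coord_ring" "\<rat> \<subseteq> coord_ring" "x \<in> coord_ring" "w \<in> coord_ring" "coord_ring \<subseteq> F0"
proof -
  note 1 = ring_closed_adjoin[OF ring_closed_Rats, of x]
  show R: "ring_closed coord_ring" unfolding coord_ring_def by (rule ring_closed_adjoin[OF 1])
  show "\<rat> \<subseteq> coord_ring" unfolding coord_ring_def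
    using adjoin_superset[OF ring_closed_Rats] adjoin_superset[OF 1] by blast
  show "x \<in> coord_ring" unfolding coord_ring_def
    using adjoin_self[OF ring_closed_Rats] adjoin_superset[OF 1] by blast
  show "w \<in> coord_ring" unfolding coord_ring_def by (rule adjoin_self[OF 1])
  show "coord_ring \<subseteq> F0" unfolding F0_def coord_ring_def[symmetric] by (rule fractions_superset[OF R])
qed

lemma \<iota>_of_rat [simp]: "\<iota> (of_rat r) = j (of_rat r)"
  by (simp add: \<iota>_def)

lemma \<iota>_image: "\<iota> ` (\<rat> :: 'a::field_char_0 set) = j ` \<rat>"
  unfolding Rats_def by (auto simp: image_image)

lemma \<iota>_hom: "\<iota> \<in> ring_hom (rational_field :: 'a::field_char_0 ring) F"
proof (rule ring_hom_memI)
  have in0: "of_rat r \<in> F0" for r using coord_ring(2,5) by (meson Rats_of_rat subsetD)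
  show "\<iota> \<one>\<^bsub>(rational_field :: 'a ring)\<^esub> = \<one>\<^bsub>F\<^esub>"
    using \<iota>_of_rat[of 1, where ?'a = 'a] by (simp add: j_one)
  fix a b :: 'a assume "a \<in> carrier rational_field" "b \<in> carrier rational_field"
  then obtain r s where rs: "a = of_rat r" "b = of_rat s" by (auto elim!: Rats_cases)
  show "\<iota> a \<in> carrier F" using rs in0 by (simp add: j_in)
  show "\<iota> (a \<otimes>\<^bsub>rational_field\<^esub> b) = \<iota> a \<otimes>\<^bsub>F\<^esub> \<iota> b"
    using rs in0 by (simp add: j_mult of_rat_mult[symmetric])
  show "\<iota> (a \<oplus>\<^bsub>rational_field\<^esub> b) = \<iota> a \<oplus>\<^bsub>F\<^esub> \<iota> b"
    using rs in0 by (simp add: j_add of_rat_add[symmetric])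
qed

lemma generate_coord_ring: "generate_ring F (j ` (\<rat> \<union> {x, w})) = j ` coord_ring"
proof (rule generate_ring_j)
  show "coord_ring \<subseteq> B" if "ring_closed B" "\<rat> \<union> {x, w} \<subseteq> B" for B
    using that unfolding coord_ring_def by (intro adjoin_least) simp_all
qed (use coord_ring in auto)

lemma generated_subfield_x:
  "generated_subfield (rational_field :: 'a::field_char_0 ring) F \<iota> [j x] = j ` rat_functions x"
proof -
  have "\<iota> ` carrier (rational_field :: 'a ring) \<union> set [j x] = j ` (\<rat> \<union> {x})"
    by (simp add: \<iota>_image image_Un)
  moreover have "generate_field F (j ` (\<rat> \<union> {x})) = j ` rat_functions x"
    using Rats_least[OF field_closed_rat_functions, of x] rat_functions_self coord_ring
    by (intro generate_field_j field_closed_rat_functions rat_functions_least F0) auto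
  ultimately show ?thesis by (simp add: generated_subfield_def)
qed

lemma base_field: "field_closed (rat_functions x)" "rat_functions x \<subseteq> F0"
  and base_least: "field_closed B \<Longrightarrow> rat_functions x \<subseteq> B \<Longrightarrow> w \<in> B \<Longrightarrow> F0 \<subseteq> B"
proof -
  show "field_closed (rat_functions x)" by (rule field_closed_rat_functions)
  show "rat_functions x \<subseteq> F0" using coord_ring by (intro rat_functions_least F0) auto
  assume B: "field_closed B" "rat_functions x \<subseteq> B" "w \<in> B"
  then have "adjoin \<rat> x \<subseteq> B"
    using rat_functions_self Rats_least[OF B(1)] by (intro adjoin_least field_closed_ring) auto
  then show "F0 \<subseteq> B"
    unfolding F0_def by (intro fractions_least[OF B(1)] adjoin_least[OF field_closed_ring[OF B(1)] _ B(3)])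
qed

lemma subring_coord: "subring (j ` coord_ring) F"
  using coord_ring by (intro subring_j)

text \<open>The curve is covered by one affine chart, so separatedness is that of an affine
  model.\<close>

lemma curve_variety: "irreducible_variety (rational_field :: 'a::field_char_0 ring) F \<iota> model"
  unfolding irreducible_variety_def
proof (intro conjI)
  show "field F" by (rule field_F)
  show "\<iota> \<in> ring_hom (rational_field :: 'a ring) F" by (rule \<iota>_hom)
  show "\<forall>O1\<in>model. \<forall>O2\<in>model. \<forall>V. valuation_subring F V \<and> dominates F V O1 \<and> dominates F V O2 \<longrightarrow> O1 = O2"
    using affine_model_separated[OF field_F subring_coord] by (auto simp: model_def)
  have gen: "generate_field F (j ` coord_ring) = carrier F"
    unfolding carrier_F
  proof (rule generate_field_j[OF F0 subset_refl coord_ring(5)])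
    show "F0 \<subseteq> B" if "field_closed B" "coord_ring \<subseteq> B" for B
      using that unfolding F0_def coord_ring_def by (rule fractions_least)
  qed
  have "\<iota> ` carrier (rational_field :: 'a ring) \<union> {j x, j w} = j ` (\<rat> \<union> {x, w})"
    by (simp add: \<iota>_image image_Un)
  then have "j ` coord_ring = generate_ring F (\<iota> ` carrier (rational_field :: 'a ring) \<union> {j x, j w})"
    using generate_coord_ring by metis
  moreover have "{j x, j w} \<subseteq> carrier F" using coord_ring by (auto simp: carrier_F)
  ultimately have "\<exists>G. finite G \<and> G \<subseteq> carrier F \<and> j ` coord_ring = generate_ring F (\<iota> ` carrier (rational_field :: 'a ring) \<union> G)"
    by (intro exI[of _ "{j x, j w}"]) simp
  then show "\<exists>\<A>. finite \<A> \<and> \<A> \<noteq> {} \<and> model = (\<Union>R\<in>\<A>. affine_model F R) \<and>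
        (\<forall>R\<in>\<A>. (\<exists>G. finite G \<and> G \<subseteq> carrier F \<and> R = generate_ring F (\<iota> ` carrier (rational_field :: 'a ring) \<union> G)) \<and>
                  generate_field F R = carrier F)"
    using gen by (intro exI[of _ "{j ` coord_ring}"]) (simp add: model_def)
qed

lemma curve_independent: "alg_independent (rational_field :: 'a::field_char_0 ring) F \<iota> [j x]"
  using coord_ring x_transcendental by (intro alg_independent_1) auto

lemma curve_dimension_1: "has_trdeg (rational_field :: 'a::field_char_0 ring) F \<iota> 1"
  unfolding has_trdeg_def
proof (intro exI[of _ "[j x]"] conjI ballI)
  show "alg_independent (rational_field :: 'a ring) F \<iota> [j x]" by (rule curve_independent)
  fix y assume y: "y \<in> carrier F"
  have kF: "subfield (j ` rat_functions x) F" by (rule subfield_j[OF base_field])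
  have wF0: "w \<in> F0" using coord_ring by auto
  obtain d where "F.dimension d (j ` rat_functions x) (carrier F)"
    using dimension_ge_2[OF base_field wF0 w_algebraic w_irrational base_least] by blast
  then have "F.finite_dimension (j ` rat_functions x) (carrier F)" by (rule F.finite_dimensionI)
  then have "(F.algebraic over (j ` rat_functions x)) y"
    using F.finite_dimension_imp_algebraic[OF kF F.carrier_is_subring] y by blast
  then show "\<not> F.transcendental (generated_subfield (rational_field :: 'a ring) F \<iota> [j x]) y"
    by (simp add: generated_subfield_x over_def)
qed simp

lemma curve_degree:
  obtains d where "has_degree (rational_field :: 'a::field_char_0 ring) F \<iota> [j x] d" "d \<ge> 2"
proof -
  have wF0: "w \<in> F0" using coord_ring by auto
  obtain d where "F.dimension d (j ` rat_functions x) (carrier F)" "d \<ge> 2"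
    using dimension_ge_2[OF base_field wF0 w_algebraic w_irrational base_least] by blast
  then show ?thesis using that[of d] by (simp add: has_degree_def generated_subfield_x)
qed

lemma curve_morphism: "morphism_to_affine model 1 [j x]"
proof -
  have "j x \<in> M" if "M \<in> model" for M
    using that local_ring_superset[OF field_F subring_coord] coord_ring(3) by (auto simp: model_def affine_model_def)
  then show ?thesis by (simp add: morphism_to_affine_def)
qed

text \<open>By \<open>spec\<close>, evaluation at \<open>(x0, w0)\<close> is well defined on the
  coordinate ring. Its kernel \<open>P\<close> is the point sought: the residue of a fraction in the
  local ring is the quotient of two rational values.\<close>

lemma curve_point:
  fixes x0 w0 :: "'a::field_char_0"
  assumes rat: "x0 \<in> \<rat>" "w0 \<in> \<rat>" and spec: "\<And>f. ev2 f x w = 0 \<Longrightarrow> ev2 f x0 w0 = 0"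
  shows "[x0] \<in> image_of_rational_points (rational_field :: 'a ring) F \<iota> model 1 [j x]"
proof -
  have cr: "coord_ring = range (\<lambda>f. ev2 f x w)" unfolding coord_ring_def by (rule adjoin2_Rats)
  have crF: "ev2 f x w \<in> F0" for f using coord_ring(5) cr by auto
  define P where "P = {j (ev2 f x w) | f. ev2 f x0 w0 = 0}"
  have P_iff: "j (ev2 f x w) \<in> P \<longleftrightarrow> ev2 f x0 w0 = 0" for f
  proof
    assume "j (ev2 f x w) \<in> P"
    then obtain g where g: "j (ev2 f x w) = j (ev2 g x w)" "ev2 g x0 w0 = 0" by (auto simp: P_def)
    then have "ev2 (f - g) x w = 0" using crF by (simp add: j_eq_iff ev2_diff)
    then have "ev2 (f - g) x0 w0 = 0" by (rule spec)
    then show "ev2 f x0 w0 = 0" using g by (simp add: ev2_diff)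
  qed (auto simp: P_def)
  have PR: "P \<subseteq> j ` coord_ring" by (auto simp: P_def cr)
  have jm: "j (ev2 f x w) \<otimes>\<^bsub>F\<^esub> j (ev2 g x w) = j (ev2 (f * g) x w)" for f g
    using crF by (simp add: j_mult ev2_mult)
  have jd: "j (ev2 f x w) \<ominus>\<^bsub>F\<^esub> j (ev2 g x w) = j (ev2 (f - g) x w)" for f g
    using crF by (simp add: j_diff ev2_diff)
  have ja: "j (ev2 f x w) \<oplus>\<^bsub>F\<^esub> j (ev2 g x w) = j (ev2 (f + g) x w)" for f g
    using crF by (simp add: j_add hom_on_add[OF ring_closed_UNIV ring_hom_on_ev2])
  let ?R = "F\<lparr>carrier := j ` coord_ring\<rparr>"
  have cringR: "cring ?R"
    using F.subcring_iff[OF subringE(1)[OF subring_coord]] F.subcringI'[OF subring_coord] by blast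
  interpret R: cring ?R by (rule cringR)
  have prime: "primeideal P ?R"
  proof (rule primeidealI)
    show "ideal P ?R"
    proof (rule idealI)
      show "ring ?R" by (rule R.ring_axioms)
      show "subgroup P (add_monoid ?R)"
      proof (rule R.add.subgroupI)
        show "P \<subseteq> carrier ?R" using PR by simp
        show "P \<noteq> {}" using P_iff[of 0] by (auto simp: ev2_0)
        fix a assume "a \<in> P"
        then obtain f where f: "a = j (ev2 f x w)" "ev2 f x0 w0 = 0" by (auto simp: P_def)
        have "\<ominus>\<^bsub>?R\<^esub> a = j (ev2 (- f) x w)"
          by (rule R.minus_equality)
            (use f cr in \<open>auto simp: ja ev2_0 j_zero intro!: range_eqI\<close>)
        then show "\<ominus>\<^bsub>?R\<^esub> a \<in> P"
          using P_iff[of "- f"] f by (simp add: hom_on_uminus[OF ring_closed_UNIV ring_hom_on_ev2])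
        fix b assume "b \<in> P"
        then obtain g where g: "b = j (ev2 g x w)" "ev2 g x0 w0 = 0" by (auto simp: P_def)
        show "a \<oplus>\<^bsub>?R\<^esub> b \<in> P"
          using f g P_iff[of "f + g"] by (simp add: ja hom_on_add[OF ring_closed_UNIV ring_hom_on_ev2])
      qed
    next
      fix a b assume "a \<in> P" "b \<in> carrier ?R"
      then obtain f g where "a = j (ev2 f x w)" "ev2 f x0 w0 = 0" "b = j (ev2 g x w)" by (auto simp: P_def cr)
      then show "b \<otimes>\<^bsub>?R\<^esub> a \<in> P" "a \<otimes>\<^bsub>?R\<^esub> b \<in> P"
        using P_iff[of "f * g"] P_iff[of "g * f"] by (simp_all add: jm ev2_mult)
    qed
    show "cring ?R" by (rule cringR)
    have "j (ev2 1 x w) \<in> carrier ?R" using cr by auto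
    moreover have "j (ev2 1 x w) \<notin> P" unfolding P_iff by (simp add: ev2_1)
    ultimately show "carrier ?R \<noteq> P" by metis
    fix a b assume ab: "a \<in> carrier ?R" "b \<in> carrier ?R" "a \<otimes>\<^bsub>?R\<^esub> b \<in> P"
    then obtain f g where fg: "a = j (ev2 f x w)" "b = j (ev2 g x w)" by (auto simp: cr)
    then have "ev2 (f * g) x0 w0 = 0" using ab(3) P_iff[of "f * g"] by (simp add: jm)
    then show "a \<in> P \<or> b \<in> P" using P_iff[of f] P_iff[of g] fg by (simp add: ev2_mult)
  qed
  define M where "M = local_ring_at F (j ` coord_ring) P"
  have M: "M \<in> model" using prime by (auto simp: M_def model_def affine_model_def)
  note nonunit = local_ring_nonunit[OF field_F subring_coord prime, folded M_def]
  obtain r where r: "x0 = of_rat r" using rat by (auto elim: Rats_cases)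
  have ev2Q: "ev2 f x0 w0 \<in> \<rat>" for f
    using adjoin2_Rats[of x0 w0] rat adjoin_least[OF field_closed_ring[OF field_closed_Rats]]
    by (metis order_refl rangeI subsetD)
  have "M \<in> rational_points (rational_field :: 'a ring) F \<iota> model"
    unfolding rational_points_def
  proof (intro CollectI conjI ballI)
    show "M \<in> model" by (rule M)
    fix y assume "y \<in> M"
    then obtain a s where as: "y \<in> carrier F" "a \<in> j ` coord_ring" "s \<in> j ` coord_ring" "s \<notin> P" "y \<otimes>\<^bsub>F\<^esub> s = a"
      by (auto simp: M_def local_ring_at_def)
    obtain f g where fg: "a = j (ev2 f x w)" "s = j (ev2 g x w)" using as cr by auto
    have g0: "ev2 g x0 w0 \<noteq> 0" using as(4) P_iff fg by simp
    define c where "c = ev2 f x0 w0 / ev2 g x0 w0"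
    have cQ: "c \<in> \<rat>" unfolding c_def using ev2Q by simp
    then obtain q where q: "c = of_rat q" by (auto elim: Rats_cases)
    have \<iota>c: "\<iota> c = j (ev2 [:[:q:]:] x w)" by (simp add: q ev2_const ev_const)
    \<comment> \<open>The numerator of \<open>y - c\<close>; it vanishes at \<open>(x0, w0)\<close>
      by the choice of \<open>c\<close>.\<close>
    define h where "h = f - [:[:q:]:] * g"
    have h0: "ev2 h x0 w0 = 0" using g0 by (simp add: h_def ev2_diff ev2_mult ev2_const ev_const q[symmetric] c_def del: mult_pCons_left)
    have F: "\<iota> c \<in> carrier F" "s \<in> carrier F" using crF by (auto simp: \<iota>c fg carrier_F)
    have "(y \<ominus>\<^bsub>F\<^esub> \<iota> c) \<otimes>\<^bsub>F\<^esub> s = (y \<otimes>\<^bsub>F\<^esub> s) \<ominus>\<^bsub>F\<^esub> (\<iota> c \<otimes>\<^bsub>F\<^esub> s)"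
      using as(1) F by (simp add: a_minus_def F.l_distr F.l_minus)
    also have "\<dots> = j (ev2 h x w)" unfolding as(5) unfolding fg \<iota>c jm jd h_def ..
    finally have eq: "(y \<ominus>\<^bsub>F\<^esub> \<iota> c) \<otimes>\<^bsub>F\<^esub> s = j (ev2 h x w)" .
    have "y \<ominus>\<^bsub>F\<^esub> \<iota> c \<in> max_ideal_of F M"
      using nonunit[OF _ as(3,4) _ eq] P_iff h0 as(1) F cr by auto
    then show "\<exists>c\<in>carrier (rational_field :: 'a ring). y \<ominus>\<^bsub>F\<^esub> \<iota> c \<in> max_ideal_of F M" using cQ by auto
  qed
  moreover have "j x \<ominus>\<^bsub>F\<^esub> \<iota> x0 \<in> max_ideal_of F M"
  proof -
    have eq: "j x \<ominus>\<^bsub>F\<^esub> \<iota> x0 = j (ev2 [:[:- r, 1:]:] x w)"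
      using jd[of "[:[:0, 1:]:]" "[:[:r:]:]"] by (simp add: ev2_const ev_const ev_var r)
    have "ev2 [:[:- r, 1:]:] x0 w0 = 0" by (simp add: ev2_const ev_def map_poly_pCons r of_rat_minus)
    then show ?thesis
      using max_ideal_of_local_ring_iff[OF field_F subring_coord prime, folded M_def, of "j (ev2 [:[:- r, 1:]:] x w)"] P_iff cr
      by (auto simp: eq)
  qed
  ultimately show ?thesis
    using rat by (auto simp: image_of_rational_points_def affine_space_def)
qed

end

section \<open>Thin sets and generic sequences\<close>

lemma countable_poly: "countable (UNIV :: 'c set) \<Longrightarrow> countable (UNIV :: 'c::zero poly set)"
proof -
  assume "countable (UNIV :: 'c set)"
  then have "countable (range (Poly :: 'c list \<Rightarrow> 'c poly))"
    by (intro countable_image) (metis countable_lists lists_UNIV)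
  moreover have "range (Poly :: 'c list \<Rightarrow> 'c poly) = UNIV"
    by (metis Poly_coeffs surjI)
  ultimately show ?thesis by simp
qed

lemma countable_rat_poly_poly: "countable (S :: rat poly poly set)"
  by (rule countable_subset[OF subset_UNIV], intro countable_poly) (rule countableI_type)

lemma clear_denominators:
  fixes g :: "'b::field poly"
  assumes A: "ring_closed A"
  shows "coeffs_in (fractions A) g \<Longrightarrow> \<exists>d\<in>A. d \<noteq> 0 \<and> coeffs_in A (smult d g)"
proof (induction g)
  case 0
  then show ?case using ring_closed_1[OF A] by (intro bexI[of _ 1]) (auto simp: coeffs_in_0[OF A])
next
  case (pCons a g)
  obtain d where d: "d \<in> A" "d \<noteq> 0" "coeffs_in A (smult d g)" using pCons by (auto simp: coeffs_in_pCons_iff)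
  obtain b c where bc: "a = b / c" "b \<in> A" "c \<in> A" "c \<noteq> 0" using pCons.prems by (auto simp: coeffs_in_pCons_iff fractions_def)
  have "coeffs_in A (smult c (smult d g))" by (rule coeffs_in_smult[OF A bc(3) d(3)])
  moreover have "c * d * a = d * b" using bc by simp
  ultimately show ?case
    using bc d by (intro bexI[of _ "c * d"]) (auto simp: coeffs_in_pCons_iff intro!: ring_closed_mult[OF A])
qed

definition root_set :: "rat poly poly \<Rightarrow> 'a::field_char_0 set" where
  "root_set f = {x0 \<in> \<rat>. \<exists>w0\<in>\<rat>. ev2 f x0 w0 = 0}"

text \<open>The zero set of \<open>X - q\<close>, where \<open>X\<close> is the monomial
  \<open>{#0#}\<close> and the constant monomial is \<open>{#}\<close>.\<close>

lemma thin_type1_singleton: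
  fixes q :: "'a::field_char_0"
  assumes q: "q \<in> \<rat>"
  shows "thin_type1 (rational_field :: 'a ring) 1 {[q]}"
proof -
  let ?K = "rational_field :: 'a ring"
  interpret K: field ?K by (rule field_rational_field)
  have "(\<lambda>c. c) \<in> ring_iso (type_ring\<lparr>carrier := \<rat>\<rparr>) ?K"
    by (simp add: ring_iso_def ring_hom_def bij_betw_def rational_field_def)
  then interpret E: embedded_field ?K "\<rat> :: 'a set" "\<lambda>c. c"
    by (intro embedded_field.intro field_rational_field field_closed_Rats)
  define p :: "nat multiset \<Rightarrow> 'a"
    where "p = K.indexed_padd (K.indexed_pmult (K.indexed_const 1) 0) (K.indexed_const (- q))"
  have p: "p m = (if m = {#0#} then 1 else if m = {#} then - q else 0)" for m :: "nat multiset"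
  proof -
    have "m - {#0#} = {#} \<and> 0 \<in># m \<longleftrightarrow> m = {#0#}"
      by (metis Diff_eq_empty_iff_mset diff_empty insert_DiffM mset_subset_eq_single subset_mset.antisym union_single_eq_member add_mset_eq_single diff_single_trivial)
    then show ?thesis by (auto simp: p_def K.indexed_padd_def K.indexed_pmult_def K.indexed_const_def)
  qed
  have pP: "p \<in> polys ?K 1"
    unfolding polys_def p_def using q
    by (intro K.indexed_pset.indexed_padd K.indexed_pset.indexed_pmult K.indexed_pset.indexed_const) auto
  have val: "poly_value ?K ?K (\<lambda>c. c) p [c] = c - q" if c: "c \<in> \<rat>" for c
  proof -
    have "poly_value ?K ?K (\<lambda>c. c) p [c] = (\<Sum>m | p m \<noteq> 0. rat_embed (p m) * c ^ count m 0)"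
      by (rule E.poly_value_1[OF pP _ c order_refl]) simp
    also have "\<dots> = (\<Sum>m\<in>{{#}, {#0#}}. rat_embed (p m) * c ^ count m 0)"
    proof (rule sum.mono_neutral_left)
      have "rat_embed (0::'a) = (0::'a)" using rat_embed_of_rat[of 0, where ?'a = 'a and ?'b = 'a] by simp
      then show "\<forall>m\<in>{{#}, {#0#}} - {m. p m \<noteq> 0}. rat_embed (p m) * c ^ count m 0 = 0" by auto
      show "{m. p m \<noteq> 0} \<subseteq> {{#}, {#0#}}" using p by (auto split: if_splits)
    qed simp
    also have "\<dots> = c - q"
    proof -
      obtain r where "q = of_rat r" using q by (auto elim: Rats_cases)
      then have "rat_embed (- q) = - q" using rat_embed_of_rat[of "- r", where ?'a = 'a and ?'b = 'a] by (simp add: of_rat_minus)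
      moreover have "rat_embed (1::'a) = (1::'a)" using rat_embed_of_rat[of 1, where ?'a = 'a and ?'b = 'a] by simp
      ultimately show ?thesis by (simp add: p)
    qed
    finally show ?thesis .
  qed
  show ?thesis
    unfolding thin_type1_def
  proof (intro exI[of _ "{p}"] conjI)
    show "{p} \<subseteq> polys ?K 1" using pP by simp
    show "\<exists>p\<in>{p}. p \<noteq> (\<lambda>_. \<zero>\<^bsub>?K\<^esub>)" using p[of "{#0#}"] by (metis rational_field_sel(5) singletonI zero_neq_one)
    show "{[q]} = {as \<in> affine_space ?K 1. \<forall>p\<in>{p}. poly_value ?K ?K (\<lambda>c. c) p as = \<zero>\<^bsub>?K\<^esub>}"
      using q by (auto simp: affine_space_def length_Suc_conv val)
  qed
qed

lemma thin_Union:
  assumes "finite \<T>" "\<And>T. T \<in> \<T> \<Longrightarrow> thin K n T" "S \<subseteq> \<Union>\<T>"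
  shows "thin K n S"
proof -
  have "\<forall>T\<in>\<T>. \<exists>\<C>. finite \<C> \<and> T \<subseteq> \<Union>\<C> \<and> (\<forall>Z\<in>\<C>. thin_type1 K n Z \<or> thin_type2 K n Z)"
    using assms(2) by (simp add: thin_def)
  then obtain c where c: "\<And>T. T \<in> \<T> \<Longrightarrow> finite (c T) \<and> T \<subseteq> \<Union>(c T) \<and> (\<forall>Z\<in>c T. thin_type1 K n Z \<or> thin_type2 K n Z)"
    by metis
  have "S \<subseteq> \<Union>(\<Union>(c ` \<T>))"
  proof
    fix s assume "s \<in> S"
    then obtain T where "T \<in> \<T>" "s \<in> T" using assms(3) by blast
    then show "s \<in> \<Union>(\<Union>(c ` \<T>))" using c[of T] by blast
  qed
  moreover have "S \<subseteq> affine_space K n" using assms(2,3) unfolding thin_def by blast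
  moreover have "finite (\<Union>(c ` \<T>))" using assms(1) c by blast
  moreover have "\<forall>Z\<in>\<Union>(c ` \<T>). thin_type1 K n Z \<or> thin_type2 K n Z" using c by blast
  ultimately show ?thesis unfolding thin_def by blast
qed

lemma thin_finite:
  fixes S :: "'a::field_char_0 set"
  assumes "finite S" "S \<subseteq> \<rat>"
  shows "thin (rational_field :: 'a ring) 1 ((\<lambda>q. [q]) ` S)"
  unfolding thin_def
proof (intro conjI exI[of _ "(\<lambda>q. {[q]}) ` S"])
  show "\<forall>Z\<in>(\<lambda>q. {[q]}) ` S. thin_type1 (rational_field :: 'a ring) 1 Z \<or> thin_type2 (rational_field :: 'a ring) 1 Z"
    using thin_type1_singleton assms by auto
qed (use assms in \<open>auto simp: affine_space_def\<close>)

lemma finite_ev_roots: "p \<noteq> 0 \<Longrightarrow> finite {x. ev p x = 0}"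
  unfolding ev_def by (intro poly_roots_finite) (simp add: map_poly_eq_0_iff)

text \<open>Take for \<open>f\<close> a relation of \<open>w\<close> of least degree. Apart from the
  finitely many zeros of its leading coefficient, a rational zero of \<open>f\<close> is a rational
  point of the curve with coordinate ring \<rat>[x, w], whose projection to the line has degree at
  least 2 because \<open>w\<close> is outside \<rat>(x).\<close>

lemma root_set_thin:
  fixes x w :: "'e::field_char_0"
  assumes x: "\<And>c. ev c x = 0 \<Longrightarrow> c = 0"
    and w: "alg_over (rat_functions x) w" "w \<notin> rat_functions x"
  shows "\<exists>f. ev2 f x w = 0 \<and> thin (rational_field :: 'a::field_char_0 ring) 1 ((\<lambda>q::'a. [q]) ` root_set f)"
proof -
  define A where "A = adjoin \<rat> x"
  have A: "ring_closed A" unfolding A_def by (rule ring_closed_adjoin[OF ring_closed_Rats])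
  obtain g where g: "coeffs_in (fractions A) g" "g \<noteq> 0" "poly g w = 0"
    using w by (auto simp: A_def rat_functions_def alg_over_def annihilates_def)
  obtain d where d: "d \<in> A" "d \<noteq> 0" "coeffs_in A (smult d g)" using clear_denominators[OF A g(1)] by blast
  obtain f0 where f0: "smult d g = map_poly (\<lambda>p. ev p x) f0"
    using coeffs_in_range[of "\<lambda>p. ev p x" UNIV "smult d g"] d(3) by (metis A_def UNIV_I adjoin_Rats ev_0)
  have "f0 \<noteq> 0"
  proof
    assume "f0 = 0"
    then have "smult d g = 0" using f0 by simp
    then show False using d g by simp
  qed
  moreover have "ev2 f0 x w = 0" using g by (simp add: ev2_def f0[symmetric])
  ultimately have "f0 \<noteq> 0 \<and> ev2 f0 x w = 0" by blast
  then obtain f where f: "f \<noteq> 0" "ev2 f x w = 0" and min: "\<And>h. h \<noteq> 0 \<Longrightarrow> ev2 h x w = 0 \<Longrightarrow> degree f \<le> degree h"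
    using ex_has_least_nat[of "\<lambda>f. f \<noteq> 0 \<and> ev2 f x w = 0" f0 degree] by blast
  define F0 where "F0 = fractions (adjoin (adjoin \<rat> x) w)"
  have F0: "field_closed F0" unfolding F0_def
    by (intro field_closed_fractions ring_closed_adjoin ring_closed_Rats)
  have "F0 \<subseteq> (\<lambda>(f, g). ev2 f x w / ev2 g x w) ` UNIV"
    unfolding F0_def adjoin2_Rats fractions_def by force
  \<comment> \<open>Countability allows \<open>F0\<close> to be copied into the natural numbers of
    \<open>'a\<close>.\<close>
  then have "countable F0"
    using countable_rat_poly_poly by (metis countable_SIGMA UNIV_Times_UNIV countable_image countable_subset)
  \<comment> \<open>\<open>thin_type2\<close> wants the function field to be carried by the type \<open>'a\<close>.\<close>
  define i where "i a = (of_nat (to_nat_on F0 a) :: 'a)" for a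
  have inj: "inj_on i F0"
    using inj_on_to_nat_on[OF \<open>countable F0\<close>] by (auto simp: inj_on_def i_def)
  let ?E = "type_ring\<lparr>carrier := F0\<rparr>" and ?K = "rational_field :: 'a ring"
  define F where "F = image_ring i ?E"
  interpret TR: field "type_ring :: 'e ring" by (rule field_from_type_algebra)
  interpret E: field ?E using TR.subfield_iff(2) F0 by (simp add: subfield_type_ring_iff)
  interpret C: plane_curve F F0 i x w
  proof (intro plane_curve.intro embedded_field.intro plane_curve_axioms.intro)
    show "field F" unfolding F_def using E.inj_imp_image_ring_is_field[of i] inj by simp
    show "i \<in> ring_iso ?E F" unfolding F_def using inj_imp_image_ring_iso[of i ?E] inj by simp
  qed (fact F0 F0_def x w)+
  define Z where "Z = image_of_rational_points ?K F C.\<iota> C.model 1 [i x]"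
  obtain e where "has_degree ?K F C.\<iota> [i x] e" "e \<ge> 2" by (rule C.curve_degree)
  then have "thin_type2 ?K 1 Z"
    unfolding thin_type2_def Z_def
    using C.curve_variety C.curve_dimension_1 C.curve_morphism C.curve_independent
    by (intro exI[of _ F] exI[of _ C.\<iota>] exI[of _ C.model] exI[of _ "[i x]"] exI[of _ e]) (auto simp: dominant_def)
  \<comment> \<open>Division by \<open>f\<close> costs a power of its leading coefficient, a
    polynomial in \<open>x\<close>. Where this does not vanish, every relation of
    \<open>(x, w)\<close> holds at a zero of \<open>f\<close>.\<close>
  have spec: "ev2 h x0 w0 = 0" if x0: "ev2 f x0 w0 = 0" "ev (lead_coeff f) x0 \<noteq> 0" and h: "ev2 h x w = 0"
    for h and x0 w0 :: 'a
  proof -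
    obtain N q r where qr: "smult (lead_coeff f ^ N) h = f * q + r" "r = 0 \<or> degree r < degree f"
      using pseudo_division_in[OF ring_closed_UNIV coeffs_in_UNIV f(1) coeffs_in_UNIV] by blast
    have eq: "ev (lead_coeff f ^ N) u * ev2 h u v = ev2 f u v * ev2 q u v + ev2 r u v" for u v :: 'a
      using arg_cong[OF qr(1), of "\<lambda>f. ev2 f u v"] ev2_mult[of "[:lead_coeff f ^ N:]" h u v]
      by (simp add: ev2_const ev2_mult hom_on_add[OF ring_closed_UNIV ring_hom_on_ev2])
    have eq': "ev (lead_coeff f ^ N) x * ev2 h x w = ev2 f x w * ev2 q x w + ev2 r x w"
      using arg_cong[OF qr(1), of "\<lambda>f. ev2 f x w"] ev2_mult[of "[:lead_coeff f ^ N:]" h x w]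
      by (simp add: ev2_const ev2_mult hom_on_add[OF ring_closed_UNIV ring_hom_on_ev2])
    have "ev2 r x w = 0" using eq' h f(2) by simp
    then have "r = 0" using qr(2) min[of r] by force
    moreover have "ev (lead_coeff f ^ N) x0 = ev (lead_coeff f) x0 ^ N"
      by (rule hom_on_power[OF ring_closed_UNIV ring_hom_on_ev]) simp
    ultimately show ?thesis using eq[of x0 w0] x0 by (simp add: ev2_0)
  qed
  define bad where "bad = {x0 \<in> \<rat>. ev (lead_coeff f) x0 = (0 :: 'a)}"
  have "finite bad" unfolding bad_def
    using finite_ev_roots[of "lead_coeff f", where ?'a = 'a] f(1) by (auto intro: rev_finite_subset)
  have "(\<lambda>q::'a. [q]) ` root_set f \<subseteq> \<Union>(insert Z ((\<lambda>q. {[q]}) ` bad))"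
  proof
    fix as assume "as \<in> (\<lambda>q::'a. [q]) ` root_set f"
    then obtain x0 w0 where x0: "as = [x0]" "x0 \<in> \<rat>" "w0 \<in> \<rat>" "ev2 f x0 w0 = 0" by (auto simp: root_set_def)
    show "as \<in> \<Union>(insert Z ((\<lambda>q. {[q]}) ` bad))"
    proof (cases "x0 \<in> bad")
      case False
      then have "ev (lead_coeff f) x0 \<noteq> 0" using x0 by (auto simp: bad_def)
      then have "[x0] \<in> Z"
        unfolding Z_def by (rule C.curve_point[OF x0(2,3) spec[OF x0(4)]])
      then show ?thesis using x0 by auto
    qed (use x0 in auto)
  qed
  moreover have "\<forall>Y\<in>insert Z ((\<lambda>q. {[q]}) ` bad). thin_type1 ?K 1 Y \<or> thin_type2 ?K 1 Y"
    using \<open>thin_type2 ?K 1 Z\<close> thin_type1_singleton by (auto simp: bad_def)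
  moreover have "(\<lambda>q::'a. [q]) ` root_set f \<subseteq> affine_space ?K 1" by (auto simp: root_set_def affine_space_def)
  ultimately have "thin ?K 1 ((\<lambda>q::'a. [q]) ` root_set f)"
    using \<open>finite bad\<close> unfolding thin_def by (intro conjI exI[of _ "insert Z ((\<lambda>q. {[q]}) ` bad)"]) auto
  then show ?thesis using f(2) by blast
qed

section \<open>Sequences of rationals that avoid thin root sets\<close>

lemma ev_star: "ev p (star_n W) = star_n (\<lambda>n. ev p (W n))"
  unfolding ev_def
  by (rule poly_star[of _ _ "degree p"]) (simp_all add: coeff_map_poly star_of_rat degree_map_poly_le flip: star_of_def)

lemma ev2_star: "ev2 f (star_n V) (star_n W) = star_n (\<lambda>n. ev2 f (V n) (W n))"
  unfolding ev2_def
  by (rule poly_star[of _ _ "degree f"]) (simp_all add: coeff_map_poly ev_0 ev_star degree_map_poly_le star_n_simps(1)[symmetric])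

lemma transcendental_star:
  fixes x :: "'a::{alg_closed_field,field_char_0} star"
  assumes alg: "\<And>c::'a. algebraic c" and x: "\<And>c. ev c x = 0 \<Longrightarrow> c = 0"
  shows "\<not> alg_over (range star_of) x"
proof
  assume a: "alg_over (range star_of) x"
  have "star_of c \<in> alg_elements \<rat>" for c :: 'a
    using alg_over_Rats_star_of[OF alg] by (simp add: alg_elements_def)
  then have "alg_over (alg_elements \<rat>) x" using alg_over_mono[OF a] by blast
  then have "alg_over \<rat> x" by (rule alg_over_trans[OF field_closed_Rats])
  then obtain p where p: "coeffs_in \<rat> p" "p \<noteq> 0" "poly p x = 0" by (auto simp: alg_over_def annihilates_def)
  then obtain q where q: "p = map_poly of_rat q"
    using coeffs_in_range[of of_rat UNIV p] unfolding Rats_def by (metis UNIV_I of_rat_0)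
  then have "q = 0" using x[of q] p(3) by (simp add: ev_def)
  then show False using q p(2) by simp
qed

text \<open>There are only countably many root sets, so a sequence can leave all thin ones among them.\<close>

lemma generic_sequence:
  fixes S :: "'a::{alg_closed_field,field_char_0} set"
  assumes alg: "\<And>c::'a. algebraic c" and S: "S \<subseteq> \<rat>"
    and not_thin: "\<not> thin (rational_field :: 'a ring) 1 ((\<lambda>q. [q]) ` S)"
  shows "\<exists>x. (\<forall>n. x n \<in> S) \<and> \<not> alg_over (range star_of) (star_n x) \<and>
    (\<forall>w\<in>star_set \<rat>. alg_over (rat_functions (star_n x)) w \<longrightarrow> w \<in> rat_functions (star_n x))"
proof -
  define \<T> where "\<T> = {f. thin (rational_field :: 'a ring) 1 ((\<lambda>q::'a. [q]) ` root_set f)}"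
  \<comment> \<open>Constant polynomials in the outer variable have finite root sets. Avoiding these
    is what makes \<open>star_n x\<close> transcendental.\<close>
  have const: "[:p:] \<in> \<T>" if "p \<noteq> 0" for p
  proof -
    have "root_set [:p:] \<subseteq> {x::'a. ev p x = 0}" by (auto simp: root_set_def ev2_const)
    then have "finite (root_set [:p:] :: 'a set)" using finite_ev_roots[OF that] finite_subset by blast
    then have "thin (rational_field :: 'a ring) 1 ((\<lambda>q::'a. [q]) ` root_set [:p:])"
      by (rule thin_finite) (auto simp: root_set_def)
    then show ?thesis by (simp add: \<T>_def)
  qed
  then have "\<T> \<noteq> {}" using one_neq_zero by blast
  then have range: "range (from_nat_into \<T>) = \<T>"
    using countable_rat_poly_poly by (rule range_from_nat_into)
  \<comment> \<open>The entry \<open>n\<close> can avoid the first \<open>n + 1\<close> root sets,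
    since otherwise finitely many thin sets would cover \<open>S\<close>.\<close>
  have "\<exists>q. q \<in> S \<and> (\<forall>i\<le>n. q \<notin> root_set (from_nat_into \<T> i))" for n
  proof (rule ccontr)
    assume no: "\<not> ?thesis"
    have "thin (rational_field :: 'a ring) 1 ((\<lambda>q. [q]) ` S)"
    proof (rule thin_Union)
      show "finite ((\<lambda>i. (\<lambda>q::'a. [q]) ` root_set (from_nat_into \<T> i)) ` {..n})" by simp
      show "thin (rational_field :: 'a ring) 1 T"
        if "T \<in> (\<lambda>i. (\<lambda>q::'a. [q]) ` root_set (from_nat_into \<T> i)) ` {..n}" for T
        using that from_nat_into[OF \<open>\<T> \<noteq> {}\<close>] by (auto simp: \<T>_def)
      show "(\<lambda>q. [q]) ` S \<subseteq> \<Union>((\<lambda>i. (\<lambda>q::'a. [q]) ` root_set (from_nat_into \<T> i)) ` {..n})"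
      proof
        fix as assume "as \<in> (\<lambda>q. [q]) ` S"
        then obtain q where q: "as = [q]" "q \<in> S" by blast
        then obtain i where "i \<le> n" "q \<in> root_set (from_nat_into \<T> i)" using no by blast
        then show "as \<in> \<Union>((\<lambda>i. (\<lambda>q::'a. [q]) ` root_set (from_nat_into \<T> i)) ` {..n})" using q by blast
      qed
    qed
    then show False using not_thin by blast
  qed
  then obtain x where x: "\<And>n. x n \<in> S" "\<And>n i. i \<le> n \<Longrightarrow> x n \<notin> root_set (from_nat_into \<T> i)" by metis
  have avoid: "eventually (\<lambda>n. x n \<notin> root_set f) ultra" if f: "f \<in> \<T>" for f
  proof -
    obtain i where "f = from_nat_into \<T> i" using f range by (metis imageE)
    then have "{n. \<not> x n \<notin> root_set f} \<subseteq> {..<i}" using x(2)[of i] by (auto simp: not_le[symmetric])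
    then have "finite {n. \<not> x n \<notin> root_set f}" by (rule finite_subset) simp
    then show ?thesis by (rule ultra_cofinite)
  qed
  \<comment> \<open>A zero with rational entries would put \<open>x n\<close> into the root set of
    \<open>f\<close> for almost all \<open>n\<close>.\<close>
  have no_root: "ev2 f (star_n x) (star_n W) \<noteq> 0" if f: "f \<in> \<T>" and W: "\<And>n. W n \<in> \<rat>" for f W
  proof
    assume "ev2 f (star_n x) (star_n W) = 0"
    then have "eventually (\<lambda>n. ev2 f (x n) (W n) = 0) ultra"
      by (simp add: ev2_star star_n_simps(1) star_n_eq_iff)
    moreover have "x n \<in> root_set f" if "ev2 f (x n) (W n) = 0" for n
      using that W[of n] subsetD[OF S x(1)[of n]] unfolding root_set_def by blast
    ultimately have "eventually (\<lambda>n. x n \<in> root_set f) ultra" by (rule eventually_mono)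
    then have "eventually (\<lambda>n. False) ultra"
      using avoid[OF f] by eventually_elim simp
    then show False by simp
  qed
  have trans: "c = 0" if "ev c (star_n x) = 0" for c
    using no_root[OF const, of c "\<lambda>_. 0"] that by (auto simp: ev2_const)
  have "w \<in> rat_functions (star_n x)" if w: "w \<in> star_set \<rat>" "alg_over (rat_functions (star_n x)) w" for w
  proof (rule ccontr)
    assume "w \<notin> rat_functions (star_n x)"
    then obtain f where "ev2 f (star_n x) w = 0" "f \<in> \<T>"
      using root_set_thin[OF trans, where ?'a = 'a] w(2) unfolding \<T>_def by blast
    moreover obtain W where "w = star_n W" "\<And>n. W n \<in> \<rat>" using w(1) by (auto simp: star_set_def)
    ultimately show False using no_root by blast
  qed
  then show ?thesis using x(1) transcendental_star[OF alg trans] by blast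
qed

section \<open>The topology of the space of subfields\<close>

lemma subfields_iff: "L \<in> subfields \<longleftrightarrow> field_closed L"
  by (simp add: subfields_def subfield_type_ring_iff)

lemma qf_sat_cong:
  assumes "\<And>i. i \<in> qf_vars \<phi> \<Longrightarrow> e i = e' i"
  shows "qf_sat e \<phi> = qf_sat e' \<phi>"
proof -
  have "qval (\<lambda>x. x) e \<phi> = qval (\<lambda>x. x) e' \<phi>"
    using assms qf_atoms_vars[of _ \<phi>] by (intro qval_atoms_cong arg_cong2[of _ _ _ _ "(=)"] tval_cong) auto
  then show ?thesis by (simp add: qval_id)
qed

text \<open>A rational outside \<open>A\<close> lies in \<open>L\<close> but not in the set that
  \<open>\<phi>\<close> defines there. The resulting failures are the points \<open>E n\<close>,
  whose first coordinates are distinct because \<open>c\<close> is injective.\<close>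

lemma nearby_failure:
  fixes A :: "'a::{alg_closed_field,field_char_0} set"
  assumes alg: "\<And>c::'a. algebraic c" and coinfinite: "infinite (\<rat> - A)"
    and not_thin: "\<not> thin (rational_field :: 'a ring) 1 ((\<lambda>q. [q]) ` (A \<inter> \<rat>))"
    and L: "field_closed L" and D: "finite D"
    and \<phi>: "set_qf_formula \<phi> \<subseteq> L" "qf_vars \<phi> \<subseteq> {..k}"
    and def: "A \<inter> L = {x \<in> L. \<forall>ys. length ys = k \<and> set ys \<subseteq> L \<longrightarrow> qf_sat (\<lambda>i. (x # ys) ! i) \<phi>}"
  shows "\<exists>F x ys. field_closed F \<and> F \<inter> D = L \<inter> D \<and> x \<in> A \<inter> \<rat> \<and> length ys = k \<and> set ys \<subseteq> F \<and>
    \<not> qf_sat (\<lambda>i. (x # ys) ! i) \<phi>"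
proof -
  have QL: "\<rat> \<subseteq> L" by (rule Rats_least[OF L])
  obtain c :: "nat \<Rightarrow> 'a" where c: "inj c" "range c \<subseteq> \<rat> - A"
    using infinite_countable_subset[OF coinfinite] by blast
  have "\<exists>ys. length ys = k \<and> set ys \<subseteq> L \<and> \<not> qf_sat (\<lambda>i. (c n # ys) ! i) \<phi>" for n
  proof -
    have "c n \<in> L" "c n \<notin> A \<inter> L" using c(2) QL by auto
    then show ?thesis unfolding def by blast
  qed
  then obtain ys where ys: "\<And>n. length (ys n) = k" "\<And>n. set (ys n) \<subseteq> L"
    "\<And>n. \<not> qf_sat (\<lambda>i. (c n # ys n) ! i) \<phi>" by metis
  define E where "E n i = (c n # ys n) ! i" for n i
  have EL: "E n i \<in> L" if "i \<le> k" for n i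
  proof -
    have "E n i \<in> set (c n # ys n)" unfolding E_def using that ys(1)[of n] by (intro nth_mem) simp
    then show ?thesis using ys(2)[of n] c(2) QL by auto
  qed
  have inj: "inj (\<lambda>n. E n 0)" using c(1) by (simp add: E_def)
  have false: "\<not> qf_sat (E n) \<phi>" for n using ys(3)[of n] by (simp add: E_def[abs_def])
  obtain m z where z: "z 0 = fps_const (E m 0) + fps_X" "\<And>i. i \<le> k \<Longrightarrow> z i \<in> fps_over L" "alg_tower z k"
    "\<not> qval fps_const z \<phi>"
    using power_series_point[OF L EL inj \<phi> false] by blast
  obtain x where x: "\<And>n. x n \<in> A \<inter> \<rat>" "\<not> alg_over (range star_of) (star_n x)"
    "\<And>w. w \<in> star_set \<rat> \<Longrightarrow> alg_over (rat_functions (star_n x)) w \<Longrightarrow> w \<in> rat_functions (star_n x)"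
    using generic_sequence[OF alg _ not_thin] by blast
  have xQ: "x n \<in> \<rat>" for n using x(1) by blast
  obtain n F e where e: "field_closed F" "F \<inter> D = L \<inter> D" "\<And>i. i \<le> k \<Longrightarrow> e i \<in> F" "e 0 = x n" "\<not> qf_sat e \<phi>"
    using rational_specialisation[OF alg L z(1,2,3) \<phi> z(4) D xQ x(2,3)] by blast
  define us where "us = map (\<lambda>i. e (Suc i)) [0..<k]"
  have "(x n # us) ! i = e i" if "i \<le> k" for i
    using that e(4) by (cases i) (simp_all add: us_def)
  then have "qf_sat (\<lambda>i. (x n # us) ! i) \<phi> = qf_sat e \<phi>"
    using \<phi>(2) by (intro qf_sat_cong) auto
  moreover have "length us = k" "set us \<subseteq> F" using e(3) by (auto simp: us_def)
  ultimately show ?thesis using e x(1)[of n] by blast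
qed

lemma topspace_subfield_topology: "topspace subfield_topology = subfields"
  by (simp add: subfield_topology_def topspace_pullback_topology)

lemma openin_subfield_topology_basic:
  assumes D: "finite D"
  shows "openin subfield_topology {L \<in> subfields. L \<inter> D = B \<inter> D}"
proof -
  let ?T = "product_topology (\<lambda>_. discrete_topology (UNIV :: bool set)) (UNIV :: 'a set)"
  define U where "U = PiE UNIV (\<lambda>d. if d \<in> D then {d \<in> B} else (UNIV :: bool set))"
  have "openin ?T U"
    unfolding U_def
  proof (rule product_topology_basis)
    show "finite {d. (if d \<in> D then {d \<in> B} else UNIV) \<noteq> topspace (discrete_topology (UNIV :: bool set))}"
      by (rule finite_subset[OF _ D]) auto
  qed simp
  moreover have "{L \<in> subfields. L \<inter> D = B \<inter> D} = (\<lambda>L x. x \<in> L) -` U \<inter> subfields"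
  proof -
    have "L \<inter> D = B \<inter> D \<longleftrightarrow> (\<forall>d\<in>D. d \<in> L \<longleftrightarrow> d \<in> B)" for L by blast
    then show ?thesis unfolding U_def PiE_UNIV_domain by (auto split: if_splits)
  qed
  ultimately show ?thesis
    unfolding subfield_topology_def openin_pullback_topology by blast
qed

lemma subfield_topology_nbhd:
  assumes "openin subfield_topology W" "L \<in> W"
  obtains D where "finite D" "{M \<in> subfields. M \<inter> D = L \<inter> D} \<subseteq> W"
proof -
  let ?T = "product_topology (\<lambda>_. discrete_topology (UNIV :: bool set)) (UNIV :: 'a set)"
  obtain U where U: "openin ?T U" "W = (\<lambda>L x. x \<in> L) -` U \<inter> subfields"
    using assms(1) unfolding subfield_topology_def openin_pullback_topology by blast
  then have "(\<lambda>x. x \<in> L) \<in> U" using assms(2) by blast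
  then obtain V where V: "finite {i. V i \<noteq> (UNIV :: bool set)}" "(\<lambda>x. x \<in> L) \<in> PiE UNIV V" "PiE UNIV V \<subseteq> U"
    using U(1) unfolding openin_product_topology_alt by fastforce
  define D where "D = {i. V i \<noteq> UNIV}"
  have "M \<in> W" if M: "M \<in> subfields" "M \<inter> D = L \<inter> D" for M
  proof -
    have "(x \<in> M) \<in> V x" for x
    proof (cases "x \<in> D")
      case True
      then have "x \<in> M \<longleftrightarrow> x \<in> L" using M(2) by blast
      then show ?thesis using V(2) by (auto simp: PiE_UNIV_domain)
    qed (simp add: D_def)
    then have "(\<lambda>x. x \<in> M) \<in> U" using V(3) by (auto simp: PiE_UNIV_domain)
    then show ?thesis using U(2) M(1) by simp
  qed
  then show ?thesis using that[of D] V(1) by (auto simp: D_def)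
qed

text \<open>An open set inside the closure contains all fields that agree on some \<open>D\<close>
  with a member \<open>K\<close> of \<open>N\<close>. The field \<open>M\<close> found near
  \<open>K\<close> is then in the closure as well, although a neighbourhood of \<open>M\<close>
  misses \<open>N\<close>. Thus only members of \<open>N\<close> have to be treated, not its
  limits.\<close>

lemma nowhere_dense_in_subfield_topology:
  assumes N: "N \<subseteq> subfields"
    and nearby: "\<And>L D. L \<in> N \<Longrightarrow> finite D \<Longrightarrow>
      \<exists>M\<in>subfields. M \<inter> D = L \<inter> D \<and> (\<exists>E. finite E \<and> (\<forall>K\<in>N. K \<inter> E \<noteq> M \<inter> E))"
  shows "nowhere_dense_in subfield_topology N"
  unfolding nowhere_dense_in_def
proof (intro conjI)
  show "N \<subseteq> topspace subfield_topology" using N by (simp add: topspace_subfield_topology)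
  have dense: "\<exists>K\<in>N. K \<inter> E = M \<inter> E" if M: "M \<in> subfield_topology closure_of N" and E: "finite E" for M E
  proof -
    have "M \<in> {L \<in> subfields. L \<inter> E = M \<inter> E}" using M closure_of_subset_topspace[of subfield_topology N]
      by (auto simp: topspace_subfield_topology)
    moreover have "\<forall>T. M \<in> T \<and> openin subfield_topology T \<longrightarrow> (\<exists>y. y \<in> N \<and> y \<in> T)"
      using M by (simp add: in_closure_of)
    ultimately obtain K where "K \<in> N" "K \<in> {L \<in> subfields. L \<inter> E = M \<inter> E}"
      using openin_subfield_topology_basic[OF E, of M] by meson
    then show ?thesis by blast
  qed
  show "subfield_topology interior_of (subfield_topology closure_of N) = {}"
  proof (rule ccontr)
    assume "\<not> ?thesis"
    then obtain L W where W: "openin subfield_topology W" "W \<subseteq> subfield_topology closure_of N" "L \<in> W"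
      unfolding interior_of_def by blast
    obtain D where D: "finite D" "{M \<in> subfields. M \<inter> D = L \<inter> D} \<subseteq> W"
      using subfield_topology_nbhd[OF W(1,3)] by blast
    have "L \<in> subfield_topology closure_of N" using W(2,3) by (rule subsetD)
    then obtain K where K: "K \<in> N" "K \<inter> D = L \<inter> D" using dense D(1) by blast
    obtain M E where M: "M \<in> subfields" "M \<inter> D = K \<inter> D" "finite E" "\<forall>K\<in>N. K \<inter> E \<noteq> M \<inter> E"
      using nearby[OF K(1) D(1)] by blast
    have "M \<in> {M \<in> subfields. M \<inter> D = L \<inter> D}" using M(1,2) K(2) by simp
    then have "M \<in> subfield_topology closure_of N" using D(2) W(2) by (meson subsetD)
    then show False using dense M(3,4) by blast
  qed
qed

lemma countable_algebraic:
  assumes "\<forall>x::'a::field_char_0. algebraic x"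
  shows "countable (UNIV :: 'a set)"
proof -
  have "x \<in> (\<Union>p\<in>UNIV - {0}. {x. ev p x = 0})" for x :: 'a
  proof -
    obtain p where p: "coeffs_in \<rat> p" "p \<noteq> 0" "poly p x = 0"
      using alg_over_Rats assms by (auto simp: alg_over_def annihilates_def)
    then obtain q where "p = map_poly of_rat q"
      using coeffs_in_range[of of_rat UNIV p] unfolding Rats_def by (metis UNIV_I of_rat_0)
    then show ?thesis using p by (intro UN_I[of q]) (auto simp: ev_def)
  qed
  moreover have "countable (\<Union>p\<in>UNIV - {0}. {x :: 'a. ev p x = 0})"
  proof (rule countable_UN)
    show "countable (UNIV - {0 :: rat poly})"
      by (rule countable_subset[OF subset_UNIV countable_poly]) (rule countableI_type)
    show "countable {x :: 'a. ev p x = 0}" if "p \<in> UNIV - {0}" for p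
      using finite_ev_roots[of p] that by (intro countable_finite) simp
  qed
  ultimately show ?thesis by (metis UNIV_I countable_subset subsetI)
qed

instance rterm :: (countable) countable
  by countable_datatype

instance qf_formula :: (countable) countable
  by countable_datatype

text \<open>Renaming the parameters along an injection into the natural numbers reduces to formulas
  over a countable type.\<close>

lemma countable_qf_formula:
  assumes "countable (UNIV :: 'a set)"
  shows "countable (UNIV :: 'a qf_formula set)"
proof (rule countableI')
  have "inj (to_nat_on (UNIV :: 'a set))" using inj_on_to_nat_on[OF assms] .
  then have "inj (map_qf_formula (to_nat_on (UNIV :: 'a set)))" by (rule qf_formula.inj_map)
  then show "inj_on (map_qf_formula (to_nat_on (UNIV :: 'a set))) UNIV" .
qed

definition defined_by :: "'a::field set \<Rightarrow> nat \<Rightarrow> 'a qf_formula \<Rightarrow> 'a set set" where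
  "defined_by A k \<phi> = {L \<in> subfields. set_qf_formula \<phi> \<subseteq> L \<and> qf_vars \<phi> \<subseteq> {..k} \<and>
     A \<inter> L = {x \<in> L. \<forall>ys. length ys = k \<and> set ys \<subseteq> L \<longrightarrow> qf_sat (\<lambda>i. (x # ys) ! i) \<phi>}}"

theorem theorem1p1:
  fixes A :: "'a::{alg_closed_field, field_char_0} set"
  assumes algebraic_closure_of_rationals: "\<forall>x::'a. algebraic x"
    and coinfinite: "infinite (\<rat> - A)"
    and not_thin: "\<not> thin (rational_field :: 'a ring) 1 ((\<lambda>q. [q]) ` (A \<inter> \<rat>))"
  shows "meager_in subfield_topology {L \<in> subfields. universally_definable L (A \<inter> L)}"
proof -
  have nd: "nowhere_dense_in subfield_topology (defined_by A k \<phi>)" for k \<phi>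
  proof (rule nowhere_dense_in_subfield_topology)
    show "defined_by A k \<phi> \<subseteq> subfields" by (auto simp: defined_by_def)
    fix L and D :: "'a set" assume L: "L \<in> defined_by A k \<phi>" and D: "finite D"
    obtain F x ys where F: "field_closed F" "F \<inter> D = L \<inter> D" "x \<in> A \<inter> \<rat>" "length ys = k" "set ys \<subseteq> F"
      "\<not> qf_sat (\<lambda>i. (x # ys) ! i) \<phi>"
      using nearby_failure[OF _ coinfinite not_thin _ D, of L \<phi> k] algebraic_closure_of_rationals L
      unfolding defined_by_def subfields_iff by blast
    \<comment> \<open>A field that contains \<open>ys\<close> also contains the rational
      \<open>x\<close>, and quantifier-free truth does not depend on the field; so
      \<open>\<phi>\<close> fails there at a point of \<open>A\<close>.\<close>
    have "K \<inter> set ys \<noteq> F \<inter> set ys" if K: "K \<in> defined_by A k \<phi>" for K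
    proof
      assume "K \<inter> set ys = F \<inter> set ys"
      then have "set ys \<subseteq> K" using F(5) by blast
      moreover have "x \<in> A \<inter> K" using F(3) K Rats_least[of K] by (auto simp: defined_by_def subfields_iff)
      ultimately show False using K F(4,6) unfolding defined_by_def by blast
    qed
    then show "\<exists>M\<in>subfields. M \<inter> D = L \<inter> D \<and> (\<exists>E. finite E \<and> (\<forall>K\<in>defined_by A k \<phi>. K \<inter> E \<noteq> M \<inter> E))"
      using F(1,2) by (intro bexI[of _ F] conjI exI[of _ "set ys"]) (auto simp: subfields_iff)
  qed
  define I where "I = (UNIV :: (nat \<times> 'a qf_formula) set)"
  have I: "countable I" "I \<noteq> {}"
    unfolding I_def UNIV_Times_UNIV[symmetric]
    by (intro countable_SIGMA countableI_type countable_qf_formula countable_algebraic algebraic_closure_of_rationals) simp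
  have "{L \<in> subfields. universally_definable L (A \<inter> L)} = (\<Union>i\<in>I. defined_by A (fst i) (snd i))"
  proof -
    have "universally_definable L (A \<inter> L) \<longleftrightarrow> (\<exists>k \<phi>. L \<in> defined_by A k \<phi>)" if "L \<in> subfields" for L
      using that by (simp add: universally_definable_def defined_by_def)
    moreover have "defined_by A k \<phi> \<subseteq> subfields" for k \<phi> by (auto simp: defined_by_def)
    ultimately show ?thesis by (auto simp: I_def)
  qed
  also have "\<dots> = (\<Union>n. defined_by A (fst (from_nat_into I n)) (snd (from_nat_into I n)))"
    using image_image[of "\<lambda>i. defined_by A (fst i) (snd i)" "from_nat_into I" UNIV]
    by (simp only: range_from_nat_into[OF I(2,1)])
  finally show ?thesis
    unfolding meager_in_def using nd
    by (intro exI[of _ "\<lambda>n. defined_by A (fst (from_nat_into I n)) (snd (from_nat_into I n))"]) auto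
qed

end
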